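(* Let $A=kQ$ be a dg path algebra where $\#Q_0<\infty$ and $Q_1^{>0}=\emptyset$. Assume $\#Q_1^{-d}<\infty$ for each $d\ge0$ and that the differential of every arrow $\alpha\in Q_1$ lies in $kQ_{\ge2}$. Then for all $i,j\in Q_0$ and $d\ge0$, $$\dim_k\mathrm{Ext}^{d+1}_A(S_i,S_j)=\#\{\alpha\colon j\to i\ \mid\ \alpha\in Q_1,\ |\alpha|=-d\}.$$
   Context: $k$ is an arbitrary field. A dg path algebra is a dg $k$-algebra whose underlying graded algebra is the path algebra $kQ$ of a graded quiver $Q$ (each arrow $\alpha$ has a degree $|\alpha|\in\mathbb Z$); $Q_1^{m}$ (resp. $Q_1^{>0}$) is the set of arrows of degree $m$ (resp. positive degree), and $kQ_{\ge2}$ is the span of paths of length at least $2$. Paths are composed so that $e_{t(\alpha)}\,\alpha\,e_{s(\alpha)}=\alpha$ for an arrow $\alpha\colon s(\alpha)\to t(\alpha)$, where $e_i$ is the idempotent at the vertex $i$. $S_i:=ke_i$ is the one-dimensional simple right module at the vertex $i$ (all arrows act by zero), viewed as a right dg $A$-module in degree $0$. $\mathrm{Ext}^n_A(X,Y):=\mathsf{D}(A)(X,Y[n])$, where $\mathsf{D}(A)$ is the derived category of right dg $A$-modules. *)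

theory Defs
  imports
    "Jordan_Normal_Form.VS_Connect"
    "Graph_Theory.Arc_Walk"
    "HOL-Library.Equipollence"
begin

section \<open>Differential graded algebras and modules\<close>

text \<open>
  The ground field is a type of class \<open>field\<close>, seen as a ring record through
  \<open>class_ring\<close>. Gradings are internal and cohomological. As usual in HOL-Algebra, the ring
  multiplication and unit fields of a record are ignored when it only serves as a vector space.
\<close>

record ('k, 'm) dg_space = "('k, 'm) module" +
  component :: "int \<Rightarrow> 'm set"
  differential :: "'m \<Rightarrow> 'm"

locale dg_space = vectorspace "class_ring :: 'k::field ring" V
  for V :: "('k::field, 'm, 'z) dg_space_scheme" (structure) +
  assumes component_submodule: "LinearCombinations.submodule class_ring (component V n) V"
    and decomposition: "x \<in> carrier V \<Longrightarrow>
      \<exists>!c. (\<forall>n. c n \<in> component V n) \<and> finite {n. c n \<noteq> \<zero>\<^bsub>V\<^esub>} \<and> x = finsum V c {n. c n \<noteq> \<zero>\<^bsub>V\<^esub>}"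
    and differential_linear: "differential V \<in> LinearCombinations.module_hom class_ring V V"
    and differential_degree: "x \<in> component V n \<Longrightarrow> differential V x \<in> component V (n + 1)"
    and differential_square: "x \<in> carrier V \<Longrightarrow> differential V (differential V x) = \<zero>\<^bsub>V\<^esub>"

locale dg_algebra = dg_space A + R?: ring A
  for A :: "('k::field, 'a, 'z) dg_space_scheme" (structure) +
  assumes smult_mult_left: "x \<in> carrier A \<Longrightarrow> y \<in> carrier A \<Longrightarrow>
      (c \<odot>\<^bsub>A\<^esub> x) \<otimes>\<^bsub>A\<^esub> y = c \<odot>\<^bsub>A\<^esub> (x \<otimes>\<^bsub>A\<^esub> y)"
    and smult_mult_right: "x \<in> carrier A \<Longrightarrow> y \<in> carrier A \<Longrightarrow>
      x \<otimes>\<^bsub>A\<^esub> (c \<odot>\<^bsub>A\<^esub> y) = c \<odot>\<^bsub>A\<^esub> (x \<otimes>\<^bsub>A\<^esub> y)"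
    and one_degree: "\<one>\<^bsub>A\<^esub> \<in> component A 0"
    and mult_degree: "x \<in> component A m \<Longrightarrow> y \<in> component A n \<Longrightarrow>
      x \<otimes>\<^bsub>A\<^esub> y \<in> component A (m + n)"
    and leibniz: "x \<in> component A m \<Longrightarrow> y \<in> carrier A \<Longrightarrow>
      differential A (x \<otimes>\<^bsub>A\<^esub> y) =
        differential A x \<otimes>\<^bsub>A\<^esub> y \<oplus>\<^bsub>A\<^esub> ((-1) powi m) \<odot>\<^bsub>A\<^esub> (x \<otimes>\<^bsub>A\<^esub> differential A y)"

record ('k, 'm, 'a) dg_module = "('k, 'm) dg_space" +
  act :: "'m \<Rightarrow> 'a \<Rightarrow> 'm"

locale dg_right_module = A: dg_algebra A + M: dg_space M
  for A :: "('k::field, 'a) dg_space" and M :: "('k, 'm, 'a) dg_module" +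
  assumes act_closed: "x \<in> carrier M \<Longrightarrow> a \<in> carrier A \<Longrightarrow> act M x a \<in> carrier M"
    and act_add_left: "x \<in> carrier M \<Longrightarrow> y \<in> carrier M \<Longrightarrow> a \<in> carrier A \<Longrightarrow>
      act M (x \<oplus>\<^bsub>M\<^esub> y) a = act M x a \<oplus>\<^bsub>M\<^esub> act M y a"
    and act_add_right: "x \<in> carrier M \<Longrightarrow> a \<in> carrier A \<Longrightarrow> b \<in> carrier A \<Longrightarrow>
      act M x (a \<oplus>\<^bsub>A\<^esub> b) = act M x a \<oplus>\<^bsub>M\<^esub> act M x b"
    and act_smult_left: "x \<in> carrier M \<Longrightarrow> a \<in> carrier A \<Longrightarrow>
      act M (c \<odot>\<^bsub>M\<^esub> x) a = c \<odot>\<^bsub>M\<^esub> act M x a"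
    and act_smult_right: "x \<in> carrier M \<Longrightarrow> a \<in> carrier A \<Longrightarrow>
      act M x (c \<odot>\<^bsub>A\<^esub> a) = c \<odot>\<^bsub>M\<^esub> act M x a"
    and act_mult: "x \<in> carrier M \<Longrightarrow> a \<in> carrier A \<Longrightarrow> b \<in> carrier A \<Longrightarrow>
      act M x (a \<otimes>\<^bsub>A\<^esub> b) = act M (act M x a) b"
    and act_one: "x \<in> carrier M \<Longrightarrow> act M x \<one>\<^bsub>A\<^esub> = x"
    and act_degree: "x \<in> component M m \<Longrightarrow> a \<in> component A n \<Longrightarrow> act M x a \<in> component M (m + n)"
    and act_leibniz: "x \<in> component M m \<Longrightarrow> a \<in> carrier A \<Longrightarrow>
      differential M (act M x a) =
        act M (differential M x) a \<oplus>\<^bsub>M\<^esub> ((-1) powi m) \<odot>\<^bsub>M\<^esub> act M x (differential A a)"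

text \<open>No sign enters the action on a shifted right module.\<close>

definition shift :: "int \<Rightarrow> ('k::field, 'm, 'a) dg_module \<Rightarrow> ('k, 'm, 'a) dg_module" where
  "shift n M = M\<lparr>component := (\<lambda>m. component M (m + n)),
                 differential := (\<lambda>x. ((-1) powi n) \<odot>\<^bsub>M\<^esub> differential M x)\<rparr>"

section \<open>Morphisms, homotopies and quasi-isomorphisms\<close>

definition graded_hom :: "('k::field, 'a) dg_space \<Rightarrow> int \<Rightarrow> ('k, 'm, 'a) dg_module \<Rightarrow>
    ('k, 'n, 'a) dg_module \<Rightarrow> ('m \<Rightarrow> 'n) set" where
  "graded_hom A p M N = {f \<in> LinearCombinations.module_hom class_ring M N.
     (\<forall>x\<in>carrier M. \<forall>a\<in>carrier A. f (act M x a) = act N (f x) a) \<and>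
     (\<forall>m. \<forall>x\<in>component M m. f x \<in> component N (m + p))}"

definition dg_hom :: "('k::field, 'a) dg_space \<Rightarrow> ('k, 'm, 'a) dg_module \<Rightarrow>
    ('k, 'n, 'a) dg_module \<Rightarrow> ('m \<Rightarrow> 'n) set" where
  "dg_hom A M N = {f \<in> graded_hom A 0 M N.
     \<forall>x\<in>carrier M. f (differential M x) = differential N (f x)}"

definition homotopic :: "('k::field, 'a) dg_space \<Rightarrow> ('k, 'm, 'a) dg_module \<Rightarrow>
    ('k, 'n, 'a) dg_module \<Rightarrow> ('m \<Rightarrow> 'n) \<Rightarrow> ('m \<Rightarrow> 'n) \<Rightarrow> bool" where
  "homotopic A M N f g \<longleftrightarrow> (\<exists>h\<in>graded_hom A (-1) M N. \<forall>x\<in>carrier M.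
     f x \<ominus>\<^bsub>N\<^esub> g x = differential N (h x) \<oplus>\<^bsub>N\<^esub> h (differential M x))"

definition cocycles :: "('k, 'm, 'z) dg_space_scheme \<Rightarrow> int \<Rightarrow> 'm set" where
  "cocycles V n = {x \<in> component V n. differential V x = \<zero>\<^bsub>V\<^esub>}"

definition coboundaries :: "('k, 'm, 'z) dg_space_scheme \<Rightarrow> int \<Rightarrow> 'm set" where
  "coboundaries V n = differential V ` component V (n - 1)"

definition coh_class :: "('k, 'm, 'z) dg_space_scheme \<Rightarrow> int \<Rightarrow> 'm \<Rightarrow> 'm set" where
  "coh_class V n x = {y \<in> cocycles V n. y \<ominus>\<^bsub>V\<^esub> x \<in> coboundaries V n}"

definition cohomology :: "('k, 'm, 'z) dg_space_scheme \<Rightarrow> int \<Rightarrow> 'm set set" where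
  "cohomology V n = coh_class V n ` cocycles V n"

definition coh_map :: "('k, 'n, 'z) dg_space_scheme \<Rightarrow> int \<Rightarrow> ('m \<Rightarrow> 'n) \<Rightarrow> 'm set \<Rightarrow> 'n set" where
  "coh_map W n f C = (\<Union>x\<in>C. coh_class W n (f x))"

definition quasi_iso :: "('k::field, 'a) dg_space \<Rightarrow> ('k, 'm, 'a) dg_module \<Rightarrow>
    ('k, 'n, 'a) dg_module \<Rightarrow> ('m \<Rightarrow> 'n) \<Rightarrow> bool" where
  "quasi_iso A M N f \<longleftrightarrow> f \<in> dg_hom A M N \<and>
     (\<forall>n. bij_betw (coh_map N n f) (cohomology M n) (cohomology N n))"

section \<open>Morphisms in the derived category\<close>

text \<open>
  The derived category is the localisation of the homotopy category at the quasi-isomorphisms.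
  A morphism from \<open>X\<close> to \<open>Y\<close> is a class of roofs \<open>X \<leftarrow> Z \<rightarrow> Y\<close>, the left leg a
  quasi-isomorphism. The apexes \<open>Z\<close> range over all dg modules whose carrier is a set of elements of
  the type \<open>'u\<close>, which plays the part of the universe. If \<open>'u\<close> is infinite and at least as large
  as \<open>A\<close>, \<open>X\<close> and \<open>Y\<close>, every quasi-isomorphism with target \<open>X\<close> is dominated by one whose source
  is a semi-free module living in \<open>'u\<close>, so that the result does not depend on \<open>'u\<close>.
\<close>

type_synonym ('k, 'u, 'a, 'x, 'y) roof = "('k, 'u, 'a) dg_module \<times> ('u \<Rightarrow> 'x) \<times> ('u \<Rightarrow> 'y)"

definition is_roof :: "('k::field, 'a) dg_space \<Rightarrow> ('k, 'x, 'a) dg_module \<Rightarrow>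
    ('k, 'y, 'a) dg_module \<Rightarrow> ('k, 'u, 'a, 'x, 'y) roof \<Rightarrow> bool" where
  "is_roof A X Y = (\<lambda>(Z, s, f). dg_right_module A Z \<and> quasi_iso A Z X s \<and> f \<in> dg_hom A Z Y)"

definition roof_equiv :: "('k::field, 'a) dg_space \<Rightarrow> ('k, 'x, 'a) dg_module \<Rightarrow>
    ('k, 'y, 'a) dg_module \<Rightarrow> ('k, 'u, 'a, 'x, 'y) roof \<Rightarrow> ('k, 'u, 'a, 'x, 'y) roof \<Rightarrow> bool" where
  "roof_equiv A X Y = (\<lambda>(Z, s, f) (Z', s', f').
     \<exists>(W :: ('k, 'u, 'a) dg_module) g g'. dg_right_module A W \<and>
       g \<in> dg_hom A W Z \<and> g' \<in> dg_hom A W Z' \<and> quasi_iso A W X (s \<circ> g) \<and>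
       homotopic A W X (s \<circ> g) (s' \<circ> g') \<and> homotopic A W Y (f \<circ> g) (f' \<circ> g'))"

definition roof_class :: "('k::field, 'a) dg_space \<Rightarrow> ('k, 'x, 'a) dg_module \<Rightarrow>
    ('k, 'y, 'a) dg_module \<Rightarrow> ('k, 'u, 'a, 'x, 'y) roof \<Rightarrow> ('k, 'u, 'a, 'x, 'y) roof set" where
  "roof_class A X Y r = {r'. is_roof A X Y r' \<and> roof_equiv A X Y r r'}"

text \<open>
  The vector space structure is computed on representatives: two classes are added by
  choosing representatives with the same left leg and adding the right legs.
\<close>

definition derived_hom :: "'u itself \<Rightarrow> ('k::field, 'a) dg_space \<Rightarrow> ('k, 'x, 'a) dg_module \<Rightarrow>
    ('k, 'y, 'a) dg_module \<Rightarrow> ('k, ('k, 'u, 'a, 'x, 'y) roof set) module" where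
  "derived_hom U A X Y =
     \<lparr>carrier = roof_class A X Y ` Collect (is_roof A X Y),
      mult = undefined, one = undefined,
      zero = (\<Union>(Z, s, f)\<in>Collect (is_roof A X Y). roof_class A X Y (Z, s, \<lambda>_. \<zero>\<^bsub>Y\<^esub>)),
      add = (\<lambda>C D. \<Union>(Z, s, f)\<in>C. \<Union>g\<in>{g. (Z, s, g) \<in> D}.
               roof_class A X Y (Z, s, \<lambda>z. f z \<oplus>\<^bsub>Y\<^esub> g z)),
      smult = (\<lambda>c C. \<Union>(Z, s, f)\<in>C. roof_class A X Y (Z, s, \<lambda>z. c \<odot>\<^bsub>Y\<^esub> f z))\<rparr>"

definition Ext :: "'u itself \<Rightarrow> ('k::field, 'a) dg_space \<Rightarrow> int \<Rightarrow> ('k, 'x, 'a) dg_module \<Rightarrow>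
    ('k, 'y, 'a) dg_module \<Rightarrow> ('k, ('k, 'u, 'a, 'x, 'y) roof set) module" where
  "Ext U A n X Y = derived_hom U A X (shift n Y)"

section \<open>Dg path algebras\<close>

text \<open>
  A path is a triple of source, list of arrows and target. The arrows are listed in the order in
  which they are traversed, hence the product \<open>q p\<close> of paths (first \<open>p\<close>, then \<open>q\<close>)
  concatenates the lists in the opposite order. The path algebra consists of the finitely supported
  functions on the set of paths.
\<close>

type_synonym ('v, 'e) path = "'v \<times> 'e list \<times> 'v"

definition paths :: "('v, 'e) pre_digraph \<Rightarrow> ('v, 'e) path set" where
  "paths Q = {(u, p, v). pre_digraph.awalk Q u p v}"

definition path_length :: "('v, 'e) path \<Rightarrow> nat" where
  "path_length = (\<lambda>(u, p, v). length p)"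

definition path_degree :: "('e \<Rightarrow> int) \<Rightarrow> ('v, 'e) path \<Rightarrow> int" where
  "path_degree deg = (\<lambda>(u, p, v). \<Sum>\<alpha>\<leftarrow>p. deg \<alpha>)"

text \<open>The pairs of composable paths \<open>(q, p)\<close> with \<open>q p = r\<close>.\<close>

definition factorizations :: "('v, 'e) pre_digraph \<Rightarrow> ('v, 'e) path \<Rightarrow>
    (('v, 'e) path \<times> ('v, 'e) path) set" where
  "factorizations Q r = {((v, q, w), (u, p, v)) | u p v q w.
     (v, q, w) \<in> paths Q \<and> (u, p, v) \<in> paths Q \<and> r = (u, p @ q, w)}"

definition path_basis :: "('v, 'e) path \<Rightarrow> ('v, 'e) path \<Rightarrow> 'k::field" where
  "path_basis p = (\<lambda>r. if r = p then 1 else 0)"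

definition path_span :: "('v, 'e) path set \<Rightarrow> (('v, 'e) path \<Rightarrow> 'k::field) set" where
  "path_span P = {f. finite {p. f p \<noteq> 0} \<and> {p. f p \<noteq> 0} \<subseteq> P}"

definition dg_path_algebra :: "('v, 'e) pre_digraph \<Rightarrow> ('e \<Rightarrow> int) \<Rightarrow>
    ((('v, 'e) path \<Rightarrow> 'k::field) \<Rightarrow> ('v, 'e) path \<Rightarrow> 'k) \<Rightarrow>
    ('k, ('v, 'e) path \<Rightarrow> 'k) dg_space" where
  "dg_path_algebra Q deg \<delta> =
     \<lparr>carrier = path_span (paths Q),
      mult = (\<lambda>f g r. \<Sum>(q, p)\<in>factorizations Q r. f q * g p),
      one = (\<lambda>r. if r \<in> {(v, [], v) | v. v \<in> verts Q} then 1 else 0),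
      zero = (\<lambda>_. 0),
      add = (\<lambda>f g r. f r + g r),
      smult = (\<lambda>c f r. c * f r),
      component = (\<lambda>n. path_span {p \<in> paths Q. path_degree deg p = n}),
      differential = \<delta>\<rparr>"

definition arrow :: "('v, 'e) pre_digraph \<Rightarrow> 'e \<Rightarrow> ('v, 'e) path \<Rightarrow> 'k::field" where
  "arrow Q \<alpha> = path_basis (tail Q \<alpha>, [\<alpha>], head Q \<alpha>)"

text \<open>
  The simple module \<open>k e\<^sub>i\<close>: the idempotent \<open>e\<^sub>i\<close> acts as the identity, all other
  paths by zero.
\<close>

definition simple_module :: "'v \<Rightarrow>
    ('k::field, ('v, 'e) path \<Rightarrow> 'k, ('v, 'e) path \<Rightarrow> 'k) dg_module" where
  "simple_module i =
     \<lparr>carrier = path_span {(i, [], i)},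
      mult = undefined, one = undefined,
      zero = (\<lambda>_. 0),
      add = (\<lambda>f g r. f r + g r),
      smult = (\<lambda>c f r. c * f r),
      component = (\<lambda>n. if n = 0 then path_span {(i, [], i)} else {\<lambda>_. 0}),
      differential = (\<lambda>_ _. 0),
      act = (\<lambda>x a r. a (i, [], i) * x r)\<rparr>"

end

(*
  Let P be the cone of the inclusion of rad e_i A into e_i A; the projection P -> S_i is a
  quasi-isomorphism. As a graded right module P is free on e_i in degree 0 and on the arrows beta
  ending at i, in degree |beta| - 1. The differential of beta has degree |beta| + 1, and no arrow
  has positive degree, so it only involves arrows of degree greater than |beta|. Hence maps out of P
  can be constructed arrow by arrow, and P -> S_i lifts along every quasi-isomorphism Z -> S_i,
  uniquely up to homotopy. A morphism from S_i to S_j[d+1] in the derived category is therefore a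
  homotopy class of maps P -> S_j[d+1]. By degrees and linearity such a map is an arbitrary choice of
  a scalar for each arrow j -> i of degree -d. As the differentials of arrows lie in kQ_{>=2}, every
  such map commutes with the differentials, and homotopic ones are equal.
*)

theory Submission
  imports Defs
begin

text \<open>Everything is made strict, so that maps are compared by equality. A map of degree -1
  from \<open>P\<close> to \<open>S_i\<close> is zero by degrees, so lifts of the projection can be
  asked to commute with it on the nose, and a roof then yields one map from \<open>P\<close> to the
  shifted \<open>S_j\<close>. Its coefficients on the arrows are a complete invariant of the roof.
  Existence and uniqueness of lifts are one problem: on the radical, solve
  \<open>d \<sigma> - (-1)^q \<sigma> \<delta> = \<tau>\<close> for given \<open>\<tau>\<close> of
  degree \<open>q + 1\<close>. The lift itself is the case \<open>q = -1\<close>, a homotopy between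
  two lifts the case \<open>q = -2\<close>. The value at an arrow involves \<open>\<sigma>\<close>
  on its differential, so maps on the right ideals generated by sets of arrows have to be handled on
  the way. The operations on classes of roofs are unions over representatives. Classes are
  identified with the fibres of the coefficient vector, which makes these unions collapse, and the
  vector space axioms are then transported from column vectors. The universe matters because
  \<open>P\<close> has to be the apex of a roof: pairs of elements of \<open>A\<close> are encoded
  in it.\<close>

section \<open>Dg spaces\<close>

context dg_space
begin

lemma scalar_closed: "x \<in> carrier V \<Longrightarrow> c \<odot> x \<in> carrier V"
  by simp

lemma scalar_add_left: "x \<in> carrier V \<Longrightarrow> (a + b) \<odot> x = a \<odot> x \<oplus> b \<odot> x"
  using smult_l_distr[of a b x] by simp

lemma scalar_add_right: "x \<in> carrier V \<Longrightarrow> y \<in> carrier V \<Longrightarrow> a \<odot> (x \<oplus> y) = a \<odot> x \<oplus> a \<odot> y"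
  using smult_r_distr[of a x y] by simp

lemma scalar_scalar: "x \<in> carrier V \<Longrightarrow> a \<odot> (b \<odot> x) = (a * b) \<odot> x"
  using smult_assoc1[of a b x] by simp

lemma scalar_one: "x \<in> carrier V \<Longrightarrow> 1 \<odot> x = x"
  using smult_one[of x] by simp

lemma scalar_zero_left: "x \<in> carrier V \<Longrightarrow> 0 \<odot> x = \<zero>"
  using scalar_add_left[of x 0 0] by (simp add: M.add.r_cancel_one')

lemma scalar_zero_right: "c \<odot> \<zero> = \<zero>"
  using scalar_add_right[of \<zero> \<zero> c] scalar_closed[of \<zero> c] by (simp add: M.add.r_cancel_one')

lemma neg_eq_scalar: "x \<in> carrier V \<Longrightarrow> \<ominus> x = (-1) \<odot> x"
  using scalar_add_left[of x 1 "-1"]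
  by (metis M.minus_equality M.zero_closed add.commute add.right_inverse scalar_add_left scalar_closed scalar_one scalar_zero_left)

lemma minus_eq_scalar: "x \<in> carrier V \<Longrightarrow> y \<in> carrier V \<Longrightarrow> x \<ominus> y = x \<oplus> (-1) \<odot> y"
  by (simp add: M.minus_eq neg_eq_scalar)

lemma minus_zero_iff: "x \<in> carrier V \<Longrightarrow> y \<in> carrier V \<Longrightarrow> x \<ominus> y = \<zero> \<longleftrightarrow> x = y"
  by (metis M.minus_eq M.a_inv_closed M.minus_equality M.minus_minus M.r_neg)

lemma component_carrier: "x \<in> component V n \<Longrightarrow> x \<in> carrier V"
  using component_submodule[of n] by (auto simp: LinearCombinations.submodule_def)

lemma component_zero: "\<zero> \<in> component V n"
  using component_submodule[of n] by (auto simp: LinearCombinations.submodule_def)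

lemma component_add: "x \<in> component V n \<Longrightarrow> y \<in> component V n \<Longrightarrow> x \<oplus> y \<in> component V n"
  using component_submodule[of n] by (auto simp: LinearCombinations.submodule_def)

lemma component_scalar: "x \<in> component V n \<Longrightarrow> c \<odot> x \<in> component V n"
  using component_submodule[of n] by (auto simp: LinearCombinations.submodule_def)

lemma differential_closed: "x \<in> carrier V \<Longrightarrow> differential V x \<in> carrier V"
  using differential_linear by (auto simp: LinearCombinations.module_hom_def)

lemma differential_add: "x \<in> carrier V \<Longrightarrow> y \<in> carrier V \<Longrightarrow>
    differential V (x \<oplus> y) = differential V x \<oplus> differential V y"
  using differential_linear by (auto simp: LinearCombinations.module_hom_def)

lemma differential_scalar: "x \<in> carrier V \<Longrightarrow> differential V (c \<odot> x) = c \<odot> differential V x"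
  using differential_linear by (auto simp: LinearCombinations.module_hom_def)

lemma differential_zero: "differential V \<zero> = \<zero>"
  using differential_scalar[of \<zero> 0] by (simp add: scalar_zero_left differential_closed)

lemmas scalar_simps = scalar_closed scalar_add_left scalar_add_right scalar_scalar scalar_one
  scalar_zero_left scalar_zero_right

end

subsection \<open>Coordinates\<close>

text \<open>A space identified with the finitely supported functions on a set of homogeneous basis
  elements. It serves both the simple modules, which are function spaces already, and the
  resolution, whose elements are opaque codes: only the conditions on the differential remain to be
  checked for each.\<close>

locale graded_coordinates =
  fixes V :: "('k::field, 'm, 'z) dg_space_scheme" (structure)
    and ev :: "'m \<Rightarrow> 'b \<Rightarrow> 'k" and B :: "'b set" and degree :: "'b \<Rightarrow> int"
  assumes bij: "bij_betw ev (carrier V) {f. finite {b. f b \<noteq> 0} \<and> {b. f b \<noteq> 0} \<subseteq> B}"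
    and zero_mem: "\<zero> \<in> carrier V"
    and add_mem: "x \<in> carrier V \<Longrightarrow> y \<in> carrier V \<Longrightarrow> x \<oplus> y \<in> carrier V"
    and scalar_mem: "x \<in> carrier V \<Longrightarrow> c \<odot> x \<in> carrier V"
    and ev_zero: "ev \<zero> = (\<lambda>_. 0)"
    and ev_add: "x \<in> carrier V \<Longrightarrow> y \<in> carrier V \<Longrightarrow> ev (x \<oplus> y) = (\<lambda>b. ev x b + ev y b)"
    and ev_scalar: "x \<in> carrier V \<Longrightarrow> ev (c \<odot> x) = (\<lambda>b. c * ev x b)"
    and component_iff: "x \<in> component V n \<longleftrightarrow> x \<in> carrier V \<and> (\<forall>b. ev x b \<noteq> 0 \<longrightarrow> degree b = n)"
begin

lemma ev_inj: "x \<in> carrier V \<Longrightarrow> y \<in> carrier V \<Longrightarrow> ev x = ev y \<longleftrightarrow> x = y"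
  using bij by (auto simp: bij_betw_def inj_on_def)

lemma ev_finite: "x \<in> carrier V \<Longrightarrow> finite {b. ev x b \<noteq> 0}"
  using bij by (auto simp: bij_betw_def)

lemma ev_outside: "x \<in> carrier V \<Longrightarrow> b \<notin> B \<Longrightarrow> ev x b = 0"
  using bij by (auto simp: bij_betw_def)

lemma ev_surj: "finite {b. f b \<noteq> 0} \<Longrightarrow> {b. f b \<noteq> 0} \<subseteq> B \<Longrightarrow> \<exists>x\<in>carrier V. ev x = f"
  using bij unfolding bij_betw_def by (metis (mono_tags, lifting) imageE mem_Collect_eq)

lemma vectorspace: "vectorspace class_ring V"
proof -
  have "Module.module class_ring V"
  proof (rule module_criteria)
    show "\<forall>v\<in>carrier V. \<exists>w\<in>carrier V. v \<oplus> w = \<zero>"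
    proof
      fix v assume v: "v \<in> carrier V"
      then have "v \<oplus> (-1) \<odot> v = \<zero>"
        by (subst ev_inj[symmetric]) (auto simp: zero_mem add_mem scalar_mem ev_zero ev_add ev_scalar)
      with v show "\<exists>w\<in>carrier V. v \<oplus> w = \<zero>" using scalar_mem by blast
    qed
  qed (auto simp: ev_inj[symmetric] zero_mem add_mem scalar_mem ev_zero ev_add ev_scalar algebra_simps
      class_cring.cring_axioms)
  then show ?thesis by (simp add: vectorspace_def class_field)
qed

lemma ev_finsum:
  assumes "finite F" "\<And>n. n \<in> F \<Longrightarrow> c n \<in> carrier V"
  shows "finsum V c F \<in> carrier V \<and> ev (finsum V c F) b = (\<Sum>n\<in>F. ev (c n) b)"
proof -
  interpret vectorspace class_ring V by (rule vectorspace)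
  show ?thesis using assms
    by (induction F) (auto simp: ev_zero ev_add Pi_def)
qed

text \<open>The part of degree \<open>n\<close> is the restriction of the coordinates of
  \<open>x\<close> to basis elements of degree \<open>n\<close>. It is forced: in any decomposition,
  the coordinate at \<open>b\<close> can only come from the summand of index
  \<open>degree b\<close>.\<close>

lemma decomposition_ex1:
  assumes x: "x \<in> carrier V"
  shows "\<exists>!c. (\<forall>n. c n \<in> component V n) \<and> finite {n. c n \<noteq> \<zero>} \<and> x = finsum V c {n. c n \<noteq> \<zero>}"
proof -
  have "\<exists>y\<in>carrier V. ev y = (\<lambda>b. if degree b = n then ev x b else 0)" for n
    by (rule ev_surj) (use ev_finite[OF x] ev_outside[OF x] in \<open>auto elim: rev_finite_subset\<close>)
  then obtain c where c: "\<And>n. c n \<in> carrier V" "\<And>n. ev (c n) = (\<lambda>b. if degree b = n then ev x b else 0)"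
    by metis
  have c_zero: "c n = \<zero> \<longleftrightarrow> (\<forall>b. degree b = n \<longrightarrow> ev x b = 0)" for n
    by (subst ev_inj[symmetric]) (auto simp: c zero_mem ev_zero fun_eq_iff)
  have "{n. c n \<noteq> \<zero>} \<subseteq> degree ` {b. ev x b \<noteq> 0}" by (auto simp: c_zero)
  then have fin: "finite {n. c n \<noteq> \<zero>}" using ev_finite[OF x] finite_surj by blast
  show ?thesis
  proof (rule ex1I[of _ c], intro conjI allI)
    show "c n \<in> component V n" for n by (auto simp: component_iff c)
    show "finite {n. c n \<noteq> \<zero>}" by (rule fin)
    have "ev x b = ev (finsum V c {n. c n \<noteq> \<zero>}) b" for b
      using ev_finsum[OF fin, of c, OF c(1)] fin by (auto simp: c sum.delta c_zero)
    then have "ev x = ev (finsum V c {n. c n \<noteq> \<zero>})" by (rule ext)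
    then show "x = finsum V c {n. c n \<noteq> \<zero>}"
      using ev_inj[OF x conjunct1[OF ev_finsum[OF fin, of c, OF c(1)]]] by blast
  next
    fix c' assume c': "(\<forall>n. c' n \<in> component V n) \<and> finite {n. c' n \<noteq> \<zero>} \<and> x = finsum V c' {n. c' n \<noteq> \<zero>}"
    then have c'V: "c' n \<in> carrier V" for n by (auto simp: component_iff)
    have *: "ev (c' n) b = (if degree b = n then ev (c' n) b else 0)" for n b
      using c' by (auto simp: component_iff)
    have "ev x b = ev (c' (degree b)) b" for b
    proof -
      have "ev x b = (\<Sum>n\<in>{n. c' n \<noteq> \<zero>}. ev (c' n) b)"
        using ev_finsum[of _ c'] c' c'V by metis
      also have "\<dots> = (\<Sum>n\<in>{n. c' n \<noteq> \<zero>}. if degree b = n then ev (c' (degree b)) b else 0)"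
        by (intro sum.cong refl) (use * in metis)
      also have "\<dots> = ev (c' (degree b)) b"
        using c' by (auto simp: sum.delta ev_zero)
      finally show ?thesis .
    qed
    then have "ev (c' n) b = ev (c n) b" for n b using *[of n b] by (cases "degree b = n") (auto simp: c)
    then have "ev (c' n) = ev (c n)" for n by (rule ext)
    then show "c' = c" using ev_inj c'V c(1) by auto
  qed
qed

lemma dg_spaceI:
  assumes "\<And>x. x \<in> carrier V \<Longrightarrow> differential V x \<in> carrier V"
    and "\<And>x y. x \<in> carrier V \<Longrightarrow> y \<in> carrier V \<Longrightarrow>
      differential V (x \<oplus> y) = differential V x \<oplus> differential V y"
    and "\<And>x c. x \<in> carrier V \<Longrightarrow> differential V (c \<odot> x) = c \<odot> differential V x"
    and "\<And>x n. x \<in> component V n \<Longrightarrow> differential V x \<in> component V (n + 1)"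
    and "\<And>x. x \<in> carrier V \<Longrightarrow> differential V (differential V x) = \<zero>"
  shows "dg_space V"
proof -
  interpret vectorspace class_ring V by (rule vectorspace)
  have submod: "LinearCombinations.submodule class_ring (component V n) V" for n
  proof (rule LinearCombinations.submodule.intro)
    show "Module.module class_ring V" by (rule module_axioms)
    show "component V n \<subseteq> carrier V" by (auto simp: component_iff)
    show "x \<oplus> y \<in> component V n" if "x \<in> component V n" "y \<in> component V n" for x y
      using that unfolding component_iff by (simp add: ev_add) (metis add.left_neutral)
    show "\<zero> \<in> component V n" by (simp add: component_iff ev_zero)
    show "c \<odot> x \<in> component V n" if "x \<in> component V n" for c x
      using that by (auto simp: component_iff ev_scalar scalar_mem)
  qed
  have hom: "differential V \<in> LinearCombinations.module_hom class_ring V V"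
    using assms(1-3) by (auto simp: LinearCombinations.module_hom_def)
  show ?thesis
    by (rule dg_space.intro[OF vectorspace dg_space_axioms.intro[OF submod decomposition_ex1 hom assms(4,5)]])
qed

end

subsection \<open>Quasi-isomorphisms\<close>

context dg_space
begin

lemma coboundariesE:
  assumes "x \<in> coboundaries V n"
  obtains y where "y \<in> component V (n - 1)" "x = differential V y"
  using assms by (auto simp: coboundaries_def)

lemma coboundaries_add: "x \<in> coboundaries V n \<Longrightarrow> y \<in> coboundaries V n \<Longrightarrow> x \<oplus> y \<in> coboundaries V n"
  unfolding coboundaries_def using component_add component_carrier
  by (auto simp: differential_add[symmetric])

lemma coboundaries_scalar: "x \<in> coboundaries V n \<Longrightarrow> c \<odot> x \<in> coboundaries V n"
  unfolding coboundaries_def using component_scalar component_carrier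
  by (auto simp: differential_scalar[symmetric])

lemma coboundaries_zero: "\<zero> \<in> coboundaries V n"
  unfolding coboundaries_def using component_zero differential_zero by (metis image_eqI)

lemma cocycles_carrier: "x \<in> cocycles V n \<Longrightarrow> x \<in> carrier V"
  unfolding cocycles_def using component_carrier by auto

lemma cocycles_minus: "x \<in> cocycles V n \<Longrightarrow> y \<in> cocycles V n \<Longrightarrow> x \<ominus> y \<in> cocycles V n"
  unfolding cocycles_def using component_carrier component_add component_scalar
  by (auto simp: minus_eq_scalar differential_add differential_scalar scalar_simps)

lemma coboundary_minus_refl: "x \<in> carrier V \<Longrightarrow> x \<ominus> x \<in> coboundaries V n"
  using coboundaries_zero by (simp add: M.r_neg M.minus_eq)

lemma coboundary_minus_sym:
  assumes "x \<in> carrier V" "y \<in> carrier V" "x \<ominus> y \<in> coboundaries V n"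
  shows "y \<ominus> x \<in> coboundaries V n"
proof -
  have "y \<ominus> x = (-1) \<odot> (x \<ominus> y)"
    using assms by (simp add: minus_eq_scalar scalar_simps M.a_comm)
  then show ?thesis using coboundaries_scalar assms by simp
qed

lemma coboundary_minus_trans:
  assumes "x \<in> carrier V" "y \<in> carrier V" "z \<in> carrier V"
    "x \<ominus> y \<in> coboundaries V n" "y \<ominus> z \<in> coboundaries V n"
  shows "x \<ominus> z \<in> coboundaries V n"
proof -
  have "x \<ominus> z = (x \<ominus> y) \<oplus> (y \<ominus> z)"
    using assms by (simp add: M.minus_eq M.a_ac M.r_neg1 M.r_neg2)
  then show ?thesis using coboundaries_add assms by simp
qed

lemma coh_class_eq_iff:
  assumes "x \<in> cocycles V n" "y \<in> cocycles V n"
  shows "coh_class V n x = coh_class V n y \<longleftrightarrow> x \<ominus> y \<in> coboundaries V n"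
proof
  assume "coh_class V n x = coh_class V n y"
  moreover have "x \<in> coh_class V n x"
    using assms coboundary_minus_refl cocycles_carrier by (simp add: coh_class_def)
  ultimately show "x \<ominus> y \<in> coboundaries V n" by (auto simp: coh_class_def)
next
  assume "x \<ominus> y \<in> coboundaries V n"
  then have "z \<ominus> x \<in> coboundaries V n \<longleftrightarrow> z \<ominus> y \<in> coboundaries V n" if "z \<in> cocycles V n" for z
    using that assms[THEN cocycles_carrier] cocycles_carrier[OF that] coboundary_minus_trans[of z x y n]
      coboundary_minus_trans[of z y x n] coboundary_minus_sym[of x y n] by blast
  then show "coh_class V n x = coh_class V n y" by (auto simp: coh_class_def)
qed

end

section \<open>Maps induced on cohomology\<close>

context
  fixes A :: "('k::field, 'a) dg_space"
    and M :: "('k, 'm, 'a) dg_module" and N :: "('k, 'n, 'a) dg_module" and f :: "'m \<Rightarrow> 'n"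
  assumes M: "dg_space M" and N: "dg_space N" and f: "f \<in> dg_hom A M N"
begin

interpretation M: dg_space M by (rule M)
interpretation N: dg_space N by (rule N)

lemma dg_hom_cocycles: "x \<in> cocycles M n \<Longrightarrow> f x \<in> cocycles N n"
  using f M.component_carrier
  by (auto simp: cocycles_def dg_hom_def graded_hom_def LinearCombinations.module_hom_def)
    (metis M.scalar_zero_left M.M.zero_closed N.scalar_zero_left Pi_mem UNIV_I)+

lemma dg_hom_minus: "x \<in> carrier M \<Longrightarrow> y \<in> carrier M \<Longrightarrow> f (x \<ominus>\<^bsub>M\<^esub> y) = f x \<ominus>\<^bsub>N\<^esub> f y"
  using f by (auto simp: M.minus_eq_scalar N.minus_eq_scalar dg_hom_def graded_hom_def LinearCombinations.module_hom_def Pi_def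
      M.scalar_closed)

lemma dg_hom_coboundaries: "x \<in> coboundaries M n \<Longrightarrow> f x \<in> coboundaries N n"
  using f M.component_carrier by (force simp: coboundaries_def dg_hom_def graded_hom_def)

text \<open>All representatives have images in one class, so the union defining
  \<open>coh_map\<close> is a nonempty union of equal sets.\<close>

lemma coh_map_coh_class:
  assumes "x \<in> cocycles M n"
  shows "coh_map N n f (coh_class M n x) = coh_class N n (f x)"
proof -
  have "coh_class N n (f y) = coh_class N n (f x)" if "y \<in> coh_class M n x" for y
  proof -
    have y: "y \<in> cocycles M n" "y \<ominus>\<^bsub>M\<^esub> x \<in> coboundaries M n" using that by (auto simp: coh_class_def)
    then have "f y \<ominus>\<^bsub>N\<^esub> f x \<in> coboundaries N n"
      using dg_hom_coboundaries dg_hom_minus assms M.cocycles_carrier by metis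
    then show ?thesis
      using N.coh_class_eq_iff[OF dg_hom_cocycles[OF y(1)] dg_hom_cocycles[OF assms]] by blast
  qed
  moreover have "x \<in> coh_class M n x"
    using assms M.coboundary_minus_refl M.cocycles_carrier by (simp add: coh_class_def)
  ultimately show ?thesis unfolding coh_map_def by blast
qed

text \<open>Cohomology classes are sets of cocycles; this removes them in favour of conditions on
  elements. By linearity, injectivity only has to be tested against the zero class.\<close>

lemma quasi_iso_iff:
  "quasi_iso A M N f \<longleftrightarrow>
    (\<forall>n. (\<forall>x\<in>cocycles M n. f x \<in> coboundaries N n \<longrightarrow> x \<in> coboundaries M n) \<and>
      (\<forall>y\<in>cocycles N n. \<exists>x\<in>cocycles M n. f x \<ominus>\<^bsub>N\<^esub> y \<in> coboundaries N n))"
proof -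
  have inj: "inj_on (coh_map N n f) (cohomology M n) \<longleftrightarrow>
      (\<forall>x\<in>cocycles M n. f x \<in> coboundaries N n \<longrightarrow> x \<in> coboundaries M n)" (is "?L \<longleftrightarrow> ?R") for n
  proof -
    have "?L \<longleftrightarrow> (\<forall>x\<in>cocycles M n. \<forall>y\<in>cocycles M n.
        f x \<ominus>\<^bsub>N\<^esub> f y \<in> coboundaries N n \<longrightarrow> x \<ominus>\<^bsub>M\<^esub> y \<in> coboundaries M n)"
      unfolding inj_on_def cohomology_def
      by (auto simp: coh_map_coh_class dg_hom_cocycles M.coh_class_eq_iff N.coh_class_eq_iff)
    also have "\<dots> \<longleftrightarrow> (\<forall>x\<in>cocycles M n. \<forall>y\<in>cocycles M n.
        f (x \<ominus>\<^bsub>M\<^esub> y) \<in> coboundaries N n \<longrightarrow> x \<ominus>\<^bsub>M\<^esub> y \<in> coboundaries M n)"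
      by (auto simp: dg_hom_minus M.cocycles_carrier)
    also have "\<dots> \<longleftrightarrow> ?R"
    proof
      assume *: "\<forall>x\<in>cocycles M n. \<forall>y\<in>cocycles M n.
        f (x \<ominus>\<^bsub>M\<^esub> y) \<in> coboundaries N n \<longrightarrow> x \<ominus>\<^bsub>M\<^esub> y \<in> coboundaries M n"
      have "\<zero>\<^bsub>M\<^esub> \<in> cocycles M n" by (simp add: cocycles_def M.component_zero M.differential_zero)
      moreover have "x \<ominus>\<^bsub>M\<^esub> \<zero>\<^bsub>M\<^esub> = x" if "x \<in> carrier M" for x
        using that by (simp add: M.minus_eq_scalar M.scalar_zero_right)
      ultimately show ?R using * M.cocycles_carrier by metis
    qed (use M.cocycles_minus in blast)
    finally show ?thesis .
  qed
  have surj: "coh_map N n f ` cohomology M n = cohomology N n \<longleftrightarrow>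
      (\<forall>y\<in>cocycles N n. \<exists>x\<in>cocycles M n. f x \<ominus>\<^bsub>N\<^esub> y \<in> coboundaries N n)" (is "?L \<longleftrightarrow> ?R") for n
  proof -
    have "?L \<longleftrightarrow> (\<lambda>x. coh_class N n (f x)) ` cocycles M n = coh_class N n ` cocycles N n"
      unfolding cohomology_def image_image by (simp add: coh_map_coh_class)
    also have "\<dots> \<longleftrightarrow> coh_class N n ` cocycles N n \<subseteq> (\<lambda>x. coh_class N n (f x)) ` cocycles M n"
      using dg_hom_cocycles by blast
    also have "\<dots> \<longleftrightarrow> (\<forall>y\<in>cocycles N n. \<exists>x\<in>cocycles M n. coh_class N n (f x) = coh_class N n y)"
      by (auto simp: image_iff subset_iff) metis+
    also have "\<dots> \<longleftrightarrow> ?R" by (auto simp: N.coh_class_eq_iff dg_hom_cocycles)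
    finally show ?thesis .
  qed
  show ?thesis using f inj surj by (auto simp: quasi_iso_def bij_betw_def)
qed

end

section \<open>Linear extension\<close>

lemma path_span_subset: "x \<in> path_span S \<Longrightarrow> S \<subseteq> T \<Longrightarrow> x \<in> path_span T"
  by (auto simp: path_span_def)

lemma path_span_zero: "(\<lambda>_. 0) \<in> path_span S"
  by (simp add: path_span_def)

lemma path_span_add:
  assumes "x \<in> path_span S" "y \<in> path_span S"
  shows "(\<lambda>r. x r + y r) \<in> path_span S"
proof -
  have "{r. x r + y r \<noteq> 0} \<subseteq> {r. x r \<noteq> 0} \<union> {r. y r \<noteq> 0}" by auto
  then show ?thesis using assms unfolding path_span_def
    by (auto intro: finite_subset)
qed

lemma path_span_scalar: "x \<in> path_span S \<Longrightarrow> (\<lambda>r. c * x r) \<in> path_span S"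
  by (auto simp: path_span_def elim: rev_finite_subset)

lemma path_span_basis: "r \<in> S \<Longrightarrow> path_basis r \<in> path_span S"
  by (auto simp: path_span_def path_basis_def)

text \<open>Induction on the support, removing one path at a time. It reduces linear statements
  about a span to statements about single paths.\<close>

lemma path_span_induct [consumes 1, case_names zero add]:
  assumes "x \<in> path_span S"
    and "Pr (\<lambda>_. 0)"
    and "\<And>r c y. r \<in> S \<Longrightarrow> y \<in> path_span S \<Longrightarrow> Pr y \<Longrightarrow> Pr (\<lambda>s. c * path_basis r s + y s)"
  shows "Pr x"
proof -
  have "finite F \<Longrightarrow> x \<in> path_span S \<Longrightarrow> {r. x r \<noteq> 0} = F \<Longrightarrow> Pr x" for F
  proof (induction F arbitrary: x rule: finite_induct)
    case empty
    then have "x = (\<lambda>_. 0)" by auto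
    with assms(2) show ?case by simp
  next
    case (insert r F)
    define y where "y = (\<lambda>s. if s = r then 0 else x s)"
    have supp: "{s. y s \<noteq> 0} = F" using insert.prems(2) insert.hyps(2) by (auto simp: y_def)
    have "y \<in> path_span S"
      using insert.prems insert.hyps supp by (auto simp: path_span_def)
    moreover have "r \<in> S" using insert.prems by (auto simp: path_span_def)
    ultimately have "Pr (\<lambda>s. x r * path_basis r s + y s)"
      using assms(3) insert.IH supp by blast
    moreover have "(\<lambda>s. x r * path_basis r s + y s) = x"
      by (auto simp: y_def path_basis_def)
    ultimately show ?case by simp
  qed
  then show ?thesis using assms(1) by (auto simp: path_span_def)
qed

context dg_space
begin

text \<open>The linear map with prescribed values \<open>w\<close> on basis vectors. The lemmas ask
  for values in the carrier at every index, so a partial prescription is completed by zero.\<close>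

definition lin_ext :: "('r \<Rightarrow> 'm) \<Rightarrow> ('r \<Rightarrow> 'k) \<Rightarrow> 'm" where
  "lin_ext w y = finsum V (\<lambda>r. y r \<odot> w r) {r. y r \<noteq> 0}"

lemma lin_ext_superset:
  assumes "\<And>r. w r \<in> carrier V" "finite F" "{r. y r \<noteq> 0} \<subseteq> F"
  shows "lin_ext w y = finsum V (\<lambda>r. y r \<odot> w r) F"
  unfolding lin_ext_def
  by (rule M.add.finprod_mono_neutral_cong_left) (use assms in \<open>auto simp: scalar_zero_left\<close>)

lemma lin_ext_closed: "(\<And>r. w r \<in> carrier V) \<Longrightarrow> lin_ext w y \<in> carrier V"
  unfolding lin_ext_def by (auto intro!: M.finsum_closed)

lemma lin_ext_zero: "lin_ext w (\<lambda>_. 0) = \<zero>"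
  by (simp add: lin_ext_def)

lemma lin_ext_add:
  assumes w: "\<And>r. w r \<in> carrier V" and fin: "finite {r. x r \<noteq> 0}" "finite {r. y r \<noteq> 0}"
  shows "lin_ext w (\<lambda>r. x r + y r) = lin_ext w x \<oplus> lin_ext w y"
proof -
  let ?F = "{r. x r \<noteq> 0} \<union> {r. y r \<noteq> 0}"
  have F: "finite ?F" using fin by simp
  have "{r. x r + y r \<noteq> 0} \<subseteq> ?F" "{r. x r \<noteq> 0} \<subseteq> ?F" "{r. y r \<noteq> 0} \<subseteq> ?F" by auto
  note eqs = this[THEN lin_ext_superset[of w, OF w F]]
  show ?thesis unfolding eqs
    by (subst M.finsum_addf[symmetric]) (auto simp: w scalar_add_left intro!: M.finsum_cong')
qed

lemma lin_ext_scalar: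
  assumes w: "\<And>r. w r \<in> carrier V" and fin: "finite {r. x r \<noteq> 0}"
  shows "lin_ext w (\<lambda>r. c * x r) = c \<odot> lin_ext w x"
proof -
  have "{r. c * x r \<noteq> 0} \<subseteq> {r. x r \<noteq> 0}" by auto
  then have "lin_ext w (\<lambda>r. c * x r) = finsum V (\<lambda>r. (c * x r) \<odot> w r) {r. x r \<noteq> 0}"
    by (rule lin_ext_superset[of w, OF w fin])
  also have "\<dots> = finsum V (\<lambda>r. c \<odot> (x r \<odot> w r)) {r. x r \<noteq> 0}"
    by (intro M.finsum_cong') (auto simp: w scalar_scalar)
  also have "\<dots> = c \<odot> finsum V (\<lambda>r. x r \<odot> w r) {r. x r \<noteq> 0}"
    using fin by (induction rule: finite_induct) (auto simp: w scalar_zero_right scalar_add_right Pi_def)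
  finally show ?thesis by (simp add: lin_ext_def)
qed

lemma lin_ext_basis: "w r \<in> carrier V \<Longrightarrow> lin_ext w (path_basis r) = w r"
  by (simp add: lin_ext_def path_basis_def scalar_one)

lemma lin_ext_cong:
  "(\<And>r. w r \<in> carrier V) \<Longrightarrow> (\<And>r. w' r \<in> carrier V) \<Longrightarrow> (\<And>r. y r \<noteq> 0 \<Longrightarrow> w r = w' r) \<Longrightarrow>
    lin_ext w y = lin_ext w' y"
  unfolding lin_ext_def by (intro M.finsum_cong') auto

lemma lin_ext_component:
  assumes w: "\<And>r. w r \<in> carrier V" and y: "y \<in> path_span S"
    and deg: "\<And>r. r \<in> S \<Longrightarrow> w r \<in> component V n"
  shows "lin_ext w y \<in> component V n"
  using y
proof (induction rule: path_span_induct)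
  case zero
  show ?case by (simp add: lin_ext_zero component_zero)
next
  case (add r c y)
  have "finite {s. path_basis r s \<noteq> (0::'k)}" by (simp add: path_basis_def)
  moreover from this have "finite {s. c * path_basis r s \<noteq> 0}" by (auto elim: rev_finite_subset)
  moreover have "finite {s. y s \<noteq> 0}" using add by (simp add: path_span_def)
  ultimately show ?case using add deg
    by (simp add: lin_ext_add[OF w] lin_ext_scalar[OF w] lin_ext_basis[OF w] component_add component_scalar)
qed

end

section \<open>Path algebras\<close>

text \<open>A factorization is determined by the position of the cut; the middle vertex is where the
  first part of the walk ends.\<close>

lemma (in wf_digraph) finite_factorizations: "finite (factorizations G r)"
proof -
  obtain u l w where r: "r = (u, l, w)" by (cases r) auto
  have "factorizations G r \<subseteq> (\<lambda>k. ((awlast u (take k l), drop k l, w), (u, take k l, awlast u (take k l)))) ` {..length l}"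
  proof
    fix z assume "z \<in> factorizations G r"
    then obtain v p q where z: "z = ((v, q, w), (u, p, v))" "l = p @ q" "awalk u p v"
      by (auto simp: factorizations_def paths_def r)
    then have "awlast u p = v" by auto
    then show "z \<in> (\<lambda>k. ((awlast u (take k l), drop k l, w), (u, take k l, awlast u (take k l)))) ` {..length l}"
      using z(1,2) by (intro rev_image_eqI[of "length p"]) simp_all
  qed
  then show ?thesis by (rule finite_subset) simp
qed

lemma (in wf_digraph) snoc_in_paths_iff:
  "(u, p @ [\<beta>], v) \<in> paths G \<longleftrightarrow> (u, p, tail G \<beta>) \<in> paths G \<and> \<beta> \<in> arcs G \<and> v = head G \<beta>"
  by (auto simp: paths_def awalk_Cons_iff awalk_Nil_iff awalk_append_iff)

lemma (in wf_digraph) append_in_paths: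
  "(u, p, v) \<in> paths G \<Longrightarrow> (v, q, w) \<in> paths G \<Longrightarrow> (u, p @ q, w) \<in> paths G"
  by (auto simp: paths_def)

lemma (in wf_digraph) trivial_in_paths_iff: "(u, [], v) \<in> paths G \<longleftrightarrow> u = v \<and> u \<in> verts G"
  by (auto simp: paths_def awalk_Nil_iff)

locale path_dga = Q: wf_digraph Q + A: dg_algebra "dg_path_algebra Q deg \<delta>"
  for Q :: "('v, 'e) pre_digraph" and deg :: "'e \<Rightarrow> int"
    and \<delta> :: "(('v, 'e) path \<Rightarrow> 'k::field) \<Rightarrow> (('v, 'e) path \<Rightarrow> 'k)" +
  assumes deg_nonpos: "\<alpha> \<in> arcs Q \<Longrightarrow> deg \<alpha> \<le> 0"
    and minimal: "\<alpha> \<in> arcs Q \<Longrightarrow> \<delta> (arrow Q \<alpha>) \<in> path_span {p \<in> paths Q. path_length p \<ge> 2}"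
begin

abbreviation A :: "('k, ('v, 'e) path \<Rightarrow> 'k) dg_space" where "A \<equiv> dg_path_algebra Q deg \<delta>"

abbreviation basis :: "('v, 'e) path \<Rightarrow> ('v, 'e) path \<Rightarrow> 'k" where "basis \<equiv> path_basis"

abbreviation mult_A (infixl "\<cdot>" 70) where "x \<cdot> y \<equiv> x \<otimes>\<^bsub>A\<^esub> y"

lemma A_simps [simp]:
  "carrier A = path_span (paths Q)" "\<zero>\<^bsub>A\<^esub> = (\<lambda>_. 0)" "x \<oplus>\<^bsub>A\<^esub> y = (\<lambda>r. x r + y r)"
  "c \<odot>\<^bsub>A\<^esub> x = (\<lambda>r. c * x r)" "component A n = path_span {p \<in> paths Q. path_degree deg p = n}"
  "differential A = \<delta>"
  by (simp_all add: dg_path_algebra_def)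

lemma mult_apply: "(x \<cdot> y) r = (\<Sum>(q, p)\<in>factorizations Q r. x q * y p)"
  by (simp add: dg_path_algebra_def)

lemma mult_add_left: "x \<in> path_span (paths Q) \<Longrightarrow> y \<in> path_span (paths Q) \<Longrightarrow> z \<in> path_span (paths Q) \<Longrightarrow>
    (\<lambda>r. x r + y r) \<cdot> z = (\<lambda>r. (x \<cdot> z) r + (y \<cdot> z) r)"
  using A.R.l_distr[of x y z] by simp

lemma mult_add_right: "x \<in> path_span (paths Q) \<Longrightarrow> y \<in> path_span (paths Q) \<Longrightarrow> z \<in> path_span (paths Q) \<Longrightarrow>
    z \<cdot> (\<lambda>r. x r + y r) = (\<lambda>r. (z \<cdot> x) r + (z \<cdot> y) r)"
  using A.R.r_distr[of x y z] by simp

lemma mult_scalar_left: "x \<in> path_span (paths Q) \<Longrightarrow> y \<in> path_span (paths Q) \<Longrightarrow>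
    (\<lambda>r. c * x r) \<cdot> y = (\<lambda>r. c * (x \<cdot> y) r)"
  using A.smult_mult_left[of x y c] by simp

lemma mult_scalar_right: "x \<in> path_span (paths Q) \<Longrightarrow> y \<in> path_span (paths Q) \<Longrightarrow>
    x \<cdot> (\<lambda>r. c * y r) = (\<lambda>r. c * (x \<cdot> y) r)"
  using A.smult_mult_right[of x y c] by simp

lemma mult_zero_left: "x \<in> path_span (paths Q) \<Longrightarrow> (\<lambda>_. 0) \<cdot> x = (\<lambda>_. 0)"
  using A.R.l_null[of x] by simp

lemma mult_zero_right: "x \<in> path_span (paths Q) \<Longrightarrow> x \<cdot> (\<lambda>_. 0) = (\<lambda>_. 0)"
  using A.R.r_null[of x] by simp

lemma mult_closed: "x \<in> path_span (paths Q) \<Longrightarrow> y \<in> path_span (paths Q) \<Longrightarrow> x \<cdot> y \<in> path_span (paths Q)"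
  using A.R.m_closed[of x y] by simp

lemma mult_assoc: "x \<in> path_span (paths Q) \<Longrightarrow> y \<in> path_span (paths Q) \<Longrightarrow> z \<in> path_span (paths Q) \<Longrightarrow>
    x \<cdot> y \<cdot> z = x \<cdot> (y \<cdot> z)"
  using A.R.m_assoc[of x y z] by simp

lemma mult_basis:
  assumes "(v', q, w) \<in> paths Q" "(u, p, v) \<in> paths Q"
  shows "basis (v', q, w) \<cdot> basis (u, p, v) =
    (if v' = v then basis (u, p @ q, w) else (\<lambda>_. 0))"
proof
  fix r
  have "(basis (v', q, w) \<cdot> basis (u, p, v)) r =
      (\<Sum>z\<in>factorizations Q r. if z = ((v', q, w), (u, p, v)) then 1 else 0)"
    unfolding mult_apply by (intro sum.cong refl) (auto simp: path_basis_def split: if_splits)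
  also have "\<dots> = (if ((v', q, w), (u, p, v)) \<in> factorizations Q r then 1 else 0)"
    using Q.finite_factorizations by (simp add: sum.delta)
  also have "\<dots> = (if v' = v then basis (u, p @ q, w) else (\<lambda>_. 0)) r"
    using assms by (auto simp: factorizations_def path_basis_def)
  finally show "(basis (v', q, w) \<cdot> basis (u, p, v)) r = \<dots>" .
qed

text \<open>Bilinearity leaves only products of two paths, which are a concatenation or zero. Used
  to see in which right ideal and in which power of the arrow ideal a product lies.\<close>

lemma path_span_mult:
  assumes x: "x \<in> path_span S" and y: "y \<in> path_span T" and S: "S \<subseteq> paths Q" and T: "T \<subseteq> paths Q"
    and U: "\<And>u p v q w. (v, q, w) \<in> S \<Longrightarrow> (u, p, v) \<in> T \<Longrightarrow> (u, p @ q, w) \<in> U"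
  shows "x \<cdot> y \<in> path_span U"
  using x
proof (induction rule: path_span_induct)
  case zero
  show ?case using y T by (simp add: mult_zero_left path_span_subset path_span_zero)
next
  case (add r c x)
  have r: "basis r \<in> path_span (paths Q)" using add S by (auto intro: path_span_basis)
  have "basis r \<cdot> y \<in> path_span U" using y
  proof (induction rule: path_span_induct)
    case zero
    show ?case by (simp add: r mult_zero_right path_span_zero)
  next
    case (add s d y)
    have s: "basis s \<in> path_span (paths Q)" using add T by (auto intro: path_span_basis)
    have "basis r \<cdot> basis s \<in> path_span U"
      using \<open>r \<in> S\<close> \<open>s \<in> T\<close> S T U
      by (cases r; cases s) (auto simp: mult_basis subset_iff path_span_zero intro: path_span_basis)
    then show ?case using add r s T
      by (simp add: mult_add_right mult_scalar_right path_span_scalar path_span_add path_span_subset[OF _ T])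
  qed
  then show ?case using add r y S T
    by (simp add: mult_add_left mult_scalar_left path_span_scalar path_span_add
        path_span_subset[OF _ T] path_span_subset[OF _ S])
qed

lemma factorizations_trivial: "v \<in> verts Q \<Longrightarrow> factorizations Q (v, [], v) = {((v, [], v), (v, [], v))}"
  by (auto simp: factorizations_def Q.trivial_in_paths_iff)

lemma mult_trivial: "v \<in> verts Q \<Longrightarrow> (x \<cdot> y) (v, [], v) = x (v, [], v) * y (v, [], v)"
  by (simp add: mult_apply factorizations_trivial)

lemma arrow_in_paths: "\<beta> \<in> arcs Q \<Longrightarrow> (tail Q \<beta>, [\<beta>], head Q \<beta>) \<in> paths Q"
  using Q.snoc_in_paths_iff[of "tail Q \<beta>" "[]" \<beta> "head Q \<beta>"] by (simp add: Q.trivial_in_paths_iff)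

text \<open>A path of length one factors only with a trivial path on one side.\<close>

lemma mult_arrow:
  assumes "\<beta> \<in> arcs Q"
  shows "(x \<cdot> y) (tail Q \<beta>, [\<beta>], head Q \<beta>) =
    x (head Q \<beta>, [], head Q \<beta>) * y (tail Q \<beta>, [\<beta>], head Q \<beta>) +
    x (tail Q \<beta>, [\<beta>], head Q \<beta>) * y (tail Q \<beta>, [], tail Q \<beta>)"
proof -
  have "factorizations Q (tail Q \<beta>, [\<beta>], head Q \<beta>) =
      {((head Q \<beta>, [], head Q \<beta>), (tail Q \<beta>, [\<beta>], head Q \<beta>)),
       ((tail Q \<beta>, [\<beta>], head Q \<beta>), (tail Q \<beta>, [], tail Q \<beta>))}" (is "?L = ?R")
  proof
    show "?L \<subseteq> ?R"
    proof
      fix z assume "z \<in> ?L"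
      then obtain p v q where z: "z = ((v, q, head Q \<beta>), (tail Q \<beta>, p, v))" "[\<beta>] = p @ q"
        "(v, q, head Q \<beta>) \<in> paths Q" "(tail Q \<beta>, p, v) \<in> paths Q"
        by (auto simp: factorizations_def)
      then show "z \<in> ?R" by (cases p) (auto simp: Q.trivial_in_paths_iff)
    qed
    show "?R \<subseteq> ?L"
      using assms arrow_in_paths[OF assms] by (auto simp: factorizations_def Q.trivial_in_paths_iff)
  qed
  then show ?thesis by (simp add: mult_apply)
qed

lemma path_degree_nonpos: "r \<in> paths Q \<Longrightarrow> path_degree deg r \<le> 0"
proof -
  assume "r \<in> paths Q"
  then obtain u p v where r: "r = (u, p, v)" and "set p \<subseteq> arcs Q"
    by (cases r) (auto simp: paths_def Q.awalk_def)
  from this(2) have "(\<Sum>\<alpha>\<leftarrow>p. deg \<alpha>) \<le> 0"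
    by (induction p) (auto dest: deg_nonpos)
  then show ?thesis by (simp add: r path_degree_def)
qed

lemma \<delta>_closed: "x \<in> path_span (paths Q) \<Longrightarrow> \<delta> x \<in> path_span (paths Q)"
  using A.differential_closed[of x] by simp

lemma \<delta>_add: "x \<in> path_span (paths Q) \<Longrightarrow> y \<in> path_span (paths Q) \<Longrightarrow> \<delta> (\<lambda>r. x r + y r) = (\<lambda>r. \<delta> x r + \<delta> y r)"
  using A.differential_add[of x y] by simp

lemma \<delta>_scalar: "x \<in> path_span (paths Q) \<Longrightarrow> \<delta> (\<lambda>r. c * x r) = (\<lambda>r. c * \<delta> x r)"
  using A.differential_scalar[of x c] by simp

lemma \<delta>_zero: "\<delta> (\<lambda>_. 0) = (\<lambda>_. 0)"
  using A.differential_zero by simp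

lemma \<delta>_\<delta>: "x \<in> path_span (paths Q) \<Longrightarrow> \<delta> (\<delta> x) = (\<lambda>_. 0)"
  using A.differential_square[of x] by simp

lemma \<delta>_degree: "x \<in> path_span {p \<in> paths Q. path_degree deg p = m} \<Longrightarrow>
    \<delta> x \<in> path_span {p \<in> paths Q. path_degree deg p = m + 1}"
  using A.differential_degree[of x m] by simp

lemma \<delta>_mult:
  assumes "x \<in> path_span {p \<in> paths Q. path_degree deg p = m}" "y \<in> path_span (paths Q)"
  shows "\<delta> (x \<cdot> y) = (\<lambda>r. (\<delta> x \<cdot> y) r + (-1) powi m * (x \<cdot> \<delta> y) r)"
  using A.leibniz[of x m y] assms by simp

text \<open>The differential has degree 1, and no path has positive degree.\<close>

lemma \<delta>_trivial:
  assumes "v \<in> verts Q"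
  shows "\<delta> (basis (v, [], v)) = (\<lambda>_. 0)"
proof -
  have "basis (v, [], v) \<in> path_span {p \<in> paths Q. path_degree deg p = 0}"
    using assms by (intro path_span_basis) (simp add: Q.trivial_in_paths_iff path_degree_def)
  from \<delta>_degree[OF this] show ?thesis
    using path_degree_nonpos by (force simp: path_span_def)
qed

text \<open>A basis of \<open>e\<^sub>i\<close> times the \<open>n\<close>-th power of the arrow
  ideal. It is a right ideal because right multiplication prolongs a path at its source and keeps
  its target.\<close>

definition paths_to :: "nat \<Rightarrow> 'v \<Rightarrow> ('v, 'e) path set" where
  "paths_to n i = {(u, p, v). (u, p, v) \<in> paths Q \<and> v = i \<and> n \<le> length p}"

lemma paths_to_subset: "paths_to n i \<subseteq> paths Q"
  by (auto simp: paths_to_def)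

lemma paths_to_span: "x \<in> path_span (paths_to n i) \<Longrightarrow> x \<in> path_span (paths Q)"
  by (rule path_span_subset[OF _ paths_to_subset])

lemma paths_to_mono: "x \<in> path_span (paths_to n i) \<Longrightarrow> m \<le> n \<Longrightarrow> x \<in> path_span (paths_to m i)"
  by (erule path_span_subset) (auto simp: paths_to_def)

lemma paths_to_mult: "x \<in> path_span (paths_to n i) \<Longrightarrow> a \<in> path_span (paths Q) \<Longrightarrow> x \<cdot> a \<in> path_span (paths_to n i)"
  by (erule path_span_mult[where T = "paths Q"]) (auto simp: paths_to_def intro: Q.append_in_paths)

text \<open>The last arrow of the list is the leftmost factor. This exhibits the radical of
  \<open>e\<^sub>i A\<close> as generated, as a right module, by the arrows ending at
  \<open>i\<close>.\<close>

lemma paths_to_cases: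
  assumes "r \<in> paths_to n i" "n > 0"
  obtains u p \<beta> where "r = (u, p @ [\<beta>], i)" "(u, p, tail Q \<beta>) \<in> paths Q" "\<beta> \<in> arcs Q" "head Q \<beta> = i"
    "basis r = arrow Q \<beta> \<cdot> basis (u, p, tail Q \<beta>)" "n \<le> Suc (length p)"
proof -
  obtain u p where r: "r = (u, p, i)" "(u, p, i) \<in> paths Q" "n \<le> length p"
    using assms by (auto simp: paths_to_def)
  then obtain p' \<beta> where p: "p = p' @ [\<beta>]" using assms(2) by (cases p rule: rev_cases) auto
  then have *: "(u, p', tail Q \<beta>) \<in> paths Q" "\<beta> \<in> arcs Q" "head Q \<beta> = i"
    using r by (auto simp: Q.snoc_in_paths_iff)
  moreover have "basis r = arrow Q \<beta> \<cdot> basis (u, p', tail Q \<beta>)"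
    using * arrow_in_paths[of \<beta>] r p by (simp add: arrow_def mult_basis)
  ultimately show ?thesis using that r p by auto
qed

lemma arrow_degree: "\<beta> \<in> arcs Q \<Longrightarrow> arrow Q \<beta> \<in> path_span {p \<in> paths Q. path_degree deg p = deg \<beta>}"
  unfolding arrow_def by (rule path_span_basis) (simp add: arrow_in_paths path_degree_def)

lemma arrow_closed: "\<beta> \<in> arcs Q \<Longrightarrow> arrow Q \<beta> \<in> path_span (paths Q)"
  unfolding arrow_def by (rule path_span_basis) (simp add: arrow_in_paths)

text \<open>\<open>minimal\<close> controls the length but not the target. The target follows from
  \<open>\<beta> = e \<beta>\<close> and the Leibniz rule, because the idempotent \<open>e\<close>
  at the head is a cocycle of degree 0.\<close>

lemma \<delta>_arrow_paths_to:
  assumes \<beta>: "\<beta> \<in> arcs Q"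
  shows "\<delta> (arrow Q \<beta>) \<in> path_span (paths_to 2 (head Q \<beta>))"
proof -
  let ?e = "basis (head Q \<beta>, [], head Q \<beta>)"
  have e: "?e \<in> path_span {p \<in> paths Q. path_degree deg p = 0}"
    using \<beta> by (intro path_span_basis) (auto simp: Q.trivial_in_paths_iff path_degree_def)
  have "arrow Q \<beta> = ?e \<cdot> arrow Q \<beta>"
    using \<beta> arrow_in_paths[OF \<beta>] by (simp add: arrow_def mult_basis Q.trivial_in_paths_iff)
  then have "\<delta> (arrow Q \<beta>) = \<delta> (?e \<cdot> arrow Q \<beta>)" by simp
  also have "\<dots> = ?e \<cdot> \<delta> (arrow Q \<beta>)"
    using \<beta> by (subst \<delta>_mult[OF e arrow_closed]) (simp_all add: \<delta>_trivial arrow_closed mult_zero_left)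
  also have "\<dots> \<in> path_span (paths_to 2 (head Q \<beta>))"
  proof (rule path_span_mult[OF _ minimal[OF \<beta>]])
    show "?e \<in> path_span {(head Q \<beta>, [], head Q \<beta>)}" by (rule path_span_basis) simp
  qed (use \<beta> in \<open>auto simp: Q.trivial_in_paths_iff paths_to_def path_length_def\<close>)
  finally show ?thesis .
qed

text \<open>Split off the leftmost arrow and apply the Leibniz rule: one term starts with the
  differential of that arrow, the other is the arrow times a differential already known to consist
  of long paths.\<close>

lemma \<delta>_basis_paths_to: "(u, p, v) \<in> paths Q \<Longrightarrow> \<delta> (basis (u, p, v)) \<in> path_span (paths_to 2 v)"
proof (induction p arbitrary: v rule: rev_induct)
  case Nil
  then show ?case by (auto simp: Q.trivial_in_paths_iff \<delta>_trivial path_span_zero)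
next
  case (snoc \<beta> p)
  then have *: "(u, p, tail Q \<beta>) \<in> paths Q" "\<beta> \<in> arcs Q" "v = head Q \<beta>"
    by (auto simp: Q.snoc_in_paths_iff)
  let ?p = "basis (u, p, tail Q \<beta>)"
  have p: "?p \<in> path_span (paths Q)" using * by (auto intro: path_span_basis)
  have "basis (u, p @ [\<beta>], v) = arrow Q \<beta> \<cdot> ?p"
    using * arrow_in_paths[of \<beta>] by (simp add: arrow_def mult_basis)
  then have "\<delta> (basis (u, p @ [\<beta>], v)) =
      (\<lambda>r. (\<delta> (arrow Q \<beta>) \<cdot> ?p) r + (-1) powi deg \<beta> * (arrow Q \<beta> \<cdot> \<delta> ?p) r)"
    using \<delta>_mult[OF arrow_degree p] * by simp
  moreover have "\<delta> (arrow Q \<beta>) \<cdot> ?p \<in> path_span (paths_to 2 v)"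
    using paths_to_mult[OF \<delta>_arrow_paths_to p] * by simp
  moreover have "arrow Q \<beta> \<cdot> \<delta> ?p \<in> path_span (paths_to 2 v)"
  proof (rule path_span_mult[OF _ snoc.IH[OF *(1)]])
    show "arrow Q \<beta> \<in> path_span {(tail Q \<beta>, [\<beta>], head Q \<beta>)}"
      unfolding arrow_def by (rule path_span_basis) simp
  qed (use * arrow_in_paths[of \<beta>] in \<open>auto simp: paths_to_def intro: Q.append_in_paths\<close>)
  ultimately show ?case by (simp add: path_span_add path_span_scalar)
qed

lemma \<delta>_paths_to: "x \<in> path_span (paths_to n i) \<Longrightarrow> \<delta> x \<in> path_span (paths_to 2 i)"
proof (induction rule: path_span_induct)
  case zero
  show ?case by (simp add: \<delta>_zero path_span_zero)
next
  case (add r c y)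
  then have "basis r \<in> path_span (paths_to n i)" by (simp add: path_span_basis)
  moreover have "\<delta> (basis r) \<in> path_span (paths_to 2 i)"
    using add.hyps(1) \<delta>_basis_paths_to by (auto simp: paths_to_def)
  ultimately show ?case using add
    by (simp add: \<delta>_add \<delta>_scalar paths_to_span path_span_scalar path_span_add)
qed

end

section \<open>Lifting along quasi-isomorphisms\<close>

context dg_right_module
begin

lemma act_zero_left: "a \<in> carrier A \<Longrightarrow> act M \<zero>\<^bsub>M\<^esub> a = \<zero>\<^bsub>M\<^esub>"
  using act_smult_left[of "\<zero>\<^bsub>M\<^esub>" a 0] by (simp add: M.scalar_zero_left act_closed)

lemma act_zero_right: "x \<in> carrier M \<Longrightarrow> act M x \<zero>\<^bsub>A\<^esub> = \<zero>\<^bsub>M\<^esub>"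
  using act_smult_right[of x "\<zero>\<^bsub>A\<^esub>" 0] A.M.zero_closed
  by (simp add: M.scalar_zero_left A.scalar_zero_left act_closed)

end

section \<open>Right ideals generated by arrows, and module maps defined on these generators\<close>

context path_dga
begin

text \<open>Serves as the source of graded maps, so that the calculus of \<open>graded_hom\<close>
  applies to maps defined on the radical alone.\<close>

definition right_ideal :: "(('v, 'e) path \<Rightarrow> 'k) set \<Rightarrow> ('k, ('v, 'e) path \<Rightarrow> 'k, ('v, 'e) path \<Rightarrow> 'k) dg_module" where
  "right_ideal I =
     \<lparr>carrier = I, mult = undefined, one = undefined, zero = (\<lambda>_. 0), add = (\<lambda>x y r. x r + y r),
      smult = (\<lambda>c x r. c * x r), component = (\<lambda>n. I \<inter> component A n), differential = \<delta>,
      act = (\<lambda>x a. x \<cdot> a)\<rparr>"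

abbreviation rad :: "'v \<Rightarrow> ('k, ('v, 'e) path \<Rightarrow> 'k, ('v, 'e) path \<Rightarrow> 'k) dg_module" where
  "rad i \<equiv> right_ideal (path_span (paths_to 1 i))"

lemma right_ideal_simps [simp]:
  "carrier (right_ideal I) = I" "\<zero>\<^bsub>right_ideal I\<^esub> = (\<lambda>_. 0)" "x \<oplus>\<^bsub>right_ideal I\<^esub> y = (\<lambda>r. x r + y r)"
  "c \<odot>\<^bsub>right_ideal I\<^esub> x = (\<lambda>r. c * x r)" "component (right_ideal I) n = I \<inter> component A n"
  "differential (right_ideal I) = \<delta>" "act (right_ideal I) x a = x \<cdot> a"
  by (simp_all add: right_ideal_def)

lemma graded_homI:
  assumes "\<And>x. x \<in> carrier M \<Longrightarrow> f x \<in> carrier N"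
    and "\<And>x y. x \<in> carrier M \<Longrightarrow> y \<in> carrier M \<Longrightarrow> f (x \<oplus>\<^bsub>M\<^esub> y) = f x \<oplus>\<^bsub>N\<^esub> f y"
    and "\<And>c x. x \<in> carrier M \<Longrightarrow> f (c \<odot>\<^bsub>M\<^esub> x) = c \<odot>\<^bsub>N\<^esub> f x"
    and "\<And>x a. x \<in> carrier M \<Longrightarrow> a \<in> carrier A \<Longrightarrow> f (act M x a) = act N (f x) a"
    and "\<And>m x. x \<in> component M m \<Longrightarrow> f x \<in> component N (m + p)"
  shows "f \<in> graded_hom A p M N"
  using assms by (auto simp: graded_hom_def LinearCombinations.module_hom_def)

lemma graded_homD:
  assumes "f \<in> graded_hom A p M N"
  shows "x \<in> carrier M \<Longrightarrow> f x \<in> carrier N"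
    and "x \<in> carrier M \<Longrightarrow> y \<in> carrier M \<Longrightarrow> f (x \<oplus>\<^bsub>M\<^esub> y) = f x \<oplus>\<^bsub>N\<^esub> f y"
    and "x \<in> carrier M \<Longrightarrow> f (c \<odot>\<^bsub>M\<^esub> x) = c \<odot>\<^bsub>N\<^esub> f x"
    and "x \<in> carrier M \<Longrightarrow> a \<in> path_span (paths Q) \<Longrightarrow> f (act M x a) = act N (f x) a"
    and "x \<in> component M m \<Longrightarrow> f x \<in> component N (m + p)"
  using assms by (auto simp: graded_hom_def LinearCombinations.module_hom_def)

lemma idempotent_mult:
  assumes "v \<in> verts Q" "x \<in> path_span (paths_to n v)"
  shows "basis (v, [], v) \<cdot> x = x"
  using assms(2)
proof (induction rule: path_span_induct)
  case zero
  show ?case using assms(1) by (intro mult_zero_right path_span_basis) (simp add: Q.trivial_in_paths_iff)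
next
  case (add r c y)
  have e: "(v, [], v) \<in> paths Q" using assms(1) by (simp add: Q.trivial_in_paths_iff)
  obtain u p where r: "r = (u, p, v)" "(u, p, v) \<in> paths Q" using add.hyps by (auto simp: paths_to_def)
  then have "basis (v, [], v) \<cdot> basis r = basis r" using mult_basis[OF e r(2)] by simp
  then show ?case
    using add e r by (simp add: mult_add_right mult_scalar_right path_span_scalar path_span_basis paths_to_span)
qed

text \<open>For a set \<open>C\<close> of arrows, a basis of the right ideal that \<open>C\<close>
  generates. Varying \<open>C\<close> makes it possible to speak of a map constructed so far on some
  of the arrows only.\<close>

definition ending :: "'e set \<Rightarrow> ('v, 'e) path set" where
  "ending C = {(u, p, v). (u, p, v) \<in> paths Q \<and> p \<noteq> [] \<and> last p \<in> C}"

lemma ending_subset: "ending C \<subseteq> paths Q"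
  by (auto simp: ending_def)

lemma ending_span: "x \<in> path_span (ending C) \<Longrightarrow> x \<in> path_span (paths Q)"
  by (rule path_span_subset[OF _ ending_subset])

lemma paths_to_eq_ending: "paths_to 1 i = ending {\<beta> \<in> arcs Q. head Q \<beta> = i}"
proof -
  have "(u, p, v) \<in> paths_to 1 i \<longleftrightarrow> (u, p, v) \<in> ending {\<beta> \<in> arcs Q. head Q \<beta> = i}" for u p v
    by (cases p rule: rev_cases) (auto simp: paths_to_def ending_def Q.snoc_in_paths_iff)
  then show ?thesis by (metis (no_types, lifting) prod_cases3 subsetI subset_antisym)
qed

lemma ending_cases:
  assumes "r \<in> ending C"
  obtains u p \<beta> where "r = (u, p @ [\<beta>], head Q \<beta>)" "(u, p, tail Q \<beta>) \<in> paths Q" "\<beta> \<in> arcs Q" "\<beta> \<in> C"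
    "basis r = arrow Q \<beta> \<cdot> basis (u, p, tail Q \<beta>)"
proof -
  obtain u p \<beta> v where r: "r = (u, p @ [\<beta>], v)" "(u, p @ [\<beta>], v) \<in> paths Q" "\<beta> \<in> C"
    using assms by (auto simp: ending_def) (metis append_butlast_last_id)
  then have *: "(u, p, tail Q \<beta>) \<in> paths Q" "\<beta> \<in> arcs Q" "v = head Q \<beta>"
    by (auto simp: Q.snoc_in_paths_iff)
  moreover have "basis r = arrow Q \<beta> \<cdot> basis (u, p, tail Q \<beta>)"
    using * arrow_in_paths[of \<beta>] r by (simp add: arrow_def mult_basis)
  ultimately show ?thesis using that r by auto
qed

text \<open>On the right ideal freely generated by the arrows in \<open>C\<close> this is the right \<open>A\<close>-linear map
  that sends \<open>\<beta>\<close> to \<open>z \<beta>\<close> times the idempotent at the tail of \<open>\<beta>\<close>.\<close>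

definition arrow_ext :: "('k, 'm, ('v, 'e) path \<Rightarrow> 'k) dg_module \<Rightarrow> 'e set \<Rightarrow> ('e \<Rightarrow> 'm) \<Rightarrow> (('v, 'e) path \<Rightarrow> 'k) \<Rightarrow> 'm" where
  "arrow_ext Z C z = dg_space.lin_ext Z (\<lambda>(u, p, v). if (u, p, v) \<in> ending C
     then act Z (z (last p)) (basis (u, butlast p, tail Q (last p))) else \<zero>\<^bsub>Z\<^esub>)"

context
  fixes Z :: "('k, 'm, ('v, 'e) path \<Rightarrow> 'k) dg_module"
  assumes Z: "dg_right_module A Z"
begin

interpretation Z: dg_right_module A Z by (rule Z)

lemma arrow_ext_summand:
  assumes "\<And>\<beta>. \<beta> \<in> C \<Longrightarrow> z \<beta> \<in> carrier Z"
  shows "(case r of (u, p, v) \<Rightarrow> if (u, p, v) \<in> ending C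
     then act Z (z (last p)) (basis (u, butlast p, tail Q (last p))) else \<zero>\<^bsub>Z\<^esub>) \<in> carrier Z"
proof (cases "r \<in> ending C")
  case True
  then show ?thesis
    by (cases rule: ending_cases) (use True assms in \<open>auto intro!: Z.act_closed path_span_basis\<close>)
qed (auto split: prod.splits)

text \<open>On the right ideal generated by \<open>B\<close> only the values at arrows of
  \<open>B\<close> count. This allows the generating set to be enlarged during the recursive
  construction.\<close>

lemma arrow_ext_cong:
  assumes "\<And>\<beta>. \<beta> \<in> C \<Longrightarrow> z \<beta> \<in> carrier Z" "\<And>\<beta>. \<beta> \<in> D \<Longrightarrow> z' \<beta> \<in> carrier Z"
    and "y \<in> path_span (ending B)" "B \<subseteq> C" "B \<subseteq> D" "\<And>\<beta>. \<beta> \<in> B \<Longrightarrow> z \<beta> = z' \<beta>"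
  shows "arrow_ext Z C z y = arrow_ext Z D z' y"
  unfolding arrow_ext_def
  by (rule Z.M.lin_ext_cong[OF arrow_ext_summand arrow_ext_summand])
    (use assms in \<open>auto simp: path_span_def ending_def split: prod.splits\<close>)

context
  fixes C :: "'e set" and z :: "'e \<Rightarrow> 'm"
  assumes C: "C \<subseteq> arcs Q" and z: "\<And>\<beta>. \<beta> \<in> C \<Longrightarrow> z \<beta> \<in> carrier Z"
begin

lemma arrow_ext_closed: "arrow_ext Z C z y \<in> carrier Z"
  unfolding arrow_ext_def by (rule Z.M.lin_ext_closed[OF arrow_ext_summand[of C z, OF z]])

lemma arrow_ext_zero: "arrow_ext Z C z (\<lambda>_. 0) = \<zero>\<^bsub>Z\<^esub>"
  unfolding arrow_ext_def by (rule Z.M.lin_ext_zero)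

lemma arrow_ext_add: "x \<in> path_span (paths Q) \<Longrightarrow> y \<in> path_span (paths Q) \<Longrightarrow>
    arrow_ext Z C z (\<lambda>r. x r + y r) = arrow_ext Z C z x \<oplus>\<^bsub>Z\<^esub> arrow_ext Z C z y"
  unfolding arrow_ext_def by (rule Z.M.lin_ext_add[OF arrow_ext_summand[of C z, OF z]]) (auto simp: path_span_def)

lemma arrow_ext_scalar: "x \<in> path_span (paths Q) \<Longrightarrow>
    arrow_ext Z C z (\<lambda>r. c * x r) = c \<odot>\<^bsub>Z\<^esub> arrow_ext Z C z x"
  unfolding arrow_ext_def by (rule Z.M.lin_ext_scalar[OF arrow_ext_summand[of C z, OF z]]) (auto simp: path_span_def)

lemma arrow_ext_basis:
  assumes "\<beta> \<in> C" "(u, p, tail Q \<beta>) \<in> paths Q"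
  shows "arrow_ext Z C z (basis (u, p @ [\<beta>], head Q \<beta>)) = act Z (z \<beta>) (basis (u, p, tail Q \<beta>))"
proof -
  have "(u, p @ [\<beta>], head Q \<beta>) \<in> ending C"
    using assms C by (auto simp: ending_def Q.snoc_in_paths_iff)
  then show ?thesis
    unfolding arrow_ext_def by (subst Z.M.lin_ext_basis[OF arrow_ext_summand[of C z, OF z]]) auto
qed

text \<open>The idempotent appears because \<open>z \<beta>\<close> need not be fixed by it. Paths
  in \<open>a\<close> that do not end at the tail of \<open>\<beta>\<close> are killed by
  \<open>\<beta>\<close> on the left side and by the idempotent on the right side.\<close>

lemma arrow_ext_arrow_mult:
  assumes \<beta>: "\<beta> \<in> C" and a: "a \<in> path_span (paths Q)"
  shows "arrow_ext Z C z (arrow Q \<beta> \<cdot> a) = act Z (z \<beta>) (basis (tail Q \<beta>, [], tail Q \<beta>) \<cdot> a)"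
  using a
proof (induction rule: path_span_induct)
  have \<beta>Q: "\<beta> \<in> arcs Q" using \<beta> C by auto
  have e: "(tail Q \<beta>, [], tail Q \<beta>) \<in> paths Q" using \<beta>Q by (simp add: Q.trivial_in_paths_iff)
  {
    case zero
    show ?case
      using \<beta>Q z[OF \<beta>] e Z.act_zero_right by (simp add: mult_zero_right arrow_closed path_span_basis arrow_ext_zero)
  next
    case (add r c y)
    obtain u p v where r: "r = (u, p, v)" by (cases r)
    have "arrow_ext Z C z (arrow Q \<beta> \<cdot> basis r) = act Z (z \<beta>) (basis (tail Q \<beta>, [], tail Q \<beta>) \<cdot> basis r)"
    proof (cases "v = tail Q \<beta>")
      case True
      have "arrow Q \<beta> \<cdot> basis r = basis (u, p @ [\<beta>], head Q \<beta>)"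
        unfolding arrow_def r using mult_basis[OF arrow_in_paths[OF \<beta>Q]] add True r by simp
      moreover have "basis (tail Q \<beta>, [], tail Q \<beta>) \<cdot> basis r = basis r"
        using mult_basis[OF e] add True r by simp
      ultimately show ?thesis using arrow_ext_basis[OF \<beta>] add True r by simp
    next
      case False
      have "arrow Q \<beta> \<cdot> basis r = (\<lambda>_. 0)"
        unfolding arrow_def r using mult_basis[OF arrow_in_paths[OF \<beta>Q]] add False r by auto
      moreover have "basis (tail Q \<beta>, [], tail Q \<beta>) \<cdot> basis r = (\<lambda>_. 0)"
        using mult_basis[OF e] add False r by auto
      ultimately show ?thesis using z[OF \<beta>] Z.act_zero_right by (simp add: arrow_ext_zero)
    qed
    then show ?case
      using add z[OF \<beta>] e \<beta>Q Z.act_add_right[of "z \<beta>"] Z.act_smult_right[of "z \<beta>"]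
      by (simp add: mult_add_right mult_scalar_right path_span_scalar path_span_basis arrow_closed
          arrow_ext_add arrow_ext_scalar mult_closed)
  }
qed

text \<open>Write a path as \<open>\<beta> p\<close> and reassociate
  \<open>(\<beta> p) a = \<beta> (p a)\<close>. The idempotent at the tail of \<open>\<beta>\<close>
  disappears since \<open>p\<close> ends there.\<close>

lemma arrow_ext_act:
  assumes y: "y \<in> path_span (ending C)" and a: "a \<in> path_span (paths Q)"
  shows "arrow_ext Z C z (y \<cdot> a) = act Z (arrow_ext Z C z y) a"
  using y
proof (induction rule: path_span_induct)
  case zero
  show ?case using a Z.act_zero_left by (simp add: mult_zero_left arrow_ext_zero)
next
  case (add r c y)
  from add(1) obtain u p \<beta> where r: "r = (u, p @ [\<beta>], head Q \<beta>)" "(u, p, tail Q \<beta>) \<in> paths Q"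
    "\<beta> \<in> arcs Q" "\<beta> \<in> C" "basis r = arrow Q \<beta> \<cdot> basis (u, p, tail Q \<beta>)"
    by (rule ending_cases)
  let ?p = "basis (u, p, tail Q \<beta>)" and ?e = "basis (tail Q \<beta>, [], tail Q \<beta>)"
  have p: "?p \<in> path_span (paths Q)" using r by (simp add: path_span_basis)
  have e: "?e \<in> path_span (paths Q)" using r by (simp add: path_span_basis Q.trivial_in_paths_iff)
  have ep: "?e \<cdot> ?p = ?p"
    using r by (intro idempotent_mult[where n = 0] path_span_basis) (auto simp: paths_to_def)
  have "arrow_ext Z C z (basis r \<cdot> a) = arrow_ext Z C z (arrow Q \<beta> \<cdot> (?p \<cdot> a))"
    using r p a by (simp add: mult_assoc arrow_closed)
  also have "\<dots> = act Z (z \<beta>) (?e \<cdot> (?p \<cdot> a))"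
    using arrow_ext_arrow_mult[OF r(4)] p a by (simp add: mult_closed)
  also have "?e \<cdot> (?p \<cdot> a) = ?p \<cdot> a"
    using mult_assoc[OF e p a] ep by simp
  also have "act Z (z \<beta>) (?p \<cdot> a) = act Z (act Z (z \<beta>) ?p) a"
    using Z.act_mult[of "z \<beta>" ?p a] z[OF r(4)] p a by simp
  also have "act Z (z \<beta>) ?p = arrow_ext Z C z (basis r)"
    using arrow_ext_basis[OF r(4,2)] r(1) by simp
  finally have *: "arrow_ext Z C z (basis r \<cdot> a) = act Z (arrow_ext Z C z (basis r)) a" .
  have rQ: "basis r \<in> path_span (paths Q)" using add(1) ending_subset by (auto intro: path_span_basis)
  show ?case
    using add(2,3) * rQ a ending_span[OF add(2)]
    by (simp add: mult_add_left mult_scalar_left path_span_scalar arrow_ext_add arrow_ext_scalar mult_closed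
        Z.act_add_left Z.act_smult_left arrow_ext_closed Z.M.scalar_closed)
qed

lemma arrow_ext_degree:
  assumes "\<And>\<beta>. \<beta> \<in> C \<Longrightarrow> z \<beta> \<in> component Z (deg \<beta> + q)"
    and "y \<in> path_span {r \<in> paths Q. path_degree deg r = m}"
  shows "arrow_ext Z C z y \<in> component Z (m + q)"
  unfolding arrow_ext_def
proof (rule Z.M.lin_ext_component[OF arrow_ext_summand[of C z, OF z] assms(2)])
  fix r assume "r \<in> {r \<in> paths Q. path_degree deg r = m}"
  then have r: "r \<in> paths Q" "path_degree deg r = m" by auto
  show "(case r of (u, p, v) \<Rightarrow> if (u, p, v) \<in> ending C
     then act Z (z (last p)) (basis (u, butlast p, tail Q (last p))) else \<zero>\<^bsub>Z\<^esub>) \<in> component Z (m + q)"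
  proof (cases "r \<in> ending C")
    case True
    then obtain u p \<beta> where *: "r = (u, p @ [\<beta>], head Q \<beta>)" "(u, p, tail Q \<beta>) \<in> paths Q" "\<beta> \<in> C"
      by (rule ending_cases)
    have "basis (u, p, tail Q \<beta>) \<in> component A (m - deg \<beta>)"
      using * r(2) by (auto intro!: path_span_basis simp: path_degree_def)
    then have "act Z (z \<beta>) (basis (u, p, tail Q \<beta>)) \<in> component Z ((deg \<beta> + q) + (m - deg \<beta>))"
      by (rule Z.act_degree[OF assms(1)[OF *(3)]])
    then show ?thesis using True * by (simp add: algebra_simps)
  qed (auto split: prod.splits simp: Z.M.component_zero)
qed

lemma arrow_ext_kernel:
  assumes s: "s \<in> graded_hom A p Z N" and N: "dg_right_module A N"
    and "\<And>\<beta>. \<beta> \<in> C \<Longrightarrow> s (z \<beta>) = \<zero>\<^bsub>N\<^esub>" and y: "y \<in> path_span (ending C)"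
  shows "s (arrow_ext Z C z y) = \<zero>\<^bsub>N\<^esub>"
proof -
  interpret N: dg_right_module A N by (rule N)
  have s0: "s \<zero>\<^bsub>Z\<^esub> = \<zero>\<^bsub>N\<^esub>"
    using graded_homD(3)[OF s, of "\<zero>\<^bsub>Z\<^esub>" 0] graded_homD(1)[OF s, of "\<zero>\<^bsub>Z\<^esub>"]
    by (simp add: Z.M.scalar_zero_left N.M.scalar_zero_left)
  show ?thesis using y
  proof (induction rule: path_span_induct)
    case zero
    show ?case by (simp add: arrow_ext_zero s0)
  next
    case (add r c y)
    from add(1) obtain u p \<beta> where r: "r = (u, p @ [\<beta>], head Q \<beta>)" "(u, p, tail Q \<beta>) \<in> paths Q"
      "\<beta> \<in> C" by (rule ending_cases)
    have "basis (u, p, tail Q \<beta>) \<in> path_span (paths Q)" using r by (simp add: path_span_basis)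
    then have "s (arrow_ext Z C z (basis r)) = \<zero>\<^bsub>N\<^esub>"
      using assms(3)[OF r(3)] r z[OF r(3)] N.act_zero_left by (simp add: arrow_ext_basis graded_homD(4)[OF s])
    moreover have "basis r \<in> path_span (paths Q)" using add(1) ending_subset by (auto intro: path_span_basis)
    ultimately show ?case
      using add(3) ending_span[OF add(2)]
      by (simp add: arrow_ext_add arrow_ext_scalar path_span_scalar graded_homD(2,3)[OF s] arrow_ext_closed
          Z.M.scalar_closed N.M.scalar_zero_right)
  qed
qed

text \<open>Writing \<open>D \<sigma> = d \<sigma> - (-1)^q \<sigma> \<delta>\<close> for the
  differential of a graded map of degree \<open>q\<close>, the equation is
  \<open>D \<sigma> = \<tau>\<close> for the extension \<open>\<sigma>\<close>. It passes from the
  arrows to their right ideal because on \<open>\<beta> p\<close> the Leibniz rules in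
  \<open>Z\<close> and in \<open>A\<close> produce the same second term, with sign
  \<open>(-1)^(deg \<beta> + q)\<close>. Closure of the ideal under \<open>\<delta>\<close> follows
  from the condition on the arrows.\<close>

lemma arrow_ext_differential:
  assumes \<tau>: "\<tau> \<in> graded_hom A (q + 1) (rad i) Z" and Ci: "\<And>\<beta>. \<beta> \<in> C \<Longrightarrow> head Q \<beta> = i"
    and zq: "\<And>\<beta>. \<beta> \<in> C \<Longrightarrow> z \<beta> \<in> component Z (deg \<beta> + q)"
    and \<delta>C: "\<And>\<beta>. \<beta> \<in> C \<Longrightarrow> \<delta> (arrow Q \<beta>) \<in> path_span (ending C)"
    and dz: "\<And>\<beta>. \<beta> \<in> C \<Longrightarrow> differential Z (z \<beta>) =
      \<tau> (arrow Q \<beta>) \<oplus>\<^bsub>Z\<^esub> ((-1) powi q) \<odot>\<^bsub>Z\<^esub> arrow_ext Z C z (\<delta> (arrow Q \<beta>))"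
    and y: "y \<in> path_span (ending C)"
  shows "differential Z (arrow_ext Z C z y) = \<tau> y \<oplus>\<^bsub>Z\<^esub> ((-1) powi q) \<odot>\<^bsub>Z\<^esub> arrow_ext Z C z (\<delta> y)"
  using y
proof (induction rule: path_span_induct)
  let ?E = "arrow_ext Z C z"
  have C_rad: "x \<in> path_span (paths_to 1 i)" if "x \<in> path_span (ending C)" for x :: "('v, 'e) path \<Rightarrow> 'k"
    using that unfolding paths_to_eq_ending by (rule path_span_subset) (use C Ci in \<open>auto simp: ending_def\<close>)
  note \<tau>_simps = graded_homD(1-4)[OF \<tau>, simplified right_ideal_simps]
  {
    case zero
    have "\<tau> (\<lambda>_. 0) = \<zero>\<^bsub>Z\<^esub>"
      using \<tau>_simps(3)[of "\<lambda>_. 0" 0] \<tau>_simps(1)[of "\<lambda>_. 0"] by (simp add: path_span_zero Z.M.scalar_zero_left)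
    then show ?case
      by (simp add: \<delta>_zero arrow_ext_zero Z.M.differential_zero Z.M.scalar_zero_right)
  next
    case (add r c y)
    from add(1) obtain u p \<beta> where r: "r = (u, p @ [\<beta>], head Q \<beta>)" "(u, p, tail Q \<beta>) \<in> paths Q"
      "\<beta> \<in> arcs Q" "\<beta> \<in> C" "basis r = arrow Q \<beta> \<cdot> basis (u, p, tail Q \<beta>)"
      by (rule ending_cases)
    let ?p = "basis (u, p, tail Q \<beta>)" and ?\<beta> = "arrow Q \<beta> :: ('v, 'e) path \<Rightarrow> 'k"
    let ?\<epsilon> = "(-1) powi q :: 'k" and ?\<eta> = "(-1) powi deg \<beta> :: 'k"
    have p: "?p \<in> path_span (paths Q)" using r by (simp add: path_span_basis)
    have \<delta>p: "\<delta> ?p \<in> path_span (paths_to 2 (tail Q \<beta>))" by (rule \<delta>_basis_paths_to[OF r(2)])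
    note \<delta>pQ = paths_to_span[OF \<delta>p]
    have \<beta>: "?\<beta> \<in> path_span (ending C)"
      unfolding arrow_def using r arrow_in_paths[OF r(3)] by (auto intro: path_span_basis simp: ending_def)
    have \<delta>\<beta>: "\<delta> ?\<beta> \<in> path_span (paths Q)" using \<delta>C[OF r(4)] by (rule ending_span)
    have z\<beta>: "z \<beta> \<in> carrier Z" by (rule z[OF r(4)])
    have E1: "?E (basis r) = act Z (z \<beta>) ?p" using arrow_ext_basis[OF r(4,2)] r(1) by simp
    have E2: "?E (?\<beta> \<cdot> \<delta> ?p) = act Z (z \<beta>) (\<delta> ?p)"
      using arrow_ext_arrow_mult[OF r(4) \<delta>pQ] idempotent_mult[OF _ \<delta>p] r(3) by simp
    have "\<delta> (basis r) = (\<lambda>s. (\<delta> ?\<beta> \<cdot> ?p) s + ?\<eta> * (?\<beta> \<cdot> \<delta> ?p) s)"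
      using \<delta>_mult[OF arrow_degree[OF r(3)] p] r(5) by simp
    then have E3: "?E (\<delta> (basis r)) = act Z (?E (\<delta> ?\<beta>)) ?p \<oplus>\<^bsub>Z\<^esub> ?\<eta> \<odot>\<^bsub>Z\<^esub> act Z (z \<beta>) (\<delta> ?p)"
      using \<delta>\<beta> \<delta>pQ p r(3)
      by (simp add: arrow_ext_add arrow_ext_scalar path_span_scalar mult_closed arrow_closed
          arrow_ext_act[OF \<delta>C[OF r(4)]] E2)
    have "differential Z (?E (basis r)) =
        act Z (differential Z (z \<beta>)) ?p \<oplus>\<^bsub>Z\<^esub> ((-1) powi (deg \<beta> + q)) \<odot>\<^bsub>Z\<^esub> act Z (z \<beta>) (\<delta> ?p)"
      using Z.act_leibniz[OF zq[OF r(4)], of ?p] p by (simp add: E1)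
    also have "act Z (differential Z (z \<beta>)) ?p = \<tau> (basis r) \<oplus>\<^bsub>Z\<^esub> ?\<epsilon> \<odot>\<^bsub>Z\<^esub> act Z (?E (\<delta> ?\<beta>)) ?p"
      using dz[OF r(4)] p \<tau>_simps(1,4)[OF C_rad[OF \<beta>]] r(5)
      by (simp add: Z.act_add_left Z.act_smult_left arrow_ext_closed Z.M.scalar_closed)
    also have "(-1) powi (deg \<beta> + q) = ?\<epsilon> * ?\<eta>" by (simp add: power_int_add)
    finally have *: "differential Z (?E (basis r)) = \<tau> (basis r) \<oplus>\<^bsub>Z\<^esub> ?\<epsilon> \<odot>\<^bsub>Z\<^esub> ?E (\<delta> (basis r))"
      using \<tau>_simps(1)[OF C_rad[OF path_span_basis[OF add(1)]]] z\<beta> p \<delta>pQ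
      by (simp add: E3 Z.M.scalar_simps Z.M.M.a_assoc arrow_ext_closed Z.act_closed)
    have rC: "basis r \<in> path_span (ending C)" using add(1) by (rule path_span_basis)
    have rQ: "basis r \<in> path_span (paths Q)" by (rule ending_span[OF rC])
    have yQ: "y \<in> path_span (paths Q)" by (rule ending_span[OF add(2)])
    have \<tau>r: "\<tau> (basis r) \<in> carrier Z" "\<tau> y \<in> carrier Z"
      using \<tau>_simps(1) C_rad rC add(2) by auto
    have \<tau>_sum: "\<tau> (\<lambda>s. c * basis r s + y s) = c \<odot>\<^bsub>Z\<^esub> \<tau> (basis r) \<oplus>\<^bsub>Z\<^esub> \<tau> y"
      using \<tau>_simps(2,3) C_rad[OF rC] C_rad[OF add(2)] by (simp add: path_span_scalar)
    have "differential Z (?E (\<lambda>s. c * basis r s + y s)) =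
        c \<odot>\<^bsub>Z\<^esub> differential Z (?E (basis r)) \<oplus>\<^bsub>Z\<^esub> differential Z (?E y)"
      using rQ yQ by (simp add: arrow_ext_add arrow_ext_scalar path_span_scalar Z.M.differential_add
          Z.M.differential_scalar arrow_ext_closed Z.M.scalar_closed)
    also have "\<dots> = c \<odot>\<^bsub>Z\<^esub> (\<tau> (basis r) \<oplus>\<^bsub>Z\<^esub> ?\<epsilon> \<odot>\<^bsub>Z\<^esub> ?E (\<delta> (basis r))) \<oplus>\<^bsub>Z\<^esub> (\<tau> y \<oplus>\<^bsub>Z\<^esub> ?\<epsilon> \<odot>\<^bsub>Z\<^esub> ?E (\<delta> y))"
      using * add(3) by simp
    also have "\<dots> = (c \<odot>\<^bsub>Z\<^esub> \<tau> (basis r) \<oplus>\<^bsub>Z\<^esub> \<tau> y) \<oplus>\<^bsub>Z\<^esub> ?\<epsilon> \<odot>\<^bsub>Z\<^esub> (c \<odot>\<^bsub>Z\<^esub> ?E (\<delta> (basis r)) \<oplus>\<^bsub>Z\<^esub> ?E (\<delta> y))"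
      using \<tau>r by (simp add: Z.M.scalar_simps arrow_ext_closed Z.M.M.a_ac mult.commute)
    also have "c \<odot>\<^bsub>Z\<^esub> ?E (\<delta> (basis r)) \<oplus>\<^bsub>Z\<^esub> ?E (\<delta> y) = ?E (\<delta> (\<lambda>s. c * basis r s + y s))"
      using rQ yQ by (simp add: \<delta>_add \<delta>_scalar \<delta>_closed path_span_scalar arrow_ext_add arrow_ext_scalar)
    finally show ?case by (simp add: \<tau>_sum)
  }
qed

end

end

end

section \<open>Solving the lifting equation on the radical\<close>

context path_dga
begin

text \<open>Only the leftmost arrow of a path decides in which right ideal the path lies. The rest
  of the path has nonpositive degree, so this arrow carries at least the whole degree
  \<open>deg \<beta> + 1\<close>.\<close>

lemma \<delta>_arrow_ending:
  assumes \<beta>: "\<beta> \<in> arcs Q"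
  shows "\<delta> (arrow Q \<beta>) \<in> path_span (ending {\<gamma> \<in> arcs Q. head Q \<gamma> = head Q \<beta> \<and> deg \<gamma> > deg \<beta>})"
proof -
  have 1: "\<delta> (arrow Q \<beta>) \<in> path_span (paths_to 2 (head Q \<beta>))" by (rule \<delta>_arrow_paths_to[OF \<beta>])
  have 2: "\<delta> (arrow Q \<beta>) \<in> path_span {p \<in> paths Q. path_degree deg p = deg \<beta> + 1}"
    by (rule \<delta>_degree[OF arrow_degree[OF \<beta>]])
  have "r \<in> ending {\<gamma> \<in> arcs Q. head Q \<gamma> = head Q \<beta> \<and> deg \<gamma> > deg \<beta>}"
    if r: "r \<in> paths_to 2 (head Q \<beta>)" "path_degree deg r = deg \<beta> + 1" for r
  proof -
    obtain u p \<gamma> where *: "r = (u, p @ [\<gamma>], head Q \<beta>)" "(u, p, tail Q \<gamma>) \<in> paths Q" "\<gamma> \<in> arcs Q"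
      "head Q \<gamma> = head Q \<beta>"
      using paths_to_cases[OF r(1)] by (metis zero_less_numeral)
    have "deg \<gamma> = deg \<beta> + 1 - path_degree deg (u, p, tail Q \<gamma>)"
      using r(2) *(1) by (simp add: path_degree_def)
    then have "deg \<gamma> > deg \<beta>" using path_degree_nonpos[OF *(2)] by simp
    then show ?thesis using * by (simp add: ending_def Q.snoc_in_paths_iff)
  qed
  then show ?thesis using 1 2 unfolding path_span_def by blast
qed

text \<open>Free of carrier conditions: the recursion principle compares arbitrary functions that
  agree below an arrow, including ones with values outside the module.\<close>

lemma arrow_ext_fun_cong: "(\<And>\<beta>. \<beta> \<in> C \<Longrightarrow> z \<beta> = z' \<beta>) \<Longrightarrow> arrow_ext Z C z = arrow_ext Z C z'"
  unfolding arrow_ext_def by (rule arg_cong[where f = "dg_space.lin_ext Z"]) (auto simp: ending_def fun_eq_iff)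

text \<open>The values of \<open>\<sigma>\<close> on the arrows are chosen by well-founded recursion: \<open>\<delta> \<beta>\<close> lies in the right ideal
  generated by the arrows of degree greater than that of \<open>\<beta>\<close>.\<close>

lemma lift_rad:
  assumes Z: "dg_right_module A Z" and N: "dg_right_module A N" and s: "s \<in> graded_hom A 0 Z N"
    and N_neg: "\<And>m. m < 0 \<Longrightarrow> component N m = {\<zero>\<^bsub>N\<^esub>}"
    and exact: "\<And>m x. x \<in> cocycles Z m \<Longrightarrow> s x = \<zero>\<^bsub>N\<^esub> \<Longrightarrow> x \<in> coboundaries Z m"
    and \<tau>: "\<tau> \<in> graded_hom A (q + 1) (rad i) Z" and q: "q < 0"
    and s\<tau>: "\<And>y. y \<in> carrier (rad i) \<Longrightarrow> s (\<tau> y) = \<zero>\<^bsub>N\<^esub>"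
    and chain: "\<And>y. y \<in> carrier (rad i) \<Longrightarrow>
      differential Z (\<tau> y) \<oplus>\<^bsub>Z\<^esub> ((-1) powi q) \<odot>\<^bsub>Z\<^esub> \<tau> (\<delta> y) = \<zero>\<^bsub>Z\<^esub>"
  shows "\<exists>\<sigma>\<in>graded_hom A q (rad i) Z. \<forall>y\<in>carrier (rad i).
    differential Z (\<sigma> y) = \<tau> y \<oplus>\<^bsub>Z\<^esub> ((-1) powi q) \<odot>\<^bsub>Z\<^esub> \<sigma> (\<delta> y)"
proof -
  interpret Z: dg_right_module A Z by (rule Z)
  interpret N: dg_right_module A N by (rule N)
  let ?\<epsilon> = "(-1) powi q :: 'k"
  define D where "D = {\<beta> \<in> arcs Q. head Q \<beta> = i}"
  define U where "U \<beta> = {\<gamma> \<in> D. deg \<gamma> > deg \<beta>}" for \<beta>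
  have D: "\<beta> \<in> arcs Q" "head Q \<beta> = i" if "\<beta> \<in> D" for \<beta> using that by (auto simp: D_def)
  have UD: "U \<beta> \<subseteq> D" for \<beta> by (auto simp: U_def)
  have rad_D: "path_span (paths_to 1 i) = (path_span (ending D) :: (('v, 'e) path \<Rightarrow> 'k) set)"
    unfolding paths_to_eq_ending D_def ..
  note \<tau>D = graded_homD[OF \<tau>, unfolded right_ideal_simps rad_D]
  have arrow_D: "arrow Q \<beta> \<in> (path_span (ending D) :: (('v, 'e) path \<Rightarrow> 'k) set)" if "\<beta> \<in> D" for \<beta>
    unfolding arrow_def using that arrow_in_paths[OF D(1)[OF that]]
    by (auto intro: path_span_basis simp: ending_def)
  have \<delta>U: "\<delta> (arrow Q \<beta>) \<in> path_span (ending (U \<beta>))" if "\<beta> \<in> D" for \<beta>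
  proof -
    have "U \<beta> = {\<gamma> \<in> arcs Q. head Q \<gamma> = head Q \<beta> \<and> deg \<gamma> > deg \<beta>}"
      using D[OF that] by (auto simp: U_def D_def)
    then show ?thesis using \<delta>_arrow_ending[OF D(1)[OF that]] by simp
  qed
  have ending_mono: "x \<in> path_span (ending C')" if "x \<in> path_span (ending C)" "C \<subseteq> C'"
    for x :: "('v, 'e) path \<Rightarrow> 'k" and C C'
    using that(1) by (rule path_span_subset) (use that(2) in \<open>auto simp: ending_def\<close>)
  \<comment> \<open>\<open>good f \<beta> r\<close> says that \<open>r\<close> is an admissible
    value at \<open>\<beta>\<close> when \<open>f\<close> gives the values at the arrows of larger
    degree. It is vacuous off \<open>D\<close>, since the recursion runs over the whole type of
    arrows.\<close>
  define good where "good f \<beta> r \<longleftrightarrow> (\<beta> \<in> D \<longrightarrow> r \<in> component Z (deg \<beta> + q) \<and>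
      differential Z r = \<tau> (arrow Q \<beta>) \<oplus>\<^bsub>Z\<^esub> ?\<epsilon> \<odot>\<^bsub>Z\<^esub> arrow_ext Z (U \<beta>) f (\<delta> (arrow Q \<beta>)))"
    for f \<beta> r
  \<comment> \<open>Used twice: for \<open>C = U \<beta>\<close> inside the recursion, and for
    \<open>C = D\<close> at the end. Both sets are closed under passing to arrows of larger degree
    with the same head.\<close>
  have diff: "differential Z (arrow_ext Z C f y) = \<tau> y \<oplus>\<^bsub>Z\<^esub> ?\<epsilon> \<odot>\<^bsub>Z\<^esub> arrow_ext Z C f (\<delta> y)"
    if f: "\<And>\<gamma>. \<gamma> \<in> C \<Longrightarrow> good f \<gamma> (f \<gamma>)" and CD: "C \<subseteq> D" and up: "\<And>\<gamma>. \<gamma> \<in> C \<Longrightarrow> U \<gamma> \<subseteq> C"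
      and y: "y \<in> path_span (ending C)" for f C y
  proof -
    have fq: "f \<gamma> \<in> component Z (deg \<gamma> + q)" if "\<gamma> \<in> C" for \<gamma>
      using f[OF that] that CD by (auto simp: good_def)
    note fZ = Z.M.component_carrier[OF fq]
    have "differential Z (f \<gamma>) = \<tau> (arrow Q \<gamma>) \<oplus>\<^bsub>Z\<^esub> ?\<epsilon> \<odot>\<^bsub>Z\<^esub> arrow_ext Z C f (\<delta> (arrow Q \<gamma>))"
      if "\<gamma> \<in> C" for \<gamma>
    proof -
      have "arrow_ext Z (U \<gamma>) f (\<delta> (arrow Q \<gamma>)) = arrow_ext Z C f (\<delta> (arrow Q \<gamma>))"
        using fZ up[OF that] that CD by (intro arrow_ext_cong[OF Z, where B = "U \<gamma>"] \<delta>U) auto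
      then show ?thesis using f[OF that] that CD by (auto simp: good_def)
    qed
    moreover have "\<delta> (arrow Q \<gamma>) \<in> path_span (ending C)" if "\<gamma> \<in> C" for \<gamma>
      using ending_mono[OF \<delta>U up] that CD by blast
    ultimately show ?thesis
      using CD D by (intro arrow_ext_differential[OF Z _ fZ \<tau> _ fq _ _ y]) auto
  qed
  have "\<exists>z. \<forall>\<beta>. good z \<beta> (z \<beta>)"
  proof (rule dependent_wf_choice)
    show "wf (measure (\<lambda>\<beta>. nat (- deg \<beta>)))" by simp
    \<comment> \<open>The recursion descends from degree 0. Since \<open>deg \<gamma>\<close> is at
      most 0, the truncation in \<open>nat\<close> does not destroy the strict inequality.\<close>
    have U_less: "(\<gamma>, \<beta>) \<in> measure (\<lambda>\<beta>. nat (- deg \<beta>))" if "\<gamma> \<in> U \<beta>" for \<gamma> \<beta>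
      using that deg_nonpos[of \<gamma>] by (auto simp: U_def D_def)
    show "good f \<beta> r = good g \<beta> r"
      if "\<And>\<gamma>. (\<gamma>, \<beta>) \<in> measure (\<lambda>\<beta>. nat (- deg \<beta>)) \<Longrightarrow> f \<gamma> = g \<gamma>" for f g \<beta> r
    proof -
      have "arrow_ext Z (U \<beta>) f = arrow_ext Z (U \<beta>) g"
        by (rule arrow_ext_fun_cong) (rule that[OF U_less])
      then show ?thesis by (simp add: good_def)
    qed
    show "\<exists>r. good f \<beta> r" if pre: "\<And>\<gamma>. (\<gamma>, \<beta>) \<in> measure (\<lambda>\<beta>. nat (- deg \<beta>)) \<Longrightarrow> good f \<gamma> (f \<gamma>)" for f \<beta>
    proof (cases "\<beta> \<in> D")
      case False
      then show ?thesis by (simp add: good_def)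
    next
      case True
      let ?E = "arrow_ext Z (U \<beta>) f" and ?\<beta> = "arrow Q \<beta> :: ('v, 'e) path \<Rightarrow> 'k"
      have good: "good f \<gamma> (f \<gamma>)" if "\<gamma> \<in> U \<beta>" for \<gamma> using pre U_less that by blast
      have fq: "f \<gamma> \<in> component Z (deg \<gamma> + q)" if "\<gamma> \<in> U \<beta>" for \<gamma>
        using good[OF that] that by (auto simp: good_def U_def)
      note fZ = Z.M.component_carrier[OF fq]
      have U_arcs: "U \<beta> \<subseteq> arcs Q" using D by (auto simp: U_def)
      have EZ: "?E x \<in> carrier Z" for x by (rule arrow_ext_closed[OF Z U_arcs fZ])
      have \<beta>: "?\<beta> \<in> path_span (ending D)" by (rule arrow_D[OF True])
      have \<beta>Q: "?\<beta> \<in> path_span (paths Q)" by (rule ending_span[OF \<beta>])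
      have \<delta>\<beta>: "\<delta> ?\<beta> \<in> path_span (ending (U \<beta>))" by (rule \<delta>U[OF True])
      have \<delta>\<beta>D: "\<delta> ?\<beta> \<in> path_span (ending D)" by (rule ending_mono[OF \<delta>\<beta> UD])
      \<comment> \<open>The equation prescribes \<open>c\<close> as the differential of the value at
        \<open>\<beta>\<close>. It remains to see that \<open>c\<close> is a cocycle killed by
        \<open>s\<close>; exactness then provides a value.\<close>
      define c where "c = \<tau> ?\<beta> \<oplus>\<^bsub>Z\<^esub> ?\<epsilon> \<odot>\<^bsub>Z\<^esub> ?E (\<delta> ?\<beta>)"
      have \<tau>\<beta>: "\<tau> ?\<beta> \<in> component Z (deg \<beta> + (q + 1))"
        by (rule \<tau>D(5)) (use \<beta> arrow_degree[OF D(1)[OF True]] in auto)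
      have E\<beta>: "?E (\<delta> ?\<beta>) \<in> component Z (deg \<beta> + 1 + q)"
        by (rule arrow_ext_degree[OF Z U_arcs fZ fq \<delta>_degree[OF arrow_degree[OF D(1)[OF True]]]])
      have "c \<in> component Z (deg \<beta> + q + 1)"
        using \<tau>\<beta> E\<beta> unfolding c_def
        by (intro Z.M.component_add Z.M.component_scalar) (simp_all add: algebra_simps)
      moreover have "differential Z c = \<zero>\<^bsub>Z\<^esub>"
      proof -
        \<comment> \<open>\<open>\<delta> \<beta>\<close> lies in the right ideal where the equation
          already holds, and \<open>\<delta> \<delta> = 0\<close> removes the last term. What is
          left of \<open>d c\<close> is the hypothesis \<open>chain\<close>, which says
          \<open>D \<tau> = 0\<close>.\<close>
        have "differential Z (?E (\<delta> ?\<beta>)) = \<tau> (\<delta> ?\<beta>) \<oplus>\<^bsub>Z\<^esub> ?\<epsilon> \<odot>\<^bsub>Z\<^esub> ?E (\<delta> (\<delta> ?\<beta>))"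
          by (rule diff[OF good UD _ \<delta>\<beta>]) (auto simp: U_def)
        also have "\<dots> = \<tau> (\<delta> ?\<beta>)"
          using \<tau>D(1)[OF \<delta>\<beta>D]
          by (simp add: \<delta>_\<delta>[OF \<beta>Q] arrow_ext_zero[OF Z U_arcs fZ] Z.M.scalar_zero_right)
        finally have "differential Z c = differential Z (\<tau> ?\<beta>) \<oplus>\<^bsub>Z\<^esub> ?\<epsilon> \<odot>\<^bsub>Z\<^esub> \<tau> (\<delta> ?\<beta>)"
          unfolding c_def using \<tau>D(1)[OF \<beta>] EZ
          by (simp add: Z.M.differential_add Z.M.differential_scalar Z.M.scalar_closed)
        then show ?thesis using chain[of ?\<beta>] \<beta> unfolding right_ideal_simps rad_D by simp
      qed
      ultimately have "c \<in> cocycles Z (deg \<beta> + q + 1)" by (simp add: cocycles_def)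
      moreover have "s c = \<zero>\<^bsub>N\<^esub>"
      proof -
        \<comment> \<open>Here \<open>q < 0\<close> enters: \<open>f \<gamma>\<close> has degree
          \<open>deg \<gamma> + q\<close>, which is negative, and \<open>N\<close> vanishes in
          negative degrees.\<close>
        have sf: "s (f \<gamma>) = \<zero>\<^bsub>N\<^esub>" if "\<gamma> \<in> U \<beta>" for \<gamma>
          using graded_homD(5)[OF s fq[OF that]] N_neg[of "deg \<gamma> + q"] q deg_nonpos[of \<gamma>] U_arcs that
          by auto
        have "s (?E (\<delta> ?\<beta>)) = \<zero>\<^bsub>N\<^esub>"
          by (rule arrow_ext_kernel[OF Z U_arcs fZ s N sf \<delta>\<beta>])
        then show ?thesis
          using s\<tau>[of ?\<beta>] \<beta> \<tau>D(1)[OF \<beta>] EZ unfolding c_def right_ideal_simps rad_D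
          by (simp add: graded_homD(2,3)[OF s] Z.M.scalar_closed N.M.scalar_zero_right)
      qed
      ultimately have "c \<in> coboundaries Z (deg \<beta> + q + 1)" by (rule exact)
      then obtain r where "r \<in> component Z (deg \<beta> + q)" "c = differential Z r"
        by (rule Z.M.coboundariesE) (simp add: algebra_simps)
      then show ?thesis unfolding good_def c_def by (intro exI[of _ r]) simp
    qed
  qed
  then obtain z where z: "\<And>\<beta>. good z \<beta> (z \<beta>)" by blast
  have zq: "z \<beta> \<in> component Z (deg \<beta> + q)" if "\<beta> \<in> D" for \<beta> using z[of \<beta>] that by (simp add: good_def)
  note zZ = Z.M.component_carrier[OF zq]
  have D_arcs: "D \<subseteq> arcs Q" using D by auto
  have "arrow_ext Z D z \<in> graded_hom A q (rad i) Z"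
  proof (rule graded_homI, unfold right_ideal_simps rad_D)
    fix x :: "('v, 'e) path \<Rightarrow> 'k" and m
    assume "x \<in> path_span (ending D) \<inter> component A m"
    then show "arrow_ext Z D z x \<in> component Z (m + q)"
      by (intro arrow_ext_degree[OF Z D_arcs zZ zq]) auto
  qed (auto simp: arrow_ext_closed[OF Z D_arcs zZ] arrow_ext_add[OF Z D_arcs zZ]
      arrow_ext_scalar[OF Z D_arcs zZ] arrow_ext_act[OF Z D_arcs zZ] ending_span)
  moreover have "differential Z (arrow_ext Z D z y) = \<tau> y \<oplus>\<^bsub>Z\<^esub> ?\<epsilon> \<odot>\<^bsub>Z\<^esub> arrow_ext Z D z (\<delta> y)"
    if "y \<in> carrier (rad i)" for y
    using that unfolding right_ideal_simps rad_D
    by (intro diff[OF z]) (auto simp: U_def)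
  ultimately show ?thesis by blast
qed

section \<open>Simple modules\<close>

text \<open>Differentials consist of paths of length at least 2. Hence \<open>\<delta> a\<close>
  acts by zero on a simple module, as the Leibniz rule for its zero differential demands.\<close>

lemma \<delta>_trivial_coefficient: "x \<in> path_span (paths Q) \<Longrightarrow> \<delta> x (v, [], v) = 0"
proof (induction rule: path_span_induct)
  case zero
  show ?case by (simp add: \<delta>_zero)
next
  case (add r c y)
  obtain u p w where r: "r = (u, p, w)" by (cases r)
  have "\<delta> (basis r) (v, [], v) = 0"
    using \<delta>_basis_paths_to[of u p w] add(1) unfolding r path_span_def paths_to_def by fastforce
  then show ?case using add by (simp add: \<delta>_add \<delta>_scalar path_span_scalar path_span_basis)
qed

text \<open>Stated for any record concentrated in one degree \<open>k\<close>, to cover the simple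
  module (\<open>k = 0\<close>) and its shift by \<open>n\<close> (\<open>k = -n\<close>) at once;
  the sign in the shift is invisible on a zero differential.\<close>

lemma simple_dg_right_module:
  fixes N :: "('k, ('v, 'e) path \<Rightarrow> 'k, ('v, 'e) path \<Rightarrow> 'k) dg_module"
  assumes v: "v \<in> verts Q"
    and N: "carrier N = path_span {(v, [], v)}" "\<zero>\<^bsub>N\<^esub> = (\<lambda>_. 0)" "\<And>x y. x \<oplus>\<^bsub>N\<^esub> y = (\<lambda>r. x r + y r)"
      "\<And>c x. c \<odot>\<^bsub>N\<^esub> x = (\<lambda>r. c * x r)"
      "\<And>m. component N m = (if m = k then path_span {(v, [], v)} else {\<lambda>_. 0})"
      "\<And>x. differential N x = (\<lambda>_. 0)" "\<And>x a. act N x a = (\<lambda>r. a (v, [], v) * x r)"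
  shows "dg_right_module A N"
proof -
  interpret graded_coordinates N "\<lambda>x. x" "{(v, [], v)}" "\<lambda>_. k"
    by unfold_locales
      (auto simp: N path_span_zero path_span_add path_span_scalar bij_betw_def path_span_def[symmetric])
  have sp: "dg_space N"
    by (rule dg_spaceI) (auto simp: N path_span_zero)
  have one: "\<one>\<^bsub>A\<^esub> (v, [], v) = 1" using v by (simp add: dg_path_algebra_def)
  have deg: "act N x a \<in> component N (m + n)" if "x \<in> component N m" "a \<in> component A n" for x a m n
  proof (cases "n = 0")
    case True
    then show ?thesis using that by (auto simp: N path_span_scalar)
  next
    case False
    have "a (v, [], v) = 0"
      using that(2) False v by (auto simp: path_span_def path_degree_def)
    then show ?thesis by (auto simp: N path_span_zero)
  qed
  have scalar_right: "(\<lambda>r. x r * c) \<in> path_span S" if "x \<in> path_span S" for x :: "('v, 'e) path \<Rightarrow> 'k" and c S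
    using path_span_scalar[OF that, of c] by (simp add: mult.commute)
  show ?thesis
    by (rule dg_right_module.intro[OF A.dg_algebra_axioms sp], rule dg_right_module_axioms.intro)
      (use deg in \<open>auto simp: N scalar_right one mult_trivial[OF v] \<delta>_trivial_coefficient algebra_simps\<close>)
qed

lemma simple_module_dg:
  assumes "v \<in> verts Q"
  shows "dg_right_module A (simple_module v)" "dg_right_module A (shift n (simple_module v))"
proof -
  show "dg_right_module A (simple_module v)"
    by (rule simple_dg_right_module[OF assms, where k = 0]) (auto simp: simple_module_def)
  show "dg_right_module A (shift n (simple_module v))"
    by (rule simple_dg_right_module[OF assms, where k = "-n"]) (auto simp: simple_module_def shift_def)
qed

lemma simple_module_simps [simp]:
  "carrier (simple_module v) = path_span {(v, [], v)}" "\<zero>\<^bsub>simple_module v\<^esub> = (\<lambda>_. 0)"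
  "x \<oplus>\<^bsub>simple_module v\<^esub> y = (\<lambda>r. x r + y r)" "c \<odot>\<^bsub>simple_module v\<^esub> x = (\<lambda>r. c * x r)"
  "component (simple_module v) m = (if m = 0 then path_span {(v, [], v)} else {\<lambda>_. 0})"
  "differential (simple_module v) x = (\<lambda>_. 0)" "act (simple_module v) x a = (\<lambda>r. a (v, [], v) * x r)"
  by (auto simp: simple_module_def)

lemma shift_simple_module_simps [simp]:
  "carrier (shift n (simple_module v)) = path_span {(v, [], v)}" "\<zero>\<^bsub>shift n (simple_module v)\<^esub> = (\<lambda>_. 0)"
  "x \<oplus>\<^bsub>shift n (simple_module v)\<^esub> y = (\<lambda>r. x r + y r)" "c \<odot>\<^bsub>shift n (simple_module v)\<^esub> x = (\<lambda>r. c * x r)"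
  "component (shift n (simple_module v)) m = (if m = - n then path_span {(v, [], v)} else {\<lambda>_. 0})"
  "differential (shift n (simple_module v)) x = (\<lambda>_. 0)"
  "act (shift n (simple_module v)) x a = (\<lambda>r. a (v, [], v) * x r)"
  by (auto simp: simple_module_def shift_def)

end

section \<open>The resolution of a simple module\<close>

text \<open>The module \<open>P\<close> is the cone of the inclusion of \<open>rad e\<^sub>i A\<close> into \<open>e\<^sub>i A\<close>, with its elements
  encoded in the universe by \<open>\<iota>\<close>.\<close>

locale simple_resolution = path_dga Q deg \<delta>
  for Q :: "('v, 'e) pre_digraph" and deg :: "'e \<Rightarrow> int"
    and \<delta> :: "(('v, 'e) path \<Rightarrow> 'k::field) \<Rightarrow> (('v, 'e) path \<Rightarrow> 'k)" +
  fixes i :: 'v and \<iota> :: "(('v, 'e) path \<Rightarrow> 'k) \<times> (('v, 'e) path \<Rightarrow> 'k) \<Rightarrow> 'u"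
  assumes i: "i \<in> verts Q"
    and \<iota>: "inj_on \<iota> (path_span (paths Q) \<times> path_span (paths Q))"
begin

definition p1 :: "'u \<Rightarrow> ('v, 'e) path \<Rightarrow> 'k" where
  "p1 u = fst (the_inv_into (path_span (paths Q) \<times> path_span (paths Q)) \<iota> u)"

definition p2 :: "'u \<Rightarrow> ('v, 'e) path \<Rightarrow> 'k" where
  "p2 u = snd (the_inv_into (path_span (paths Q) \<times> path_span (paths Q)) \<iota> u)"

abbreviation E0 :: "(('v, 'e) path \<Rightarrow> 'k) set" where "E0 \<equiv> path_span (paths_to 0 i)"
abbreviation E1 :: "(('v, 'e) path \<Rightarrow> 'k) set" where "E1 \<equiv> path_span (paths_to 1 i)"

text \<open>The second entry belongs to the radical shifted by one, which explains the degree
  \<open>n + 1\<close> and the sign of its differential; the summand \<open>p2 u\<close> in the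
  first entry is the inclusion whose cone is taken.\<close>

definition P :: "('k, 'u, ('v, 'e) path \<Rightarrow> 'k) dg_module" where
  "P = \<lparr>carrier = \<iota> ` (E0 \<times> E1), mult = undefined, one = undefined, zero = \<iota> (\<lambda>_. 0, \<lambda>_. 0),
     add = (\<lambda>u v. \<iota> (\<lambda>r. p1 u r + p1 v r, \<lambda>r. p2 u r + p2 v r)),
     smult = (\<lambda>c u. \<iota> (\<lambda>r. c * p1 u r, \<lambda>r. c * p2 u r)),
     component = (\<lambda>n. {u \<in> \<iota> ` (E0 \<times> E1). p1 u \<in> component A n \<and> p2 u \<in> component A (n + 1)}),
     differential = (\<lambda>u. \<iota> (\<lambda>r. \<delta> (p1 u) r + p2 u r, \<lambda>r. - 1 * \<delta> (p2 u) r)),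
     act = (\<lambda>u a. \<iota> (p1 u \<cdot> a, p2 u \<cdot> a))\<rparr>"

lemma E1_E0: "x \<in> E1 \<Longrightarrow> x \<in> E0"
  by (rule paths_to_mono) auto

lemma p_\<iota>:
  assumes "x \<in> E0" "y \<in> E1"
  shows "p1 (\<iota> (x, y)) = x" "p2 (\<iota> (x, y)) = y"
  using the_inv_into_f_f[OF \<iota>, of "(x, y)"] paths_to_span[OF assms(1)] paths_to_span[OF assms(2)]
  by (simp_all add: p1_def p2_def)

lemma \<iota>_mem: "x \<in> E0 \<Longrightarrow> y \<in> E1 \<Longrightarrow> \<iota> (x, y) \<in> carrier P"
  by (simp add: P_def)

lemma P_mem:
  assumes "u \<in> carrier P"
  shows "p1 u \<in> E0" "p2 u \<in> E1" "\<iota> (p1 u, p2 u) = u"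
  using assms p_\<iota> by (auto simp: P_def)

lemma P_mem_span: "u \<in> carrier P \<Longrightarrow> p1 u \<in> path_span (paths Q)" "u \<in> carrier P \<Longrightarrow> p2 u \<in> path_span (paths Q)"
  by (rule paths_to_span, erule P_mem)+

lemma P_eq_iff: "u \<in> carrier P \<Longrightarrow> v \<in> carrier P \<Longrightarrow> u = v \<longleftrightarrow> p1 u = p1 v \<and> p2 u = p2 v"
  by (metis P_mem(3))

lemma P_zero: "\<zero>\<^bsub>P\<^esub> \<in> carrier P" "p1 \<zero>\<^bsub>P\<^esub> = (\<lambda>_. 0)" "p2 \<zero>\<^bsub>P\<^esub> = (\<lambda>_. 0)"
  by (simp_all add: P_def p_\<iota> path_span_zero)

lemma P_add:
  assumes "u \<in> carrier P" "v \<in> carrier P"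
  shows "u \<oplus>\<^bsub>P\<^esub> v \<in> carrier P" "p1 (u \<oplus>\<^bsub>P\<^esub> v) = (\<lambda>r. p1 u r + p1 v r)" "p2 (u \<oplus>\<^bsub>P\<^esub> v) = (\<lambda>r. p2 u r + p2 v r)"
proof -
  have "(\<lambda>r. p1 u r + p1 v r) \<in> E0" "(\<lambda>r. p2 u r + p2 v r) \<in> E1"
    by (intro path_span_add P_mem assms)+
  then show "u \<oplus>\<^bsub>P\<^esub> v \<in> carrier P" "p1 (u \<oplus>\<^bsub>P\<^esub> v) = (\<lambda>r. p1 u r + p1 v r)" "p2 (u \<oplus>\<^bsub>P\<^esub> v) = (\<lambda>r. p2 u r + p2 v r)"
    by (simp_all add: P_def p_\<iota>)
qed

lemma P_smult:
  assumes "u \<in> carrier P"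
  shows "c \<odot>\<^bsub>P\<^esub> u \<in> carrier P" "p1 (c \<odot>\<^bsub>P\<^esub> u) = (\<lambda>r. c * p1 u r)" "p2 (c \<odot>\<^bsub>P\<^esub> u) = (\<lambda>r. c * p2 u r)"
proof -
  have "(\<lambda>r. c * p1 u r) \<in> E0" "(\<lambda>r. c * p2 u r) \<in> E1"
    by (intro path_span_scalar P_mem assms)+
  then show "c \<odot>\<^bsub>P\<^esub> u \<in> carrier P" "p1 (c \<odot>\<^bsub>P\<^esub> u) = (\<lambda>r. c * p1 u r)" "p2 (c \<odot>\<^bsub>P\<^esub> u) = (\<lambda>r. c * p2 u r)"
    by (simp_all add: P_def p_\<iota>)
qed

lemma P_act:
  assumes "u \<in> carrier P" "a \<in> path_span (paths Q)"
  shows "act P u a \<in> carrier P" "p1 (act P u a) = p1 u \<cdot> a" "p2 (act P u a) = p2 u \<cdot> a"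
proof -
  have "p1 u \<cdot> a \<in> E0" "p2 u \<cdot> a \<in> E1"
    by (intro paths_to_mult P_mem assms)+
  then show "act P u a \<in> carrier P" "p1 (act P u a) = p1 u \<cdot> a" "p2 (act P u a) = p2 u \<cdot> a"
    by (simp_all add: P_def p_\<iota>)
qed

lemma P_diff:
  assumes "u \<in> carrier P"
  shows "differential P u \<in> carrier P" "p1 (differential P u) = (\<lambda>r. \<delta> (p1 u) r + p2 u r)"
    "p2 (differential P u) = (\<lambda>r. - 1 * \<delta> (p2 u) r)"
proof -
  have d: "\<delta> (p1 u) \<in> E0" "\<delta> (p2 u) \<in> E1"
    by (rule paths_to_mono[OF \<delta>_paths_to], rule P_mem[OF assms], simp)+
  have "(\<lambda>r. \<delta> (p1 u) r + p2 u r) \<in> E0" "(\<lambda>r. - 1 * \<delta> (p2 u) r) \<in> E1"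
    by (rule path_span_add[OF d(1) E1_E0[OF P_mem(2)[OF assms]]] path_span_scalar[OF d(2)])+
  then show "differential P u \<in> carrier P" "p1 (differential P u) = (\<lambda>r. \<delta> (p1 u) r + p2 u r)"
    "p2 (differential P u) = (\<lambda>r. - 1 * \<delta> (p2 u) r)"
    by (simp_all add: P_def p_\<iota>)
qed

lemma P_component: "u \<in> component P n \<longleftrightarrow> u \<in> carrier P \<and> p1 u \<in> component A n \<and> p2 u \<in> component A (n + 1)"
  by (auto simp: P_def)

lemmas P_simps = P_zero P_add P_smult P_act P_diff P_mem_span

text \<open>The coordinates are the coefficients of both entries, indexed by a disjoint union of
  paths. A path in the shifted summand counts with its degree lowered by one.\<close>

lemma P_coordinates:
  "graded_coordinates P (\<lambda>u. case_sum (p1 u) (p2 u)) (Inl ` paths_to 0 i \<union> Inr ` paths_to 1 i)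
    (case_sum (path_degree deg) (\<lambda>r. path_degree deg r - 1))"
proof -
  let ?ev = "\<lambda>u. case_sum (p1 u) (p2 u)" and ?B = "Inl ` paths_to 0 i \<union> Inr ` paths_to 1 i"
  have supp: "{b. case_sum f g b \<noteq> 0} = Inl ` {r. f r \<noteq> 0} \<union> Inr ` {r. g r \<noteq> 0}"
    for f g :: "('v, 'e) path \<Rightarrow> 'k"
  proof -
    have "b \<in> {b. case_sum f g b \<noteq> 0} \<longleftrightarrow> b \<in> Inl ` {r. f r \<noteq> 0} \<union> Inr ` {r. g r \<noteq> 0}" for b
      by (cases b) auto
    then show ?thesis by blast
  qed
  have "bij_betw ?ev (carrier P) {f. finite {b. f b \<noteq> 0} \<and> {b. f b \<noteq> 0} \<subseteq> ?B}"
  proof (rule bij_betw_byWitness[where f' = "\<lambda>f. \<iota> (\<lambda>r. f (Inl r), \<lambda>r. f (Inr r))"])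
    show "\<forall>u\<in>carrier P. \<iota> (\<lambda>r. ?ev u (Inl r), \<lambda>r. ?ev u (Inr r)) = u"
      using P_mem(3) by simp
    show "?ev ` carrier P \<subseteq> {f. finite {b. f b \<noteq> 0} \<and> {b. f b \<noteq> 0} \<subseteq> ?B}"
    proof
      fix f assume "f \<in> ?ev ` carrier P"
      then obtain u where u: "u \<in> carrier P" "f = ?ev u" by auto
      show "f \<in> {f. finite {b. f b \<noteq> 0} \<and> {b. f b \<noteq> 0} \<subseteq> ?B}"
        using P_mem(1,2)[OF u(1)] unfolding u(2) mem_Collect_eq supp by (auto simp: path_span_def)
    qed
    have *: "(\<lambda>r. f (Inl r)) \<in> E0" "(\<lambda>r. f (Inr r)) \<in> E1"
      if "finite {b. f b \<noteq> 0}" "{b. f b \<noteq> 0} \<subseteq> ?B" for f :: "('v, 'e) path + ('v, 'e) path \<Rightarrow> 'k"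
      using finite_vimageI[OF that(1), of Inl] finite_vimageI[OF that(1), of Inr] that(2)
      by (auto simp: path_span_def vimage_def)
    show "\<forall>f\<in>{f. finite {b. f b \<noteq> 0} \<and> {b. f b \<noteq> 0} \<subseteq> ?B}. ?ev (\<iota> (\<lambda>r. f (Inl r), \<lambda>r. f (Inr r))) = f"
      using * p_\<iota> by (auto simp: fun_eq_iff split: sum.splits)
    show "(\<lambda>f. \<iota> (\<lambda>r. f (Inl r), \<lambda>r. f (Inr r))) ` {f. finite {b. f b \<noteq> 0} \<and> {b. f b \<noteq> 0} \<subseteq> ?B} \<subseteq> carrier P"
      using * \<iota>_mem by blast
  qed
  moreover have "u \<in> component P n \<longleftrightarrow> u \<in> carrier P \<and>
      (\<forall>b. ?ev u b \<noteq> 0 \<longrightarrow> case_sum (path_degree deg) (\<lambda>r. path_degree deg r - 1) b = n)" for u n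
  proof (cases "u \<in> carrier P")
    case True
    have *: "x \<in> component A m \<longleftrightarrow> (\<forall>r. x r \<noteq> 0 \<longrightarrow> path_degree deg r = m)" if "x \<in> path_span (paths Q)" for x m
      using that by (auto simp: path_span_def)
    show ?thesis
      unfolding P_component *[OF P_mem_span(1)[OF True]] *[OF P_mem_span(2)[OF True]]
      by (simp add: True split_sum_all diff_eq_eq)
  qed (simp add: P_component)
  ultimately show ?thesis
    by unfold_locales (auto simp: P_simps fun_eq_iff split: sum.splits)
qed

lemma P_dg: "dg_right_module A P"
proof -
  interpret graded_coordinates P "\<lambda>u. case_sum (p1 u) (p2 u)" "Inl ` paths_to 0 i \<union> Inr ` paths_to 1 i"
    "case_sum (path_degree deg) (\<lambda>r. path_degree deg r - 1)" by (rule P_coordinates)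
  have sp: "dg_space P"
  proof (rule dg_spaceI)
    fix x n assume x: "x \<in> component P n"
    then have x': "x \<in> carrier P" "p1 x \<in> component A n" "p2 x \<in> component A (n + 1)"
      by (auto simp: P_component)
    then have "\<delta> (p1 x) \<in> component A (n + 1)" "\<delta> (p2 x) \<in> component A (n + 1 + 1)"
      using \<delta>_degree[of "p1 x" n] \<delta>_degree[of "p2 x" "n + 1"] by simp_all
    then show "differential P x \<in> component P (n + 1)"
      using x' path_span_scalar[of "\<delta> (p2 x)" _ "- 1"] by (simp add: P_component P_simps path_span_add)
  next
    fix x assume x: "x \<in> carrier P"
    then show "differential P (differential P x) = \<zero>\<^bsub>P\<^esub>"
      using \<delta>_scalar[of "\<delta> (p2 x)" "- 1"]
      by (simp add: P_eq_iff P_simps \<delta>_add \<delta>_\<delta> \<delta>_closed path_span_scalar)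
  qed (auto simp: P_eq_iff P_simps \<delta>_add \<delta>_scalar algebra_simps)
  have deg: "act P x a \<in> component P (m + n)" if "x \<in> component P m" "a \<in> component A n" for x a m n
  proof -
    have x: "x \<in> carrier P" "p1 x \<in> component A m" "p2 x \<in> component A (m + 1)"
      using that by (auto simp: P_component)
    have "a \<in> path_span (paths Q)" using that(2) by (auto intro: path_span_subset)
    moreover have "p1 x \<cdot> a \<in> component A (m + n)" "p2 x \<cdot> a \<in> component A (m + 1 + n)"
      using A.mult_degree[OF x(2) that(2)] A.mult_degree[OF x(3) that(2)] by auto
    ultimately show ?thesis using x(1) by (simp add: P_component P_simps algebra_simps)
  qed
  have leibniz: "differential P (act P x a) =
      act P (differential P x) a \<oplus>\<^bsub>P\<^esub> ((-1) powi m) \<odot>\<^bsub>P\<^esub> act P x (differential A a)"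
    if "x \<in> component P m" "a \<in> carrier A" for x a m
  proof -
    have x: "x \<in> carrier P" "p1 x \<in> path_span {p \<in> paths Q. path_degree deg p = m}"
      "p2 x \<in> path_span {p \<in> paths Q. path_degree deg p = m + 1}"
      using that(1) by (auto simp: P_component)
    have a: "a \<in> path_span (paths Q)" using that(2) by simp
    show ?thesis
      using x(1) a \<delta>_mult[OF x(2) a] \<delta>_mult[OF x(3) a] mult_scalar_left[of "\<delta> (p2 x)" a "- 1"]
      by (simp add: P_eq_iff P_simps \<delta>_closed mult_add_left power_int_add algebra_simps)
  qed
  have one: "x \<cdot> \<one>\<^bsub>A\<^esub> = x" if "x \<in> path_span (paths Q)" for x
    using A.R.r_one[of x] that by simp
  have one_mem: "\<one>\<^bsub>A\<^esub> \<in> path_span (paths Q)" using A.R.one_closed by simp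
  show ?thesis
    by (rule dg_right_module.intro[OF A.dg_algebra_axioms sp], rule dg_right_module_axioms.intro)
      (use deg leibniz in \<open>auto simp: P_eq_iff P_simps one one_mem mult_closed mult_add_left mult_add_right
        mult_scalar_left mult_scalar_right mult_assoc path_span_add path_span_scalar\<close>)
qed

sublocale P: dg_right_module A P by (rule P_dg)

abbreviation S :: "('k, ('v, 'e) path \<Rightarrow> 'k, ('v, 'e) path \<Rightarrow> 'k) dg_module" where "S \<equiv> simple_module i"

definition \<pi> :: "'u \<Rightarrow> ('v, 'e) path \<Rightarrow> 'k" where
  "\<pi> u = (\<lambda>r. if r = (i, [], i) then p1 u r else 0)"

lemma E1_trivial: "x \<in> E1 \<Longrightarrow> x (i, [], i) = 0"
  by (auto simp: path_span_def paths_to_def)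

text \<open>The only path of length 0 ending at \<open>i\<close> is the trivial one, so the radical
  is the kernel of the augmentation.\<close>

lemma E0_E1: "x \<in> E0 \<Longrightarrow> x (i, [], i) = 0 \<Longrightarrow> x \<in> E1"
proof -
  assume x: "x \<in> E0" "x (i, [], i) = 0"
  have "r \<in> paths_to 1 i" if "x r \<noteq> 0" for r
  proof -
    have "r \<in> paths_to 0 i" using x(1) that by (auto simp: path_span_def)
    then obtain u p where r: "r = (u, p, i)" "(u, p, i) \<in> paths Q" by (auto simp: paths_to_def)
    have "p \<noteq> []" using r that x(2) by (auto simp: Q.trivial_in_paths_iff)
    then show ?thesis using r by (cases p) (auto simp: paths_to_def)
  qed
  then show ?thesis using x(1) by (auto simp: path_span_def)
qed

lemma \<pi>_dg_hom: "\<pi> \<in> dg_hom A P S"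
proof -
  have "\<pi> \<in> graded_hom A 0 P S"
  proof (rule graded_homI)
    fix m x assume "x \<in> component P m"
    then have x: "p1 x \<in> component A m" by (simp add: P_component)
    have "path_degree deg (i, [], i) = 0" by (simp add: path_degree_def)
    then have "m = 0" if "p1 x (i, [], i) \<noteq> 0" using x that by (auto simp: path_span_def)
    then show "\<pi> x \<in> component S (m + 0)"
      by (auto simp: \<pi>_def path_span_def fun_eq_iff)
  qed (auto simp: \<pi>_def P_simps mult_trivial[OF i] path_span_def)
  moreover have "\<pi> (differential P x) = differential S (\<pi> x)" if "x \<in> carrier P" for x
    using that E1_trivial[OF P_mem(2)[OF that]]
    by (auto simp: \<pi>_def P_simps \<delta>_trivial_coefficient)
  ultimately show ?thesis by (simp add: dg_hom_def)
qed

lemma S_coboundaries: "coboundaries (simple_module v) n = {\<lambda>_. 0}"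
  by (auto simp: coboundaries_def intro: image_eqI[OF _ path_span_zero])

lemma S_minus:
  fixes x y :: "('v, 'e) path \<Rightarrow> 'k"
  assumes "v \<in> verts Q" "x \<in> path_span {(v, [], v)}" "y \<in> path_span {(v, [], v)}"
  shows "x \<ominus>\<^bsub>simple_module v\<^esub> y = (\<lambda>_. 0) \<longleftrightarrow> x = y"
    and "x \<ominus>\<^bsub>shift n (simple_module v)\<^esub> y = (\<lambda>_. 0) \<longleftrightarrow> x = y"
proof -
  interpret S: dg_right_module A "simple_module v" by (rule simple_module_dg(1)[OF assms(1)])
  interpret T: dg_right_module A "shift n (simple_module v)" by (rule simple_module_dg(2)[OF assms(1)])
  show "x \<ominus>\<^bsub>simple_module v\<^esub> y = (\<lambda>_. 0) \<longleftrightarrow> x = y" using S.M.minus_zero_iff[of x y] assms by simp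
  show "x \<ominus>\<^bsub>shift n (simple_module v)\<^esub> y = (\<lambda>_. 0) \<longleftrightarrow> x = y" using T.M.minus_zero_iff[of x y] assms by simp
qed

text \<open>\<open>S\<close> has no nonzero coboundaries, so a class in it is a single element. In
  degrees other than 0 the target has no cohomology and surjectivity is automatic.\<close>

lemma quasi_iso_simple_iff:
  assumes Z: "dg_right_module A Z" and f: "f \<in> dg_hom A Z S"
  shows "quasi_iso A Z S f \<longleftrightarrow>
    (\<forall>n. \<forall>x\<in>cocycles Z n. f x = (\<lambda>_. 0) \<longrightarrow> x \<in> coboundaries Z n) \<and>
    (\<forall>c\<in>path_span {(i, [], i)}. \<exists>x\<in>cocycles Z 0. f x = c)"
proof -
  interpret Z: dg_right_module A Z by (rule Z)
  interpret S: dg_right_module A S by (rule simple_module_dg(1)[OF i])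
  have fS: "f x \<in> path_span {(i, [], i)}" if "x \<in> cocycles Z n" for x n
    using f graded_homD(1)[of f 0 Z S] Z.M.cocycles_carrier[OF that] by (simp add: dg_hom_def)
  have f0: "f \<zero>\<^bsub>Z\<^esub> = (\<lambda>_. 0)"
    using f graded_homD(3)[of f 0 Z S "\<zero>\<^bsub>Z\<^esub>" 0] Z.M.scalar_zero_left[of "\<zero>\<^bsub>Z\<^esub>"]
    by (simp add: dg_hom_def)
  have z: "\<zero>\<^bsub>Z\<^esub> \<in> cocycles Z n" for n
    by (simp add: cocycles_def Z.M.component_zero Z.M.differential_zero)
  have "(\<forall>y\<in>cocycles S n. \<exists>x\<in>cocycles Z n. f x \<ominus>\<^bsub>S\<^esub> y \<in> coboundaries S n) \<longleftrightarrow>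
      (n = 0 \<longrightarrow> (\<forall>c\<in>path_span {(i, [], i)}. \<exists>x\<in>cocycles Z 0. f x = c))" for n
  proof -
    have "(\<forall>y\<in>cocycles S n. \<exists>x\<in>cocycles Z n. f x \<ominus>\<^bsub>S\<^esub> y \<in> coboundaries S n) \<longleftrightarrow>
        (\<forall>y\<in>cocycles S n. \<exists>x\<in>cocycles Z n. f x = y)"
      by (intro ball_cong bex_cong refl)
        (use fS S_minus(1)[OF i] in \<open>auto simp: S_coboundaries cocycles_def path_span_zero split: if_splits\<close>)
    also have "\<dots> \<longleftrightarrow> (n = 0 \<longrightarrow> (\<forall>c\<in>path_span {(i, [], i)}. \<exists>x\<in>cocycles Z 0. f x = c))"
      using z[of n] f0 by (cases "n = 0") (auto simp: cocycles_def[of S])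
    finally show ?thesis .
  qed
  then show ?thesis
    unfolding quasi_iso_iff[OF Z.M.dg_space_axioms S.M.dg_space_axioms f]
    by (auto simp: S_coboundaries)
qed

lemma \<pi>_quasi_iso: "quasi_iso A P S \<pi>"
  unfolding quasi_iso_simple_iff[OF P_dg \<pi>_dg_hom]
proof (intro conjI allI ballI impI)
  fix n u assume u: "u \<in> cocycles P n" and \<pi>u: "\<pi> u = (\<lambda>_. 0)"
  have uP: "u \<in> carrier P" "p1 u \<in> component A n" using u by (auto simp: cocycles_def P_component)
  have x: "p1 u \<in> E1"
    using fun_cong[OF \<pi>u, of "(i, [], i)"] by (intro E0_E1 P_mem uP) (simp add: \<pi>_def)
  \<comment> \<open>The differential of \<open>(0, x)\<close> is \<open>(x, - \<delta> x)\<close>.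
    With \<open>x\<close> the first entry of \<open>u\<close>, which lies in the radical, this is
    \<open>u\<close> itself, since the cocycle condition forces the second entry to be
    \<open>- \<delta> x\<close>.\<close>
  let ?v = "\<iota> (\<lambda>_. 0, p1 u)"
  have v: "?v \<in> carrier P" "p1 ?v = (\<lambda>_. 0)" "p2 ?v = p1 u"
    using x by (auto simp: p_\<iota> path_span_zero intro: \<iota>_mem)
  have "differential P u = \<zero>\<^bsub>P\<^esub>" using u by (simp add: cocycles_def)
  then have "(\<lambda>r. \<delta> (p1 u) r + p2 u r) = (\<lambda>_. 0)" using uP P_diff(2)[of u] P_zero(2) by simp
  then have "p2 u = (\<lambda>r. - 1 * \<delta> (p1 u) r)" by (simp add: fun_eq_iff) (metis add.inverse_unique)
  then have "u = differential P ?v"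
    using v uP by (simp add: P_eq_iff P_simps \<delta>_zero)
  moreover have "?v \<in> component P (n - 1)" using v uP(2) by (simp add: P_component path_span_zero)
  ultimately show "u \<in> coboundaries P n" unfolding coboundaries_def by blast
next
  fix c :: "('v, 'e) path \<Rightarrow> 'k" assume c: "c \<in> path_span {(i, [], i)}"
  have E: "(i, [], i) \<in> paths_to 0 i" using i by (simp add: paths_to_def Q.trivial_in_paths_iff)
  have cE: "c \<in> E0" using c by (rule path_span_subset) (use E in auto)
  have c_eq: "c = (\<lambda>r. c (i, [], i) * basis (i, [], i) r)"
    using c by (auto simp: path_span_def path_basis_def fun_eq_iff)
  have "\<delta> c = (\<lambda>_. 0)"
    using \<delta>_scalar[of "basis (i, [], i)" "c (i, [], i)"] c_eq \<delta>_trivial[OF i] E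
    by (simp add: path_span_basis paths_to_def)
  moreover have "c \<in> component A 0"
    using c by (auto intro!: path_span_subset[OF c] simp: path_degree_def Q.trivial_in_paths_iff i)
  ultimately have "\<iota> (c, \<lambda>_. 0) \<in> cocycles P 0"
    using cE by (simp add: cocycles_def P_component \<iota>_mem p_\<iota> path_span_zero P_eq_iff P_simps \<delta>_zero)
  moreover have "\<pi> (\<iota> (c, \<lambda>_. 0)) = c"
    using cE c by (auto simp: \<pi>_def p_\<iota> path_span_zero path_span_def fun_eq_iff)
  ultimately show "\<exists>u\<in>cocycles P 0. \<pi> u = c" by blast
qed

end

section \<open>Maps out of the resolution\<close>

context path_dga
begin

lemma graded_hom_comp:
  assumes f: "f \<in> graded_hom A p M N" and g: "g \<in> graded_hom A q N K"
  shows "(\<lambda>x. g (f x)) \<in> graded_hom A (p + q) M K"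
proof (rule graded_homI)
  fix m x assume "x \<in> component M m"
  then show "g (f x) \<in> component K (m + (p + q))"
    using graded_homD(5)[OF g graded_homD(5)[OF f, of x m]] by (simp add: algebra_simps)
qed (use graded_homD[OF f] graded_homD[OF g] in auto)

text \<open>Of the source only the inclusion of its components in the carrier is required, so that
  the radical is allowed as a source.\<close>

lemma graded_hom_combine:
  assumes f: "f \<in> graded_hom A p M N" and g: "g \<in> graded_hom A p M N" and N: "dg_right_module A N"
    and M: "\<And>m x. x \<in> component M m \<Longrightarrow> x \<in> carrier M"
  shows "(\<lambda>x. f x \<oplus>\<^bsub>N\<^esub> c \<odot>\<^bsub>N\<^esub> g x) \<in> graded_hom A p M N"
proof -
  interpret N: dg_right_module A N by (rule N)
  note closed = graded_homD(1)[OF f] graded_homD(1)[OF g]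
  show ?thesis
  proof (rule graded_homI)
    fix x y assume "x \<in> carrier M" "y \<in> carrier M"
    then show "f (x \<oplus>\<^bsub>M\<^esub> y) \<oplus>\<^bsub>N\<^esub> c \<odot>\<^bsub>N\<^esub> g (x \<oplus>\<^bsub>M\<^esub> y) =
        (f x \<oplus>\<^bsub>N\<^esub> c \<odot>\<^bsub>N\<^esub> g x) \<oplus>\<^bsub>N\<^esub> (f y \<oplus>\<^bsub>N\<^esub> c \<odot>\<^bsub>N\<^esub> g y)"
      by (simp add: graded_homD(2)[OF f] graded_homD(2)[OF g] closed N.M.scalar_closed N.M.scalar_add_right N.M.M.a_ac)
  next
    fix a x assume "x \<in> carrier M"
    then show "f (a \<odot>\<^bsub>M\<^esub> x) \<oplus>\<^bsub>N\<^esub> c \<odot>\<^bsub>N\<^esub> g (a \<odot>\<^bsub>M\<^esub> x) = a \<odot>\<^bsub>N\<^esub> (f x \<oplus>\<^bsub>N\<^esub> c \<odot>\<^bsub>N\<^esub> g x)"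
      by (simp add: graded_homD(3)[OF f] graded_homD(3)[OF g] closed N.M.scalar_simps mult.commute)
  next
    fix x a assume "x \<in> carrier M" "a \<in> carrier A"
    then show "f (act M x a) \<oplus>\<^bsub>N\<^esub> c \<odot>\<^bsub>N\<^esub> g (act M x a) = act N (f x \<oplus>\<^bsub>N\<^esub> c \<odot>\<^bsub>N\<^esub> g x) a"
      by (simp add: graded_homD(4)[OF f] graded_homD(4)[OF g] closed N.M.scalar_closed N.act_add_left N.act_smult_left)
  next
    fix m x assume "x \<in> component M m"
    then show "f x \<oplus>\<^bsub>N\<^esub> c \<odot>\<^bsub>N\<^esub> g x \<in> component N (m + p)"
      using graded_homD(5)[OF f] graded_homD(5)[OF g] by (intro N.M.component_add N.M.component_scalar)
  qed (use closed in \<open>auto intro: N.M.scalar_closed\<close>)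
qed

lemma dg_hom_comp: "f \<in> dg_hom A M N \<Longrightarrow> g \<in> dg_hom A N K \<Longrightarrow> (\<lambda>x. g (f x)) \<in> dg_hom A M K"
  using graded_hom_comp[of f 0 M N g 0 K] graded_homD(1)[of f 0 M N] by (auto simp: dg_hom_def)

lemma dg_hom_combine:
  assumes "f \<in> dg_hom A M N" "g \<in> dg_hom A M N" "dg_right_module A N" "dg_right_module A M"
  shows "(\<lambda>x. f x \<oplus>\<^bsub>N\<^esub> c \<odot>\<^bsub>N\<^esub> g x) \<in> dg_hom A M N"
proof -
  interpret N: dg_right_module A N by (rule assms)
  interpret M: dg_right_module A M by (rule assms)
  have f: "f \<in> graded_hom A 0 M N" "\<And>x. x \<in> carrier M \<Longrightarrow> f (differential M x) = differential N (f x)"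
    and g: "g \<in> graded_hom A 0 M N" "\<And>x. x \<in> carrier M \<Longrightarrow> g (differential M x) = differential N (g x)"
    using assms by (auto simp: dg_hom_def)
  show ?thesis
    using graded_hom_combine[OF f(1) g(1) assms(3) M.M.component_carrier] graded_homD(1)[OF f(1)] graded_homD(1)[OF g(1)]
    by (auto simp: dg_hom_def f(2) g(2) N.M.differential_add N.M.differential_scalar N.M.scalar_closed)
qed

lemma rad_hom_eqI:
  assumes \<phi>: "\<phi> \<in> graded_hom A p (rad i) N" and \<psi>: "\<psi> \<in> graded_hom A p (rad i) N" and N: "dg_right_module A N"
    and eq: "\<And>\<beta>. \<beta> \<in> arcs Q \<Longrightarrow> head Q \<beta> = i \<Longrightarrow> \<phi> (arrow Q \<beta>) = \<psi> (arrow Q \<beta>)"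
    and y: "y \<in> path_span (paths_to 1 i)"
  shows "\<phi> y = \<psi> y"
  using y
proof (induction rule: path_span_induct)
  interpret N: dg_right_module A N by (rule N)
  note hom = graded_homD(1-4)[OF \<phi>, unfolded right_ideal_simps] graded_homD(1-4)[OF \<psi>, unfolded right_ideal_simps]
  {
    case zero
    show ?case
      using hom(3,7)[OF path_span_zero, of 0] hom(1,5)[OF path_span_zero] by (simp add: N.M.scalar_zero_left)
  next
    case (add r c y)
    obtain u p \<beta> where r: "(u, p, tail Q \<beta>) \<in> paths Q" "\<beta> \<in> arcs Q" "head Q \<beta> = i"
      "basis r = arrow Q \<beta> \<cdot> basis (u, p, tail Q \<beta>)"
      by (rule paths_to_cases[OF add(1)]) (simp, blast)
    have \<beta>: "arrow Q \<beta> \<in> (path_span (paths_to 1 i) :: (('v, 'e) path \<Rightarrow> 'k) set)"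
      unfolding arrow_def using r arrow_in_paths[OF r(2)] by (auto intro: path_span_basis simp: paths_to_def)
    have "\<phi> (basis r) = \<psi> (basis r)"
      using r eq[OF r(2,3)] by (simp add: hom(4,8)[OF \<beta>] path_span_basis)
    moreover have "basis r \<in> path_span (paths_to 1 i)" by (rule path_span_basis[OF add(1)])
    ultimately show ?case
      using add(3) hom(2,3,6,7) add(2) by (simp add: path_span_scalar)
  }
qed

text \<open>An arrow \<open>\<beta>\<close> is sent to degree \<open>deg \<beta> + p\<close>, which
  is negative, and the arrows ending at \<open>i\<close> generate the radical.\<close>

lemma rad_hom_zero:
  assumes \<phi>: "\<phi> \<in> graded_hom A p (rad i) N" and p: "p < 0" and N: "dg_right_module A N"
    and N_neg: "\<And>m. m < 0 \<Longrightarrow> component N m = {\<zero>\<^bsub>N\<^esub>}" and y: "y \<in> path_span (paths_to 1 i)"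
  shows "\<phi> y = \<zero>\<^bsub>N\<^esub>"
proof (rule rad_hom_eqI[OF \<phi> _ N _ y])
  interpret N: dg_right_module A N by (rule N)
  show "(\<lambda>_. \<zero>\<^bsub>N\<^esub>) \<in> graded_hom A p (rad i) N"
    by (rule graded_homI) (auto simp: N.M.scalar_zero_right N.act_zero_left N.M.component_zero)
  fix \<beta> assume \<beta>: "\<beta> \<in> arcs Q" "head Q \<beta> = i"
  then have "arrow Q \<beta> \<in> component (rad i) (deg \<beta>)"
    using arrow_degree[OF \<beta>(1)] arrow_in_paths[OF \<beta>(1)]
    by (auto intro: path_span_basis simp: paths_to_def arrow_def)
  then have "\<phi> (arrow Q \<beta>) \<in> component N (deg \<beta> + p)" by (rule graded_homD(5)[OF \<phi>])
  then show "\<phi> (arrow Q \<beta>) = \<zero>\<^bsub>N\<^esub>" using N_neg[of "deg \<beta> + p"] deg_nonpos[OF \<beta>(1)] p by simp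
qed

text \<open>A path of length at least 2 is \<open>\<beta> p\<close> with \<open>p\<close>
  nontrivial, and \<open>p\<close> annihilates the simple module. Minimality acts through this
  lemma: differentials of arrows are sent to zero.\<close>

lemma rad_hom_simple:
  assumes \<phi>: "\<phi> \<in> graded_hom A p (rad i) (shift n (simple_module j))" and j: "j \<in> verts Q"
    and y: "y \<in> path_span (paths_to 2 i)"
  shows "\<phi> y = (\<lambda>_. 0)"
  using y
proof (induction rule: path_span_induct)
  note hom = graded_homD(1-4)[OF \<phi>, unfolded right_ideal_simps shift_simple_module_simps]
  {
    case zero
    show ?case using hom(3)[OF path_span_zero, of 0] by simp
  next
    case (add r c y)
    obtain u p \<beta> where r: "(u, p, tail Q \<beta>) \<in> paths Q" "\<beta> \<in> arcs Q" "head Q \<beta> = i"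
      "basis r = arrow Q \<beta> \<cdot> basis (u, p, tail Q \<beta>)" "2 \<le> Suc (length p)"
      by (rule paths_to_cases[OF add(1)]) (simp, blast)
    have \<beta>: "arrow Q \<beta> \<in> (path_span (paths_to 1 i) :: (('v, 'e) path \<Rightarrow> 'k) set)"
      unfolding arrow_def using r arrow_in_paths[OF r(2)] by (auto intro: path_span_basis simp: paths_to_def)
    have "basis (u, p, tail Q \<beta>) (j, [], j) = 0" using r(5) by (auto simp: path_basis_def)
    then have "\<phi> (basis r) = (\<lambda>_. 0)"
      using r by (simp add: hom(4)[OF \<beta>] path_span_basis)
    moreover have "basis r \<in> path_span (paths_to 1 i)" "y \<in> path_span (paths_to 1 i)"
      using path_span_basis[OF add(1)] add(2) paths_to_mono by (metis one_le_numeral)+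
    ultimately show ?case using add(3) hom(2,3) by (simp add: path_span_scalar)
  }
qed

end

section \<open>Generators of the resolution, and lifts of the projection\<close>

context simple_resolution
begin

text \<open>The shifted radical inside the cone. It lowers degrees by one, and its failure to
  respect the differentials is the term \<open>g0 y\<close> in
  \<open>inj1_differential\<close>.\<close>

definition inj1 :: "(('v, 'e) path \<Rightarrow> 'k) \<Rightarrow> 'u" where "inj1 y = \<iota> (\<lambda>_. 0, y)"

definition g0 :: 'u where "g0 = \<iota> (basis (i, [], i), \<lambda>_. 0)"

lemma E1_span: "y \<in> E1 \<Longrightarrow> y \<in> path_span (paths Q)"
  by (rule paths_to_span)

lemma e_E0: "basis (i, [], i) \<in> E0"
  using i by (auto intro: path_span_basis simp: paths_to_def Q.trivial_in_paths_iff)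

lemma inj1_simps:
  assumes "y \<in> E1"
  shows "inj1 y \<in> carrier P" "p1 (inj1 y) = (\<lambda>_. 0)" "p2 (inj1 y) = y"
  using assms by (simp_all only: inj1_def \<iota>_mem p_\<iota> path_span_zero)

lemma g0_simps: "g0 \<in> carrier P" "p1 g0 = basis (i, [], i)" "p2 g0 = (\<lambda>_. 0)"
  by (simp_all only: g0_def \<iota>_mem p_\<iota> path_span_zero e_E0)

lemma g0_degree: "g0 \<in> component P 0"
proof -
  have "basis (i, [], i) \<in> component A 0"
    using i by (auto intro: path_span_basis simp: path_degree_def Q.trivial_in_paths_iff)
  then show ?thesis by (simp add: P_component g0_simps path_span_zero)
qed

lemma g0_differential: "differential P g0 = \<zero>\<^bsub>P\<^esub>"
  using i by (simp add: P_eq_iff P_simps g0_simps \<delta>_trivial \<delta>_zero)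

lemma P_decompose: "u \<in> carrier P \<Longrightarrow> u = act P g0 (p1 u) \<oplus>\<^bsub>P\<^esub> inj1 (p2 u)"
  using idempotent_mult[OF i P_mem(1)] P_mem(2)
  by (simp add: P_eq_iff P_simps g0_simps inj1_simps mult_zero_left)

lemma inj1_hom: "inj1 \<in> graded_hom A (-1) (rad i) P"
proof (rule graded_homI, unfold right_ideal_simps)
  fix x m assume x: "x \<in> E1 \<inter> component A m"
  then show "inj1 x \<in> component P (m + - 1)"
    by (simp add: P_component inj1_simps path_span_zero)
next
  fix x a assume x: "x \<in> E1" "a \<in> carrier A"
  then have "x \<cdot> a \<in> E1" by (simp add: paths_to_mult)
  then show "inj1 (x \<cdot> a) = act P (inj1 x) a"
    using x by (simp add: P_eq_iff P_simps inj1_simps mult_zero_left)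
next
  fix x y assume "x \<in> E1" "y \<in> E1"
  moreover from this have "(\<lambda>r. x r + y r) \<in> E1" by (rule path_span_add)
  ultimately show "inj1 (\<lambda>r. x r + y r) = inj1 x \<oplus>\<^bsub>P\<^esub> inj1 y"
    by (simp add: P_eq_iff P_simps inj1_simps)
next
  fix x c assume "x \<in> E1"
  moreover from this have "(\<lambda>r. c * x r) \<in> E1" by (rule path_span_scalar)
  ultimately show "inj1 (\<lambda>r. c * x r) = c \<odot>\<^bsub>P\<^esub> inj1 x"
    by (simp add: P_eq_iff P_simps inj1_simps)
qed (simp add: inj1_simps)

lemma \<delta>_E1: "y \<in> E1 \<Longrightarrow> \<delta> y \<in> E1"
  by (rule paths_to_mono[OF \<delta>_paths_to]) auto

lemma inj1_differential:
  "y \<in> E1 \<Longrightarrow> differential P (inj1 y) = act P g0 y \<oplus>\<^bsub>P\<^esub> (- 1) \<odot>\<^bsub>P\<^esub> inj1 (\<delta> y)"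
  using idempotent_mult[OF i, of y 1] \<delta>_E1[of y] paths_to_span[of y 1 i]
  by (simp add: P_eq_iff P_simps inj1_simps g0_simps \<delta>_zero mult_zero_left)

lemma arrow_E1: "\<beta> \<in> arcs Q \<Longrightarrow> head Q \<beta> = i \<Longrightarrow> arrow Q \<beta> \<in> E1"
  unfolding arrow_def using arrow_in_paths[of \<beta>] by (auto intro: path_span_basis simp: paths_to_def)

lemma hom_P_eqI:
  assumes \<phi>: "\<phi> \<in> graded_hom A p P N" and \<psi>: "\<psi> \<in> graded_hom A p P N" and N: "dg_right_module A N"
    and g0: "\<phi> g0 = \<psi> g0"
    and eq: "\<And>\<beta>. \<beta> \<in> arcs Q \<Longrightarrow> head Q \<beta> = i \<Longrightarrow> \<phi> (inj1 (arrow Q \<beta>)) = \<psi> (inj1 (arrow Q \<beta>))"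
    and u: "u \<in> carrier P"
  shows "\<phi> u = \<psi> u"
proof -
  have "\<phi> (inj1 (p2 u)) = \<psi> (inj1 (p2 u))"
    by (rule rad_hom_eqI[OF graded_hom_comp[OF inj1_hom \<phi>] graded_hom_comp[OF inj1_hom \<psi>] N _ P_mem(2)[OF u]])
      (rule eq)
  moreover have "\<phi> (act P g0 (p1 u)) = \<psi> (act P g0 (p1 u))"
    using u g0 by (simp add: graded_homD(4)[OF \<phi>] graded_homD(4)[OF \<psi>] g0_simps P_mem_span)
  moreover have "\<phi> u = \<phi> (act P g0 (p1 u)) \<oplus>\<^bsub>N\<^esub> \<phi> (inj1 (p2 u))" "\<psi> u = \<psi> (act P g0 (p1 u)) \<oplus>\<^bsub>N\<^esub> \<psi> (inj1 (p2 u))"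
    using P_decompose[OF u] graded_homD(2)[OF \<phi>, of "act P g0 (p1 u)" "inj1 (p2 u)"]
      graded_homD(2)[OF \<psi>, of "act P g0 (p1 u)" "inj1 (p2 u)"] u inj1_simps(1)[OF P_mem(2)[OF u]]
    by (simp_all add: P_simps g0_simps)
  ultimately show ?thesis by simp
qed

lemma S_dg: "dg_right_module A S"
  by (rule simple_module_dg(1)[OF i])

lemma S_neg: "m < 0 \<Longrightarrow> component S m = {\<zero>\<^bsub>S\<^esub>}"
  by simp

lemma quasi_iso_exact:
  assumes "dg_right_module A Z" "quasi_iso A Z S s" "x \<in> cocycles Z m" "s x = \<zero>\<^bsub>S\<^esub>"
  shows "x \<in> coboundaries Z m"
  using assms quasi_iso_simple_iff[OF assms(1), of s] by (auto simp: quasi_iso_def)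

lemma act_hom:
  assumes Z: "dg_right_module A Z" and z: "z \<in> component Z p"
  shows "(\<lambda>y. act Z z y) \<in> graded_hom A p (rad i) Z"
proof -
  interpret Z: dg_right_module A Z by (rule Z)
  have zZ: "z \<in> carrier Z" by (rule Z.M.component_carrier[OF z])
  show ?thesis
  proof (rule graded_homI, unfold right_ideal_simps)
    fix x m assume "x \<in> E1 \<inter> component A m"
    then show "act Z z x \<in> component Z (m + p)" using Z.act_degree[OF z, of x m] by (simp add: add.commute)
  next
    fix x y assume "x \<in> E1" "y \<in> E1"
    then show "act Z z (\<lambda>r. x r + y r) = act Z z x \<oplus>\<^bsub>Z\<^esub> act Z z y"
      using Z.act_add_right[OF zZ, of x y] E1_span by simp
  next
    fix c x assume "x \<in> E1"
    then show "act Z z (\<lambda>r. c * x r) = c \<odot>\<^bsub>Z\<^esub> act Z z x"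
      using Z.act_smult_right[OF zZ, of x c] E1_span by simp
  next
    fix x a assume "x \<in> E1" "a \<in> carrier A"
    then show "act Z z (x \<cdot> a) = act Z (act Z z x) a"
      using Z.act_mult[OF zZ, of x a] E1_span by simp
  next
    fix x assume "x \<in> E1"
    then show "act Z z x \<in> carrier Z" using Z.act_closed[OF zZ, of x] E1_span by simp
  qed
qed

text \<open>Choose a cocycle \<open>z\<close> over the idempotent \<open>e\<^sub>i\<close> and send
  \<open>(x, y)\<close> to \<open>z x + \<sigma> y\<close>. Compatibility with the differentials
  requires \<open>d (\<sigma> y) = z y - \<sigma> (\<delta> y)\<close>, which is the lifting
  equation with \<open>q = -1\<close> and \<open>\<tau> y = z y\<close>. The composite with
  \<open>s\<close> is \<open>\<pi>\<close> exactly, because \<open>s \<sigma>\<close> has degree -1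
  and so vanishes on the radical.\<close>

lemma lift_exists:
  assumes Z: "dg_right_module A Z" and s: "quasi_iso A Z S s"
  shows "\<exists>\<sigma>\<in>dg_hom A P Z. \<forall>u\<in>carrier P. s (\<sigma> u) = \<pi> u"
proof -
  interpret Z: dg_right_module A Z by (rule Z)
  have s_dg: "s \<in> dg_hom A Z S" using s by (simp add: quasi_iso_def)
  then have s_gr: "s \<in> graded_hom A 0 Z S" by (simp add: dg_hom_def)
  obtain z where z: "z \<in> cocycles Z 0" "s z = basis (i, [], i)"
    using quasi_iso_simple_iff[OF Z s_dg] s path_span_basis[of "(i, [], i)" "{(i, [], i)}"] by (metis singletonI)
  have z0: "z \<in> component Z 0" "differential Z z = \<zero>\<^bsub>Z\<^esub>" using z by (auto simp: cocycles_def)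
  note zZ = Z.M.component_carrier[OF z0(1)]
  have z_act: "act Z z y \<in> carrier Z" if "y \<in> path_span (paths Q)" for y
    using Z.act_closed[OF zZ, of y] that by simp
  have dz: "differential Z (act Z z y) = act Z z (\<delta> y)" if "y \<in> path_span (paths Q)" for y
    using Z.act_leibniz[OF z0(1), of y] that Z.act_zero_left[of y]
    by (simp add: z0(2) Z.M.scalar_one z_act \<delta>_closed)
  have \<tau>: "act Z z \<in> graded_hom A (- 1 + 1) (rad i) Z"
    using act_hom[OF Z z0(1)] by simp
  have s_act: "s (act Z z y) = (\<lambda>r. y (i, [], i) * basis (i, [], i) r)" if "y \<in> path_span (paths Q)" for y
    using graded_homD(4)[OF s_gr zZ that] by (simp add: z(2))
  have neg: "(- 1 :: int) < 0" by simp
  have "\<exists>\<sigma>\<in>graded_hom A (- 1) (rad i) Z. \<forall>y\<in>carrier (rad i).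
      differential Z (\<sigma> y) = act Z z y \<oplus>\<^bsub>Z\<^esub> ((- 1) powi (- 1)) \<odot>\<^bsub>Z\<^esub> \<sigma> (\<delta> y)"
  proof (rule lift_rad[OF Z S_dg s_gr S_neg quasi_iso_exact[OF Z s] \<tau> neg])
    fix y assume "y \<in> carrier (rad i)"
    then have y: "y \<in> E1" "y \<in> path_span (paths Q)" using E1_span by auto
    \<comment> \<open>An element of the radical has no coefficient at the trivial path, so it
      annihilates the image of \<open>z\<close>.\<close>
    show "s (act Z z y) = \<zero>\<^bsub>S\<^esub>" using y E1_trivial[OF y(1)] by (simp add: s_act)
    show "differential Z (act Z z y) \<oplus>\<^bsub>Z\<^esub> ((- 1) powi (- 1)) \<odot>\<^bsub>Z\<^esub> act Z z (\<delta> y) = \<zero>\<^bsub>Z\<^esub>"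
      using Z.M.neg_eq_scalar[OF z_act[OF \<delta>_closed[OF y(2)]]] Z.M.M.r_neg[OF z_act[OF \<delta>_closed[OF y(2)]]]
      by (simp add: dz[OF y(2)])
  qed
  then obtain \<sigma> where \<sigma>: "\<sigma> \<in> graded_hom A (- 1) (rad i) Z"
    and d\<sigma>: "\<And>y. y \<in> E1 \<Longrightarrow> differential Z (\<sigma> y) = act Z z y \<oplus>\<^bsub>Z\<^esub> (- 1) \<odot>\<^bsub>Z\<^esub> \<sigma> (\<delta> y)"
    by auto
  note \<sigma>_simps = graded_homD(1-4)[OF \<sigma>, unfolded right_ideal_simps]
  define f where "f u = act Z z (p1 u) \<oplus>\<^bsub>Z\<^esub> \<sigma> (p2 u)" for u
  have "f \<in> graded_hom A 0 P Z"
  proof (rule graded_homI)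
    fix u assume u: "u \<in> carrier P"
    then show "f u \<in> carrier Z" by (simp add: f_def P_mem_span z_act \<sigma>_simps P_mem[simplified])
  next
    fix u v assume u: "u \<in> carrier P" and v: "v \<in> carrier P"
    then show "f (u \<oplus>\<^bsub>P\<^esub> v) = f u \<oplus>\<^bsub>Z\<^esub> f v"
      using Z.act_add_right[OF zZ, of "p1 u" "p1 v"] \<sigma>_simps(2)[OF P_mem(2)[OF u] P_mem(2)[OF v]]
        \<sigma>_simps(1)[OF P_mem(2)[OF u]] \<sigma>_simps(1)[OF P_mem(2)[OF v]]
      by (simp add: f_def P_simps z_act Z.M.M.a_ac)
  next
    fix c u assume u: "u \<in> carrier P"
    then show "f (c \<odot>\<^bsub>P\<^esub> u) = c \<odot>\<^bsub>Z\<^esub> f u"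
      using Z.act_smult_right[OF zZ, of "p1 u" c] \<sigma>_simps(3)[OF P_mem(2)[OF u]] \<sigma>_simps(1)[OF P_mem(2)[OF u]]
      by (simp add: f_def P_simps z_act Z.M.scalar_add_right)
  next
    fix u a assume u: "u \<in> carrier P" and a: "a \<in> carrier A"
    then show "f (act P u a) = act Z (f u) a"
      using Z.act_mult[OF zZ, of "p1 u" a] \<sigma>_simps(4)[OF P_mem(2)[OF u]] \<sigma>_simps(1)[OF P_mem(2)[OF u]]
        Z.act_add_left[of "act Z z (p1 u)" "\<sigma> (p2 u)" a]
      by (simp add: f_def P_simps z_act)
  next
    fix m u assume "u \<in> component P m"
    then have u: "u \<in> carrier P" "p1 u \<in> component A m" "p2 u \<in> component A (m + 1)" by (auto simp: P_component)
    then show "f u \<in> component Z (m + 0)"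
      using Z.act_degree[OF z0(1) u(2)] graded_homD(5)[OF \<sigma>, of "p2 u" "m + 1"] P_mem(2)[OF u(1)]
      by (simp add: f_def Z.M.component_add)
  qed
  moreover have "f (differential P u) = differential Z (f u)" if u: "u \<in> carrier P" for u
  proof -
    note E1u = P_mem(2)[OF u]
    note cl = \<sigma>_simps(1)[OF E1u] \<sigma>_simps(1)[OF \<delta>_E1[OF E1u]]
    have "f (differential P u) = act Z z (\<delta> (p1 u)) \<oplus>\<^bsub>Z\<^esub> act Z z (p2 u) \<oplus>\<^bsub>Z\<^esub> (- 1) \<odot>\<^bsub>Z\<^esub> \<sigma> (\<delta> (p2 u))"
      using u Z.act_add_right[OF zZ, of "\<delta> (p1 u)" "p2 u"] \<sigma>_simps(3)[OF \<delta>_E1[OF E1u], of "- 1"]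
      by (simp add: f_def P_simps \<delta>_closed)
    also have "\<dots> = differential Z (f u)"
      using u cl by (simp add: f_def Z.M.differential_add z_act P_simps dz d\<sigma>[OF E1u] Z.M.M.a_assoc
          \<delta>_closed Z.M.scalar_closed)
    finally show ?thesis .
  qed
  ultimately have "f \<in> dg_hom A P Z" by (simp add: dg_hom_def)
  moreover have "s (f u) = \<pi> u" if u: "u \<in> carrier P" for u
  proof -
    have "s (\<sigma> (p2 u)) = \<zero>\<^bsub>S\<^esub>"
      by (rule rad_hom_zero[OF graded_hom_comp[OF \<sigma> s_gr] _ S_dg S_neg P_mem(2)[OF u]]) simp
    then show ?thesis
      using graded_homD(2)[OF s_gr z_act \<sigma>_simps(1)[OF P_mem(2)[OF u]], of "p1 u"] u
      by (auto simp: f_def P_mem_span s_act \<pi>_def path_basis_def)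
  qed
  ultimately show ?thesis by blast
qed

end

section \<open>Roofs and maps out of the resolution\<close>

context simple_resolution
begin

lemma hom_S_neg:
  assumes \<phi>: "\<phi> \<in> graded_hom A (- 1) P S" and u: "u \<in> carrier P"
  shows "\<phi> u = (\<lambda>_. 0)"
proof -
  have "(\<lambda>_. \<zero>\<^bsub>S\<^esub>) \<in> graded_hom A (- 1) P S"
    by (rule graded_homI) (auto simp: path_span_zero)
  moreover have "\<phi> g0 = (\<lambda>_. 0)" using graded_homD(5)[OF \<phi> g0_degree] by simp
  moreover have "\<phi> (inj1 (arrow Q \<beta>)) = (\<lambda>_. 0)" if "\<beta> \<in> arcs Q" "head Q \<beta> = i" for \<beta>
    using rad_hom_zero[OF graded_hom_comp[OF inj1_hom \<phi>] _ S_dg S_neg arrow_E1[OF that]] by simp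
  ultimately show ?thesis using hom_P_eqI[OF \<phi> _ S_dg _ _ u, of "\<lambda>_. \<zero>\<^bsub>S\<^esub>"] by simp
qed

end

text \<open>\<open>n\<close> is the degree of the Ext group. The generator belonging to an arrow
  \<open>\<beta>\<close> has degree \<open>deg \<beta> - 1\<close> and the target sits in degree
  \<open>- n\<close>, hence the arrows with \<open>deg \<beta> = 1 - n\<close>.\<close>

locale simple_ext = simple_resolution Q deg \<delta> i \<iota>
  for Q :: "('v, 'e) pre_digraph" and deg :: "'e \<Rightarrow> int"
    and \<delta> :: "(('v, 'e) path \<Rightarrow> 'k::field) \<Rightarrow> (('v, 'e) path \<Rightarrow> 'k)"
    and i :: 'v and \<iota> :: "(('v, 'e) path \<Rightarrow> 'k) \<times> (('v, 'e) path \<Rightarrow> 'k) \<Rightarrow> 'u" +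
  fixes j :: 'v and n :: int
  assumes j: "j \<in> verts Q" and n: "n \<ge> 1"
    and finite_arrows: "finite {\<alpha> \<in> arcs Q. tail Q \<alpha> = j \<and> head Q \<alpha> = i \<and> deg \<alpha> = 1 - n}"
begin

abbreviation T :: "('k, ('v, 'e) path \<Rightarrow> 'k, ('v, 'e) path \<Rightarrow> 'k) dg_module" where
  "T \<equiv> shift n (simple_module j)"

lemma T_dg: "dg_right_module A T"
  by (rule simple_module_dg(2)[OF j])

lemma T_act_arrow: "act T x (arrow Q \<beta>) = (\<lambda>_. 0)"
  by (auto simp: arrow_def path_basis_def)

text \<open>The generator \<open>g0\<close> has degree 0 while \<open>T\<close> sits in degree
  \<open>- n < 0\<close>, so it contributes nothing. Arrows of other degrees are sent to zero by
  degrees, and those with another tail because \<open>\<beta>\<close> is fixed by the idempotent at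
  its tail.\<close>

lemma hom_T_eqI:
  assumes \<phi>: "\<phi> \<in> graded_hom A 0 P T" and \<psi>: "\<psi> \<in> graded_hom A 0 P T"
    and eq: "\<And>\<beta>. \<beta> \<in> arcs Q \<Longrightarrow> tail Q \<beta> = j \<Longrightarrow> head Q \<beta> = i \<Longrightarrow> deg \<beta> = 1 - n \<Longrightarrow>
      \<phi> (inj1 (arrow Q \<beta>)) (j, [], j) = \<psi> (inj1 (arrow Q \<beta>)) (j, [], j)"
    and u: "u \<in> carrier P"
  shows "\<phi> u = \<psi> u"
proof (rule hom_P_eqI[OF \<phi> \<psi> T_dg _ _ u])
  show "\<phi> g0 = \<psi> g0"
    using graded_homD(5)[OF \<phi> g0_degree] graded_homD(5)[OF \<psi> g0_degree] n by simp
next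
  fix \<beta> assume \<beta>: "\<beta> \<in> arcs Q" "head Q \<beta> = i"
  note arr = arrow_E1[OF \<beta>]
  have deg\<beta>: "inj1 (arrow Q \<beta>) \<in> component P (deg \<beta> + - 1)"
    using graded_homD(5)[OF inj1_hom, of "arrow Q \<beta>" "deg \<beta>"] arr arrow_degree[OF \<beta>(1)] by simp
  have tail: "x (inj1 (arrow Q \<beta>)) (j, [], j) = 0" if x: "x \<in> graded_hom A 0 P T" and "tail Q \<beta> \<noteq> j" for x
  proof -
    let ?e = "basis (tail Q \<beta>, [], tail Q \<beta>)"
    have e: "?e \<in> path_span (paths Q)" using \<beta> by (auto intro: path_span_basis simp: Q.trivial_in_paths_iff)
    have "arrow Q \<beta> \<cdot> ?e = arrow Q \<beta>"
      using \<beta> arrow_in_paths[OF \<beta>(1)] by (simp add: arrow_def mult_basis Q.trivial_in_paths_iff)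
    then have "inj1 (arrow Q \<beta>) = act P (inj1 (arrow Q \<beta>)) ?e"
      using arr e graded_homD(4)[OF inj1_hom, of "arrow Q \<beta>" ?e] by simp
    then have "x (inj1 (arrow Q \<beta>)) = act T (x (inj1 (arrow Q \<beta>))) ?e"
      using graded_homD(4)[OF x inj1_simps(1)[OF arr] e] by simp
    then have "x (inj1 (arrow Q \<beta>)) (j, [], j) = ?e (j, [], j) * x (inj1 (arrow Q \<beta>)) (j, [], j)"
      by (metis shift_simple_module_simps(7))
    then show ?thesis using that(2) by (simp add: path_basis_def)
  qed
  have val: "x (inj1 (arrow Q \<beta>)) \<in> component T (deg \<beta> - 1)" if "x \<in> graded_hom A 0 P T" for x
    using graded_homD(5)[OF that deg\<beta>] by simp
  have at_j: "\<phi> (inj1 (arrow Q \<beta>)) (j, [], j) = \<psi> (inj1 (arrow Q \<beta>)) (j, [], j)"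
  proof (cases "deg \<beta> = 1 - n \<and> tail Q \<beta> = j")
    case True
    then show ?thesis using eq \<beta> by blast
  next
    case False
    then show ?thesis using tail[OF \<phi>] tail[OF \<psi>] val[OF \<phi>] val[OF \<psi>] by (auto split: if_splits)
  qed
  have "x (inj1 (arrow Q \<beta>)) r = 0" if "x \<in> graded_hom A 0 P T" "r \<noteq> (j, [], j)" for x r
    using graded_homD(1)[OF that(1) inj1_simps(1)[OF arr]] that(2) by (auto simp: path_span_def)
  then show "\<phi> (inj1 (arrow Q \<beta>)) = \<psi> (inj1 (arrow Q \<beta>))"
    using at_j \<phi> \<psi> by (intro ext) metis
qed

text \<open>The boundary of the generator is \<open>g0 \<beta> - inj1 (\<delta> \<beta>)\<close>.
  Arrows annihilate \<open>T\<close>, which disposes of the first term, and minimality disposes of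
  the second. As \<open>T\<close> has zero differential, homotopies into it are invisible on
  arrows.\<close>

lemma hom_T_differential:
  assumes h: "h \<in> graded_hom A (- 1) P T" and \<beta>: "\<beta> \<in> arcs Q" "head Q \<beta> = i"
  shows "h (differential P (inj1 (arrow Q \<beta>))) = (\<lambda>_. 0)"
proof -
  note arr = arrow_E1[OF \<beta>]
  have arrQ: "arrow Q \<beta> \<in> path_span (paths Q)" by (rule arrow_closed[OF \<beta>(1)])
  have \<delta>: "\<delta> (arrow Q \<beta>) \<in> path_span (paths_to 2 i)" using \<delta>_arrow_paths_to[OF \<beta>(1)] \<beta>(2) by simp
  have "h (inj1 (\<delta> (arrow Q \<beta>))) = (\<lambda>_. 0)"
    by (rule rad_hom_simple[OF graded_hom_comp[OF inj1_hom h] j \<delta>])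
  moreover have "h (act P g0 (arrow Q \<beta>)) = (\<lambda>_. 0)"
    using graded_homD(4)[OF h g0_simps(1) arrQ] by (simp only: T_act_arrow)
  moreover have "act P g0 (arrow Q \<beta>) \<in> carrier P" "inj1 (\<delta> (arrow Q \<beta>)) \<in> carrier P"
    using P_act(1)[OF g0_simps(1) arrQ] inj1_simps(1)[OF \<delta>_E1[OF arr]] by simp_all
  ultimately show ?thesis
    using graded_homD(2)[OF h] graded_homD(3)[OF h] P_smult(1) by (simp add: inj1_differential[OF arr])
qed

text \<open>Two lifts of \<open>\<pi>\<close> differ by a null-homotopic map \<open>\<rho>\<close>. A null-homotopy consists of \<open>w\<close> with
  \<open>dw = \<rho> g0\<close> and of a map \<open>H\<close> on the radical. On an arrow \<open>\<beta>\<close> it expresses \<open>\<rho>\<close> through \<open>d(H \<beta>)\<close>,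
  \<open>H(\<delta> \<beta>)\<close> and \<open>w \<beta>\<close>, and \<open>f\<close> annihilates all three.\<close>

lemma lift_unique:
  assumes Z: "dg_right_module A Z" and s: "quasi_iso A Z S s" and f: "f \<in> dg_hom A Z T"
    and \<sigma>: "\<sigma> \<in> dg_hom A P Z" and \<sigma>': "\<sigma>' \<in> dg_hom A P Z"
    and eq: "\<And>u. u \<in> carrier P \<Longrightarrow> s (\<sigma> u) = s (\<sigma>' u)"
    and u: "u \<in> carrier P"
  shows "f (\<sigma> u) = f (\<sigma>' u)"
proof -
  interpret Z: dg_right_module A Z by (rule Z)
  have s_gr: "s \<in> graded_hom A 0 Z S" using s by (simp add: quasi_iso_def dg_hom_def)
  have f_gr: "f \<in> graded_hom A 0 Z T" and f_d: "\<And>x. x \<in> carrier Z \<Longrightarrow> f (differential Z x) = (\<lambda>_. 0)"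
    using f by (auto simp: dg_hom_def)
  have \<sigma>_gr: "\<sigma> \<in> graded_hom A 0 P Z" "\<sigma>' \<in> graded_hom A 0 P Z" using \<sigma> \<sigma>' by (auto simp: dg_hom_def)
  note \<sigma>Z = graded_homD(1)[OF \<sigma>_gr(1)] graded_homD(1)[OF \<sigma>_gr(2)]
  define \<rho> where "\<rho> u = \<sigma> u \<oplus>\<^bsub>Z\<^esub> (- 1) \<odot>\<^bsub>Z\<^esub> \<sigma>' u" for u
  have "\<rho> \<in> dg_hom A P Z" unfolding \<rho>_def by (rule dg_hom_combine[OF \<sigma> \<sigma>' Z P_dg])
  then have \<rho>: "\<rho> \<in> graded_hom A 0 P Z" and \<rho>d: "\<And>u. u \<in> carrier P \<Longrightarrow> differential Z (\<rho> u) = \<rho> (differential P u)"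
    by (auto simp: dg_hom_def)
  note \<rho>_simps = graded_homD(1-4)[OF \<rho>]
  have s\<rho>: "s (\<rho> u) = (\<lambda>_. 0)" if "u \<in> carrier P" for u
    using \<sigma>Z[OF that] eq[OF that]
    by (simp add: \<rho>_def graded_homD(2,3)[OF s_gr] Z.M.scalar_closed)
  have s_neg: "s x = (\<lambda>_. 0)" if "x \<in> component Z m" "m < 0" for x m
    using graded_homD(5)[OF s_gr that(1)] that(2) by simp
  have \<rho>zero: "\<rho> \<zero>\<^bsub>P\<^esub> = \<zero>\<^bsub>Z\<^esub>"
    using \<rho>_simps(3)[OF P_zero(1), of 0] \<rho>_simps(1)[OF P_zero(1)] P.M.scalar_zero_left[OF P_zero(1)]
    by (simp add: Z.M.scalar_zero_left)
  have "\<rho> g0 \<in> cocycles Z 0"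
    using graded_homD(5)[OF \<rho> g0_degree] \<rho>d[OF g0_simps(1)] by (simp add: cocycles_def g0_differential \<rho>zero)
  then have "\<rho> g0 \<in> coboundaries Z 0"
    using quasi_iso_exact[OF Z s] s\<rho>[OF g0_simps(1)] by simp
  \<comment> \<open>Exactness applies because \<open>\<rho> g0\<close> is a cocycle killed by
    \<open>s\<close>.\<close>
  then obtain w where w: "w \<in> component Z (- 1)" "\<rho> g0 = differential Z w"
    by (rule Z.M.coboundariesE) simp
  note wZ = Z.M.component_carrier[OF w(1)]
  have w_act: "act Z w y \<in> carrier Z" if "y \<in> path_span (paths Q)" for y
    using Z.act_closed[OF wZ, of y] that by simp
  have dw: "differential Z (act Z w y) = \<rho> (act P g0 y) \<oplus>\<^bsub>Z\<^esub> (- 1) \<odot>\<^bsub>Z\<^esub> act Z w (\<delta> y)"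
    if "y \<in> path_span (paths Q)" for y
    using Z.act_leibniz[OF w(1), of y] that \<rho>_simps(4)[OF g0_simps(1) that] by (simp add: w(2))
  \<comment> \<open>A null-homotopy \<open>(x, y) \<mapsto> w x + H y\<close> of
    \<open>\<rho>\<close> has to satisfy
    \<open>d (H y) = \<rho> (inj1 y) - w y + H (\<delta> y)\<close>. This is the lifting equation
    with \<open>q = -2\<close>: the homotopy and \<open>inj1\<close> both have degree -1.\<close>
  define \<tau> where "\<tau> y = \<rho> (inj1 y) \<oplus>\<^bsub>Z\<^esub> (- 1) \<odot>\<^bsub>Z\<^esub> act Z w y" for y
  have \<rho>inj: "(\<lambda>y. \<rho> (inj1 y)) \<in> graded_hom A (- 2 + 1) (rad i) Z"
    using graded_hom_comp[OF inj1_hom \<rho>] by simp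
  have w_hom: "(\<lambda>y. act Z w y) \<in> graded_hom A (- 2 + 1) (rad i) Z"
    using act_hom[OF Z w(1)] by simp
  have "(\<lambda>y. \<rho> (inj1 y) \<oplus>\<^bsub>Z\<^esub> (- 1) \<odot>\<^bsub>Z\<^esub> act Z w y) \<in> graded_hom A (- 2 + 1) (rad i) Z"
    by (rule graded_hom_combine[OF \<rho>inj w_hom Z]) simp
  then have \<tau>: "\<tau> \<in> graded_hom A (- 2 + 1) (rad i) Z" by (simp add: \<tau>_def[abs_def])
  have neg: "(- 2 :: int) < 0" by simp
  have "\<exists>H\<in>graded_hom A (- 2) (rad i) Z. \<forall>y\<in>carrier (rad i).
      differential Z (H y) = \<tau> y \<oplus>\<^bsub>Z\<^esub> ((- 1) powi (- 2)) \<odot>\<^bsub>Z\<^esub> H (\<delta> y)"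
  proof (rule lift_rad[OF Z S_dg s_gr S_neg quasi_iso_exact[OF Z s] \<tau> neg])
    fix y assume "y \<in> carrier (rad i)"
    then have y: "y \<in> E1" by simp
    have yQ: "y \<in> path_span (paths Q)" by (rule E1_span[OF y])
    have \<delta>y: "\<delta> y \<in> E1" "\<delta> y \<in> path_span (paths Q)" using \<delta>_E1[OF y] E1_span by auto
    note cl = \<rho>_simps(1)[OF inj1_simps(1)[OF y]] \<rho>_simps(1)[OF inj1_simps(1)[OF \<delta>y(1)]] w_act[OF yQ] w_act[OF \<delta>y(2)]
      \<rho>_simps(1)[OF P_act(1)[OF g0_simps(1) yQ]]
    show "s (\<tau> y) = \<zero>\<^bsub>S\<^esub>"
      using cl s\<rho>[OF inj1_simps(1)[OF y]] graded_homD(4)[OF s_gr wZ yQ] s_neg[OF w(1)]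
      by (simp add: \<tau>_def graded_homD(2,3)[OF s_gr] Z.M.scalar_closed)
    have "\<rho> (differential P (inj1 y)) = \<rho> (act P g0 y) \<oplus>\<^bsub>Z\<^esub> (- 1) \<odot>\<^bsub>Z\<^esub> \<rho> (inj1 (\<delta> y))"
      using \<rho>_simps(2)[OF P_act(1)[OF g0_simps(1) yQ] P_smult(1)[OF inj1_simps(1)[OF \<delta>y(1)]]]
        \<rho>_simps(3)[OF inj1_simps(1)[OF \<delta>y(1)]] by (simp add: inj1_differential[OF y])
    then have "differential Z (\<tau> y) = \<rho> (act P g0 y) \<oplus>\<^bsub>Z\<^esub> (- 1) \<odot>\<^bsub>Z\<^esub> \<rho> (inj1 (\<delta> y)) \<oplus>\<^bsub>Z\<^esub>
        (- 1) \<odot>\<^bsub>Z\<^esub> (\<rho> (act P g0 y) \<oplus>\<^bsub>Z\<^esub> (- 1) \<odot>\<^bsub>Z\<^esub> act Z w (\<delta> y))"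
      using cl by (simp add: \<tau>_def Z.M.differential_add Z.M.differential_scalar \<rho>d[OF inj1_simps(1)[OF y]]
          dw[OF yQ] Z.M.scalar_closed)
    then have "differential Z (\<tau> y) = (- 1) \<odot>\<^bsub>Z\<^esub> \<rho> (inj1 (\<delta> y)) \<oplus>\<^bsub>Z\<^esub> act Z w (\<delta> y)"
      using cl by (simp add: Z.M.scalar_simps Z.M.M.a_ac Z.M.neg_eq_scalar[symmetric] Z.M.M.r_neg)
    then show "differential Z (\<tau> y) \<oplus>\<^bsub>Z\<^esub> ((- 1) powi (- 2)) \<odot>\<^bsub>Z\<^esub> \<tau> (\<delta> y) = \<zero>\<^bsub>Z\<^esub>"
      using cl by (simp add: \<tau>_def Z.M.scalar_simps Z.M.M.a_ac Z.M.neg_eq_scalar[symmetric] Z.M.M.r_neg1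
          Z.M.M.r_neg2 Z.M.M.r_neg)
  qed
  then obtain H where H: "H \<in> graded_hom A (- 2) (rad i) Z"
    and dH: "\<And>y. y \<in> E1 \<Longrightarrow> differential Z (H y) = \<tau> y \<oplus>\<^bsub>Z\<^esub> H (\<delta> y)"
    using graded_homD(1)[of _ "- 2" "rad i" Z] \<delta>_E1 by (auto simp: Z.M.scalar_one)
  note HZ = graded_homD(1)[OF H, unfolded right_ideal_simps]
  have "f (\<rho> (inj1 (arrow Q \<beta>))) = (\<lambda>_. 0)" if \<beta>: "\<beta> \<in> arcs Q" "head Q \<beta> = i" for \<beta>
  proof -
    let ?\<beta> = "arrow Q \<beta> :: ('v, 'e) path \<Rightarrow> 'k"
    note arr = arrow_E1[OF \<beta>]
    have arrQ: "?\<beta> \<in> path_span (paths Q)" by (rule arrow_closed[OF \<beta>(1)])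
    have \<delta>: "\<delta> ?\<beta> \<in> path_span (paths_to 2 i)" using \<delta>_arrow_paths_to[OF \<beta>(1)] \<beta>(2) by simp
    note \<tau>Z = graded_homD(1)[OF \<tau>, unfolded right_ideal_simps, OF arr]
    have "f (H (\<delta> ?\<beta>)) = (\<lambda>_. 0)" by (rule rad_hom_simple[OF graded_hom_comp[OF H f_gr] j \<delta>])
    moreover have "f (differential Z (H ?\<beta>)) = (\<lambda>_. 0)" by (rule f_d[OF HZ[OF arr]])
    ultimately have "f (\<tau> ?\<beta>) = (\<lambda>_. 0)"
      using graded_homD(2)[OF f_gr \<tau>Z HZ[OF \<delta>_E1[OF arr]]] by (simp add: dH[OF arr])
    moreover have "f (act Z w ?\<beta>) = (\<lambda>_. 0)"
      using graded_homD(4)[OF f_gr wZ arrQ] by (simp only: T_act_arrow)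
    ultimately show ?thesis
      using graded_homD(2,3)[OF f_gr] \<rho>_simps(1)[OF inj1_simps(1)[OF arr]] w_act[OF arrQ]
      by (simp add: \<tau>_def Z.M.scalar_closed)
  qed
  then have "f (\<sigma> (inj1 (arrow Q \<beta>))) (j, [], j) = f (\<sigma>' (inj1 (arrow Q \<beta>))) (j, [], j)"
    if "\<beta> \<in> arcs Q" "head Q \<beta> = i" for \<beta>
    using that \<sigma>Z[OF inj1_simps(1)[OF arrow_E1[OF that]]]
    by (force simp: \<rho>_def graded_homD(2,3)[OF f_gr] Z.M.scalar_closed fun_eq_iff)
  then show ?thesis
    using hom_T_eqI[OF graded_hom_comp[OF \<sigma>_gr(1) f_gr, simplified] graded_hom_comp[OF \<sigma>_gr(2) f_gr, simplified] _ u]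
    by blast
qed

definition lift :: "('k, 'u, ('v, 'e) path \<Rightarrow> 'k) dg_module \<Rightarrow> ('u \<Rightarrow> ('v, 'e) path \<Rightarrow> 'k) \<Rightarrow> 'u \<Rightarrow> 'u" where
  "lift Z s = (SOME \<sigma>. \<sigma> \<in> dg_hom A P Z \<and> (\<forall>u\<in>carrier P. s (\<sigma> u) = \<pi> u))"

lemma lift:
  assumes "dg_right_module A Z" "quasi_iso A Z S s"
  shows "lift Z s \<in> dg_hom A P Z" "\<And>u. u \<in> carrier P \<Longrightarrow> s (lift Z s u) = \<pi> u"
proof -
  have "\<exists>\<sigma>. \<sigma> \<in> dg_hom A P Z \<and> (\<forall>u\<in>carrier P. s (\<sigma> u) = \<pi> u)"
    using lift_exists[OF assms] by blast
  from someI_ex[OF this] show "lift Z s \<in> dg_hom A P Z" "\<And>u. u \<in> carrier P \<Longrightarrow> s (lift Z s u) = \<pi> u"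
    unfolding lift_def by blast+
qed

text \<open>The right leg pulled back to \<open>P\<close> along a chosen lift of
  \<open>\<pi>\<close> through the left leg.\<close>

definition roof_map :: "('k, 'u, ('v, 'e) path \<Rightarrow> 'k, ('v, 'e) path \<Rightarrow> 'k, ('v, 'e) path \<Rightarrow> 'k) roof \<Rightarrow>
    'u \<Rightarrow> ('v, 'e) path \<Rightarrow> 'k" where
  "roof_map = (\<lambda>(Z, s, f) u. f (lift Z s u))"

lemma roof_map_hom:
  assumes "is_roof A S T (Z, s, f)"
  shows "roof_map (Z, s, f) \<in> dg_hom A P T"
  using dg_hom_comp[OF lift(1)] assms by (auto simp: roof_map_def is_roof_def)

text \<open>By \<open>lift_unique\<close> the choice of the lift is immaterial, so any strict lift
  at hand may be used to compute the map.\<close>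

lemma roof_map_eq:
  assumes r: "is_roof A S T (Z, s, f)" and \<sigma>: "\<sigma> \<in> dg_hom A P Z" "\<And>u. u \<in> carrier P \<Longrightarrow> s (\<sigma> u) = \<pi> u"
    and u: "u \<in> carrier P"
  shows "roof_map (Z, s, f) u = f (\<sigma> u)"
proof -
  have Z: "dg_right_module A Z" "quasi_iso A Z S s" "f \<in> dg_hom A Z T" using r by (auto simp: is_roof_def)
  show ?thesis
    using lift_unique[OF Z lift(1)[OF Z(1,2)] \<sigma>(1) _ u] lift(2)[OF Z(1,2)] \<sigma>(2) by (simp add: roof_map_def)
qed

text \<open>From left to right, lift \<open>\<pi>\<close> to the common apex \<open>W\<close>; the
  two homotopies, pulled back to \<open>P\<close>, become equalities. From right to left,
  \<open>P\<close> with the two lifts as legs is a common apex, and zero homotopies suffice.\<close>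

lemma roof_equiv_iff:
  assumes r: "is_roof A S T (Z, s, f)" and r': "is_roof A S T (Z', s', f')"
  shows "roof_equiv A S T (Z, s, f) (Z', s', f') \<longleftrightarrow>
    (\<forall>u\<in>carrier P. roof_map (Z, s, f) u = roof_map (Z', s', f') u)"
proof
  have Z: "dg_right_module A Z" "quasi_iso A Z S s" "f \<in> dg_hom A Z T" using r by (auto simp: is_roof_def)
  have Z': "dg_right_module A Z'" "quasi_iso A Z' S s'" "f' \<in> dg_hom A Z' T" using r' by (auto simp: is_roof_def)
  {
    assume "roof_equiv A S T (Z, s, f) (Z', s', f')"
    then obtain W :: "('k, 'u, ('v, 'e) path \<Rightarrow> 'k) dg_module" and g g' where W: "dg_right_module A W"
      and g: "g \<in> dg_hom A W Z" "g' \<in> dg_hom A W Z'" and q: "quasi_iso A W S (s \<circ> g)"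
      and hS: "homotopic A W S (s \<circ> g) (s' \<circ> g')" and hT: "homotopic A W T (f \<circ> g) (f' \<circ> g')"
      by (auto simp: roof_equiv_def)
    define \<rho> where "\<rho> = lift W (s \<circ> g)"
    have \<rho>: "\<rho> \<in> dg_hom A P W" and s\<rho>: "\<And>u. u \<in> carrier P \<Longrightarrow> s (g (\<rho> u)) = \<pi> u"
      using lift[OF W q] by (auto simp: \<rho>_def)
    have \<rho>_gr: "\<rho> \<in> graded_hom A 0 P W" and \<rho>d: "\<And>u. u \<in> carrier P \<Longrightarrow> differential W (\<rho> u) = \<rho> (differential P u)"
      using \<rho> by (auto simp: dg_hom_def)
    note \<rho>W = graded_homD(1)[OF \<rho>_gr]
    have hom: "(\<lambda>u. g (\<rho> u)) \<in> dg_hom A P Z" "(\<lambda>u. g' (\<rho> u)) \<in> dg_hom A P Z'"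
      "(\<lambda>u. s (g (\<rho> u))) \<in> dg_hom A P S" "(\<lambda>u. s' (g' (\<rho> u))) \<in> dg_hom A P S"
      "(\<lambda>u. f (g (\<rho> u))) \<in> dg_hom A P T" "(\<lambda>u. f' (g' (\<rho> u))) \<in> dg_hom A P T"
      using dg_hom_comp[OF \<rho> g(1)] dg_hom_comp[OF \<rho> g(2)] Z Z' by (auto simp: quasi_iso_def intro: dg_hom_comp)
    have hom_gr: "(\<lambda>u. s (g (\<rho> u))) \<in> graded_hom A 0 P S" "(\<lambda>u. s' (g' (\<rho> u))) \<in> graded_hom A 0 P S"
      "(\<lambda>u. f (g (\<rho> u))) \<in> graded_hom A 0 P T" "(\<lambda>u. f' (g' (\<rho> u))) \<in> graded_hom A 0 P T"
      using hom by (auto simp: dg_hom_def)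
    obtain h where h: "h \<in> graded_hom A (- 1) W S"
      "\<And>x. x \<in> carrier W \<Longrightarrow> s (g x) \<ominus>\<^bsub>S\<^esub> s' (g' x) = differential S (h x) \<oplus>\<^bsub>S\<^esub> h (differential W x)"
      using hS by (auto simp: homotopic_def)
    \<comment> \<open>The apex is only known to commute with \<open>s'\<close> up to homotopy.
      Equality is needed for \<open>g' \<rho>\<close> to be a strict lift through \<open>s'\<close>;
      it holds since the homotopy is a map of degree -1 from \<open>P\<close> to
      \<open>S\<close>.\<close>
    have "s' (g' (\<rho> u)) = \<pi> u" if u: "u \<in> carrier P" for u
    proof -
      have "(\<lambda>u. h (\<rho> u)) \<in> graded_hom A (- 1) P S" using graded_hom_comp[OF \<rho>_gr h(1)] by simp
      then have "h (\<rho> (differential P u)) = (\<lambda>_. 0)" using hom_S_neg P_diff(1)[OF u] by blast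
      then have "s (g (\<rho> u)) \<ominus>\<^bsub>S\<^esub> s' (g' (\<rho> u)) = (\<lambda>_. 0)"
        using h(2)[OF \<rho>W[OF u]] by (simp add: \<rho>d[OF u])
      then show ?thesis
        using S_minus(1)[OF i, of "s (g (\<rho> u))" "s' (g' (\<rho> u))"] graded_homD(1)[OF hom_gr(1) u]
          graded_homD(1)[OF hom_gr(2) u] s\<rho>[OF u] by simp
    qed
    note lifts = roof_map_eq[OF r hom(1) s\<rho>] roof_map_eq[OF r' hom(2) this]
    obtain k where k: "k \<in> graded_hom A (- 1) W T"
      "\<And>x. x \<in> carrier W \<Longrightarrow> f (g x) \<ominus>\<^bsub>T\<^esub> f' (g' x) = differential T (k x) \<oplus>\<^bsub>T\<^esub> k (differential W x)"
      using hT by (auto simp: homotopic_def)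
    have k\<rho>: "(\<lambda>u. k (\<rho> u)) \<in> graded_hom A (- 1) P T" using graded_hom_comp[OF \<rho>_gr k(1)] by simp
    have "f (g (\<rho> (inj1 (arrow Q \<beta>)))) = f' (g' (\<rho> (inj1 (arrow Q \<beta>))))"
      if \<beta>: "\<beta> \<in> arcs Q" "head Q \<beta> = i" for \<beta>
    proof -
      let ?u = "inj1 (arrow Q \<beta>)"
      have u: "?u \<in> carrier P" by (rule inj1_simps(1)[OF arrow_E1[OF \<beta>]])
      have "k (\<rho> (differential P ?u)) = (\<lambda>_. 0)" by (rule hom_T_differential[OF k\<rho> \<beta>])
      then have "f (g (\<rho> ?u)) \<ominus>\<^bsub>T\<^esub> f' (g' (\<rho> ?u)) = (\<lambda>_. 0)"
        using k(2)[OF \<rho>W[OF u]] by (simp add: \<rho>d[OF u])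
      then show ?thesis
        using S_minus(2)[OF j, of "f (g (\<rho> ?u))" "f' (g' (\<rho> ?u))"] graded_homD(1)[OF hom_gr(3) u]
          graded_homD(1)[OF hom_gr(4) u] by simp
    qed
    then have "f (g (\<rho> u)) = f' (g' (\<rho> u))" if "u \<in> carrier P" for u
      using hom_T_eqI[OF hom_gr(3,4) _ that] by simp
    then show "\<forall>u\<in>carrier P. roof_map (Z, s, f) u = roof_map (Z', s', f') u" using lifts by simp
  }
  {
    assume eq: "\<forall>u\<in>carrier P. roof_map (Z, s, f) u = roof_map (Z', s', f') u"
    let ?\<sigma> = "lift Z s" and ?\<sigma>' = "lift Z' s'"
    note \<sigma> = lift[OF Z(1,2)] and \<sigma>' = lift[OF Z'(1,2)]
    have s_dg: "s \<circ> ?\<sigma> \<in> dg_hom A P S"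
      using dg_hom_comp[OF \<sigma>(1)] Z(2) by (auto simp: quasi_iso_def comp_def)
    have "quasi_iso A P S (s \<circ> ?\<sigma>)"
    proof -
      interpret P: dg_right_module A P by (rule P_dg)
      have "(s \<circ> ?\<sigma>) x = \<pi> x" if "x \<in> cocycles P m" for x m
        using \<sigma>(2) P.M.cocycles_carrier[OF that] by simp
      then show ?thesis
        using \<pi>_quasi_iso unfolding quasi_iso_simple_iff[OF P_dg s_dg] quasi_iso_simple_iff[OF P_dg \<pi>_dg_hom]
        by metis
    qed
    moreover have "homotopic A P N a b"
      if N: "dg_right_module A N" and ab: "\<And>u. u \<in> carrier P \<Longrightarrow> a u = b u \<and> b u \<in> carrier N" for N :: "('k, ('v, 'e) path \<Rightarrow> 'k, ('v, 'e) path \<Rightarrow> 'k) dg_module" and a b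
    proof -
      interpret N: dg_right_module A N by (rule N)
      have "(\<lambda>_. \<zero>\<^bsub>N\<^esub>) \<in> graded_hom A (- 1) P N"
        by (rule graded_homI) (auto simp: N.M.scalar_zero_right N.act_zero_left N.M.component_zero)
      moreover have "a u \<ominus>\<^bsub>N\<^esub> b u = differential N \<zero>\<^bsub>N\<^esub> \<oplus>\<^bsub>N\<^esub> \<zero>\<^bsub>N\<^esub>" if "u \<in> carrier P" for u
        using ab[OF that] N.M.minus_zero_iff[of "b u" "b u"] by (simp add: N.M.differential_zero)
      ultimately show ?thesis
        unfolding homotopic_def by (intro bexI[where x = "\<lambda>_. \<zero>\<^bsub>N\<^esub>"] ballI)
    qed
    note homotopic = this
    have "homotopic A P S (s \<circ> ?\<sigma>) (s' \<circ> ?\<sigma>')"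
      using \<sigma>(2) \<sigma>'(2) graded_homD(1)[of \<pi> 0 P S] \<pi>_dg_hom by (intro homotopic[OF S_dg]) (auto simp: dg_hom_def)
    moreover have "homotopic A P T (f \<circ> ?\<sigma>) (f' \<circ> ?\<sigma>')"
      using eq graded_homD(1)[of "roof_map (Z', s', f')" 0 P T] roof_map_hom[OF r']
      by (intro homotopic[OF T_dg]) (auto simp: dg_hom_def roof_map_def)
    ultimately show "roof_equiv A S T (Z, s, f) (Z', s', f')"
      unfolding roof_equiv_def using P_dg \<sigma>(1) \<sigma>'(1) by auto
  }
qed

end

section \<open>The vector space of classes of roofs\<close>

text \<open>\<open>W\<close> carries only operations at the start; the axioms are read off through
  the bijection \<open>K\<close>, which then is a linear isomorphism and preserves the
  dimension.\<close>

lemma vectorspace_transport: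
  fixes V :: "('k::field, 'a, 'z) module_scheme" and W :: "('k, 'b, 'y) module_scheme"
  assumes V: "vectorspace class_ring V" and fin: "vectorspace.fin_dim class_ring V"
    and inj: "inj_on K (carrier V)" and carrier: "carrier W = K ` carrier V" and zero: "\<zero>\<^bsub>W\<^esub> = K \<zero>\<^bsub>V\<^esub>"
    and add: "\<And>x y. x \<in> carrier V \<Longrightarrow> y \<in> carrier V \<Longrightarrow> K x \<oplus>\<^bsub>W\<^esub> K y = K (x \<oplus>\<^bsub>V\<^esub> y)"
    and smult: "\<And>c x. x \<in> carrier V \<Longrightarrow> c \<odot>\<^bsub>W\<^esub> K x = K (c \<odot>\<^bsub>V\<^esub> x)"
  shows "vectorspace class_ring W \<and> vectorspace.fin_dim class_ring W \<and>
    vectorspace.dim class_ring W = vectorspace.dim class_ring V"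
proof -
  interpret V: vectorspace class_ring V by (rule V)
  have "Module.module class_ring W"
  proof (rule module_criteria)
    show "\<forall>v\<in>carrier W. \<exists>w\<in>carrier W. v \<oplus>\<^bsub>W\<^esub> w = \<zero>\<^bsub>W\<^esub>"
    proof
      fix v assume "v \<in> carrier W"
      then obtain x where x: "x \<in> carrier V" "v = K x" by (auto simp: carrier)
      then have "v \<oplus>\<^bsub>W\<^esub> K (\<ominus>\<^bsub>V\<^esub> x) = \<zero>\<^bsub>W\<^esub>" by (simp add: add zero V.M.r_neg)
      with x show "\<exists>w\<in>carrier W. v \<oplus>\<^bsub>W\<^esub> w = \<zero>\<^bsub>W\<^esub>" by (auto simp: carrier)
    qed
  qed (use V.smult_l_distr V.smult_assoc1 V.smult_one in
      \<open>auto simp: carrier zero add smult class_cring.cring_axioms V.M.a_ac V.smult_r_distr\<close>)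
  then have W: "vectorspace class_ring W" by (simp add: vectorspace_def class_field)
  have "K \<in> LinearCombinations.module_hom class_ring V W"
    by (auto simp: LinearCombinations.module_hom_def carrier add smult)
  then interpret K: linear_map class_ring V W K
    using V W by (simp add: linear_map_def mod_hom_def mod_hom_axioms_def vectorspace_def)
  show ?thesis
    using W K.surj_fin_dim[OF fin] K.dim_eq[OF fin inj] carrier by simp
qed

section \<open>Coefficient vectors of roofs, and the operations on classes\<close>

context simple_ext
begin

abbreviation B :: "'e set" where
  "B \<equiv> {\<alpha> \<in> arcs Q. tail Q \<alpha> = j \<and> head Q \<alpha> = i \<and> deg \<alpha> = 1 - n}"

definition b :: "nat \<Rightarrow> 'e" where "b = (SOME b. bij_betw b {0..<card B} B)"

lemma b: "bij_betw b {0..<card B} B"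
  unfolding b_def by (rule someI_ex[OF ex_bij_betw_nat_finite[OF finite_arrows]])

lemma b_mem:
  assumes "k < card B"
  shows "b k \<in> arcs Q" "tail Q (b k) = j" "head Q (b k) = i" "deg (b k) = 1 - n"
  using bij_betwE[OF b] assms by auto

type_synonym ('k1, 'u1, 'v1, 'e1) simple_roof =
  "('k1, 'u1, ('v1, 'e1) path \<Rightarrow> 'k1, ('v1, 'e1) path \<Rightarrow> 'k1, ('v1, 'e1) path \<Rightarrow> 'k1) roof"

definition val :: "('k, 'u, 'v, 'e) simple_roof \<Rightarrow> 'k vec" where
  "val r = vec (card B) (\<lambda>k. roof_map r (inj1 (arrow Q (b k))) (j, [], j))"

lemma val_carrier: "val r \<in> carrier_vec (card B)"
  by (simp add: val_def)

lemma inj1_b: "k < card B \<Longrightarrow> inj1 (arrow Q (b k)) \<in> carrier P"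
  using b_mem by (intro inj1_simps(1) arrow_E1) auto

lemma roof_equiv_iff_val:
  assumes r: "is_roof A S T r" and r': "is_roof A S T r'"
  shows "roof_equiv A S T r r' \<longleftrightarrow> val r = val r'"
proof -
  obtain Z s f where r_eq: "r = (Z, s, f)" by (cases r)
  obtain Z' s' f' where r'_eq: "r' = (Z', s', f')" by (cases r')
  have hom: "roof_map r \<in> graded_hom A 0 P T" "roof_map r' \<in> graded_hom A 0 P T"
    using roof_map_hom r r' unfolding r_eq r'_eq by (auto simp: dg_hom_def)
  have "(\<forall>u\<in>carrier P. roof_map r u = roof_map r' u) \<longleftrightarrow> val r = val r'"
  proof
    assume "\<forall>u\<in>carrier P. roof_map r u = roof_map r' u"
    then show "val r = val r'" unfolding val_def by (intro eq_vecI) (auto simp: inj1_b)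
  next
    assume eq: "val r = val r'"
    have "roof_map r (inj1 (arrow Q \<beta>)) (j, [], j) = roof_map r' (inj1 (arrow Q \<beta>)) (j, [], j)"
      if "\<beta> \<in> B" for \<beta>
    proof -
      have "\<beta> \<in> b ` {0..<card B}" using that bij_betw_imp_surj_on[OF b] by blast
      then obtain k where "k < card B" "\<beta> = b k" by auto
      then show ?thesis using arg_cong[OF eq, of "\<lambda>v. v $ k"] by (simp add: val_def)
    qed
    then show "\<forall>u\<in>carrier P. roof_map r u = roof_map r' u" using hom_T_eqI[OF hom] by simp
  qed
  then show ?thesis using roof_equiv_iff r r' by (simp add: r_eq r'_eq)
qed

definition roof_fibre :: "'k vec \<Rightarrow> ('k, 'u, 'v, 'e) simple_roof set" where
  "roof_fibre v = {r. is_roof A S T r \<and> val r = v}"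

text \<open>Equivalence of roofs is equality of coefficient vectors, so it is an equivalence
  relation and its classes are fibres.\<close>

lemma roof_class_eq: "is_roof A S T r \<Longrightarrow> roof_class A S T r = roof_fibre (val r)"
  unfolding roof_class_def roof_fibre_def by (rule Collect_cong) (metis roof_equiv_iff_val)

text \<open>The map that vanishes on \<open>g0\<close> and takes the value \<open>v $ k\<close> on
  the arrow \<open>b k\<close>: it reads off the coefficients at these arrows in the second
  entry.\<close>

definition hom_of_vec :: "'k vec \<Rightarrow> 'u \<Rightarrow> ('v, 'e) path \<Rightarrow> 'k" where
  "hom_of_vec v u = (\<lambda>r. if r = (j, [], j) then \<Sum>k<card B. v $ k * p2 u (j, [b k], i) else 0)"

lemma hom_of_vec_dg_hom: "hom_of_vec v \<in> dg_hom A P T"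
proof -
  have "hom_of_vec v \<in> graded_hom A 0 P T"
  proof (rule graded_homI)
    fix u a assume u: "u \<in> carrier P" and a: "a \<in> carrier A"
    \<comment> \<open>The other summand in \<open>mult_arrow\<close> contains the coefficient of
      \<open>p2 u\<close> at the trivial path, which is zero on the radical.\<close>
    have "(p2 u \<cdot> a) (j, [b k], i) = a (j, [], j) * p2 u (j, [b k], i)" if "k < card B" for k
      using mult_arrow[OF b_mem(1)[OF that], of "p2 u" a] b_mem[OF that] E1_trivial[OF P_mem(2)[OF u]] by simp
    then show "hom_of_vec v (act P u a) = act T (hom_of_vec v u) a"
      using u a by (simp add: hom_of_vec_def P_simps sum_distrib_left fun_eq_iff mult.left_commute)
  next
    fix m u assume u: "u \<in> component P m"
    have "p2 u (j, [b k], i) = 0" if "k < card B" "m \<noteq> - n" for k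
      using u that b_mem[OF that(1)] by (auto simp: P_component path_span_def path_degree_def)
    then show "hom_of_vec v u \<in> component T (m + 0)"
      by (cases "m = - n") (auto simp: hom_of_vec_def path_span_def)
  qed (auto simp: hom_of_vec_def P_simps path_span_def sum.distrib sum_distrib_left algebra_simps)
  moreover have "hom_of_vec v (differential P u) = (\<lambda>_. 0)" if u: "u \<in> carrier P" for u
  proof -
    \<comment> \<open>By minimality differentials have no coefficients at arrows, so every choice of
      scalars gives a chain map.\<close>
    have "\<delta> (p2 u) (j, [b k], i) = 0" for k
      using \<delta>_paths_to[OF P_mem(2)[OF u]] by (auto simp: path_span_def paths_to_def)
    then show ?thesis using u by (simp add: hom_of_vec_def P_simps fun_eq_iff)
  qed
  ultimately show ?thesis by (simp add: dg_hom_def)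
qed

text \<open>Every vector is realised over the same left leg \<open>\<pi>\<close>. This gives
  surjectivity of \<open>val\<close>, and also representatives with a common left leg for any two
  classes, as addition requires. The identity of \<open>P\<close> is a strict lift of
  \<open>\<pi>\<close> through itself, so no other lift enters the computation.\<close>

lemma roof_of_vec:
  assumes "v \<in> carrier_vec (card B)"
  shows "(P, \<pi>, hom_of_vec v) \<in> roof_fibre v"
proof -
  have r: "is_roof A S T (P, \<pi>, hom_of_vec v)"
    by (simp add: is_roof_def P_dg \<pi>_quasi_iso hom_of_vec_dg_hom)
  have id: "(\<lambda>u. u) \<in> dg_hom A P P" by (auto simp: dg_hom_def intro: graded_homI)
  have "roof_map (P, \<pi>, hom_of_vec v) (inj1 (arrow Q (b k))) (j, [], j) = v $ k" if k: "k < card B" for k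
  proof -
    have coeff: "p2 (inj1 (arrow Q (b k))) (j, [b l], i) = (if l = k then 1 else 0)" if "l < card B" for l
      using b that k b_mem[OF k] inj1_simps(3)[OF arrow_E1[OF b_mem(1,3)[OF k]]]
      by (auto simp: arrow_def path_basis_def bij_betw_def inj_on_def)
    have "hom_of_vec v (inj1 (arrow Q (b k))) (j, [], j) =
        (\<Sum>l<card B. v $ l * p2 (inj1 (arrow Q (b k))) (j, [b l], i))"
      by (simp add: hom_of_vec_def)
    also have "\<dots> = (\<Sum>l<card B. if l = k then v $ k else 0)"
      by (intro sum.cong refl) (simp add: coeff)
    finally have "hom_of_vec v (inj1 (arrow Q (b k))) (j, [], j) = (\<Sum>l<card B. if l = k then v $ k else 0)" .
    then show ?thesis using roof_map_eq[OF r id _ inj1_b[OF k]] k by simp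
  qed
  then have "val (P, \<pi>, hom_of_vec v) = v"
    unfolding val_def using assms by (intro eq_vecI) auto
  with r show ?thesis by (simp add: roof_fibre_def)
qed

lemma roof_map_apply: "roof_map (Z, s, f) u = f (lift Z s u)"
  by (simp add: roof_map_def)

text \<open>One statement for both operations: \<open>c = 1\<close> gives sums, and \<open>f\<close>
  zero gives scalar multiples.\<close>

lemma roof_combine:
  assumes f: "is_roof A S T (Z, s, f)" and g: "is_roof A S T (Z, s, g)"
  shows "is_roof A S T (Z, s, \<lambda>z. f z \<oplus>\<^bsub>T\<^esub> c \<odot>\<^bsub>T\<^esub> g z)"
    and "val (Z, s, \<lambda>z. f z \<oplus>\<^bsub>T\<^esub> c \<odot>\<^bsub>T\<^esub> g z) = val (Z, s, f) + c \<cdot>\<^sub>v val (Z, s, g)"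
proof -
  show "is_roof A S T (Z, s, \<lambda>z. f z \<oplus>\<^bsub>T\<^esub> c \<odot>\<^bsub>T\<^esub> g z)"
    using f g dg_hom_combine[OF _ _ T_dg, of f Z g c] by (auto simp: is_roof_def)
  show "val (Z, s, \<lambda>z. f z \<oplus>\<^bsub>T\<^esub> c \<odot>\<^bsub>T\<^esub> g z) = val (Z, s, f) + c \<cdot>\<^sub>v val (Z, s, g)"
    unfolding val_def by (intro eq_vecI) (auto simp: roof_map_apply)
qed

lemma zero_roof:
  assumes "is_roof A S T (Z, s, f)"
  shows "is_roof A S T (Z, s, \<lambda>_. \<zero>\<^bsub>T\<^esub>)" "val (Z, s, \<lambda>_. \<zero>\<^bsub>T\<^esub>) = 0\<^sub>v (card B)"
proof -
  have "(\<lambda>_. \<zero>\<^bsub>T\<^esub>) \<in> dg_hom A Z T"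
    by (auto simp: dg_hom_def path_span_zero intro!: graded_homI)
  then show "is_roof A S T (Z, s, \<lambda>_. \<zero>\<^bsub>T\<^esub>)" using assms by (auto simp: is_roof_def)
  show "val (Z, s, \<lambda>_. \<zero>\<^bsub>T\<^esub>) = 0\<^sub>v (card B)"
    unfolding val_def by (intro eq_vecI) (auto simp: roof_map_apply)
qed

lemma derived_hom_zero: "\<zero>\<^bsub>derived_hom TYPE('u) A S T\<^esub> = roof_fibre (0\<^sub>v (card B))"
proof -
  have "(P, \<pi>, hom_of_vec (0\<^sub>v (card B))) \<in> Collect (is_roof A S T)"
    using roof_of_vec[of "0\<^sub>v (card B)"] by (simp add: roof_fibre_def)
  moreover have "(case r of (Z, s, f) \<Rightarrow> roof_class A S T (Z, s, \<lambda>_. \<zero>\<^bsub>T\<^esub>)) = roof_fibre (0\<^sub>v (card B))"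
    if "r \<in> Collect (is_roof A S T)" for r :: "('k, 'u, 'v, 'e) simple_roof"
    using that zero_roof by (cases r) (simp add: roof_class_eq del: shift_simple_module_simps)
  ultimately have "(\<Union>r\<in>Collect (is_roof A S T). case r of (Z, s, f) \<Rightarrow> roof_class A S T (Z, s, \<lambda>_. \<zero>\<^bsub>T\<^esub>)) =
      (roof_fibre (0\<^sub>v (card B)) :: ('k, 'u, 'v, 'e) simple_roof set)"
    by blast
  then show ?thesis by (simp add: derived_hom_def)
qed

text \<open>All members of the union are the same fibre, whichever representatives are added; the
  union is nonempty because both classes have a representative with left leg
  \<open>\<pi>\<close>.\<close>

lemma derived_hom_add:
  assumes v: "v \<in> carrier_vec (card B)" and w: "w \<in> carrier_vec (card B)"
  shows "roof_fibre v \<oplus>\<^bsub>derived_hom TYPE('u) A S T\<^esub> roof_fibre w = roof_fibre (v + w)"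
proof -
  have "roof_class A S T (Z, s, \<lambda>z. f z \<oplus>\<^bsub>T\<^esub> g z) = roof_fibre (v + w)"
    if f: "(Z, s, f) \<in> roof_fibre v" and g: "(Z, s, g) \<in> roof_fibre w" for Z s f g
  proof -
    have fg: "is_roof A S T (Z, s, f)" "is_roof A S T (Z, s, g)" "val (Z, s, f) = v" "val (Z, s, g) = w"
      using f g by (auto simp: roof_fibre_def)
    have "(\<lambda>z. f z \<oplus>\<^bsub>T\<^esub> 1 \<odot>\<^bsub>T\<^esub> g z) = (\<lambda>z. f z \<oplus>\<^bsub>T\<^esub> g z)" by simp
    then show ?thesis
      using roof_combine[OF fg(1,2), of 1] fg(3,4) roof_class_eq v w by (simp del: shift_simple_module_simps)
  qed
  moreover have "(P, \<pi>, hom_of_vec v) \<in> roof_fibre v" "(P, \<pi>, hom_of_vec w) \<in> roof_fibre w"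
    using roof_of_vec v w by auto
  ultimately have "(\<Union>(Z, s, f)\<in>roof_fibre v. \<Union>g\<in>{g. (Z, s, g) \<in> roof_fibre w}.
      roof_class A S T (Z, s, \<lambda>z. f z \<oplus>\<^bsub>T\<^esub> g z)) = roof_fibre (v + w)"
    by fast
  then show ?thesis by (simp add: derived_hom_def)
qed

lemma derived_hom_smult:
  assumes v: "v \<in> carrier_vec (card B)"
  shows "c \<odot>\<^bsub>derived_hom TYPE('u) A S T\<^esub> roof_fibre v = roof_fibre (c \<cdot>\<^sub>v v)"
proof -
  have "roof_class A S T (Z, s, \<lambda>z. c \<odot>\<^bsub>T\<^esub> f z) = roof_fibre (c \<cdot>\<^sub>v v)"
    if f: "(Z, s, f) \<in> roof_fibre v" for Z s f
  proof -
    have f: "is_roof A S T (Z, s, f)" "val (Z, s, f) = v"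
      using f by (auto simp: roof_fibre_def)
    have "(\<lambda>z. \<zero>\<^bsub>T\<^esub> \<oplus>\<^bsub>T\<^esub> c \<odot>\<^bsub>T\<^esub> f z) = (\<lambda>z. c \<odot>\<^bsub>T\<^esub> f z)" by simp
    then show ?thesis
      using roof_combine[OF zero_roof(1)[OF f(1)] f(1), of c] zero_roof(2)[OF f(1)] f(2) roof_class_eq v
      by (simp del: shift_simple_module_simps)
  qed
  moreover have "(P, \<pi>, hom_of_vec v) \<in> roof_fibre v" using roof_of_vec v by auto
  ultimately have "(\<Union>(Z, s, f)\<in>roof_fibre v. roof_class A S T (Z, s, \<lambda>z. c \<odot>\<^bsub>T\<^esub> f z)) = roof_fibre (c \<cdot>\<^sub>v v)"
    by fast
  then show ?thesis by (simp add: derived_hom_def)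
qed

lemma derived_hom_carrier: "carrier (derived_hom TYPE('u) A S T) = roof_fibre ` carrier_vec (card B)"
proof -
  have "roof_class A S T ` Collect (is_roof A S T) = (\<lambda>r. roof_fibre (val r)) ` Collect (is_roof A S T)"
    by (intro image_cong refl) (simp add: roof_class_eq)
  also have "\<dots> = roof_fibre ` carrier_vec (card B)"
  proof
    show "roof_fibre ` carrier_vec (card B) \<subseteq> (\<lambda>r. roof_fibre (val r)) ` Collect (is_roof A S T)"
    proof
      fix C assume "C \<in> roof_fibre ` carrier_vec (card B)"
      then obtain v where v: "v \<in> carrier_vec (card B)" "C = roof_fibre v" by auto
      then show "C \<in> (\<lambda>r. roof_fibre (val r)) ` Collect (is_roof A S T)"
        using roof_of_vec[OF v(1)] by (intro image_eqI[where x = "(P, \<pi>, hom_of_vec v)"]) (auto simp: roof_fibre_def)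
    qed
  qed (use val_carrier in auto)
  finally show ?thesis by (simp add: derived_hom_def)
qed

lemma derived_hom_dim:
  "vectorspace class_ring (derived_hom TYPE('u) A S T) \<and>
   vectorspace.fin_dim class_ring (derived_hom TYPE('u) A S T) \<and>
   vectorspace.dim class_ring (derived_hom TYPE('u) A S T) = card B"
proof -
  interpret V: vec_space "TYPE('k)" "card B" .
  have V: "vectorspace class_ring (module_vec TYPE('k) (card B))" by (rule vec_vs)
  have "inj_on roof_fibre (carrier_vec (card B))"
  proof (rule inj_onI)
    fix v w assume "v \<in> carrier_vec (card B)" "roof_fibre v = roof_fibre w"
    then have "(P, \<pi>, hom_of_vec v) \<in> roof_fibre w" using roof_of_vec by blast
    moreover have "(P, \<pi>, hom_of_vec v) \<in> roof_fibre v" using roof_of_vec \<open>v \<in> carrier_vec _\<close> by blast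
    ultimately show "v = w" by (simp add: roof_fibre_def)
  qed
  then show ?thesis
    using vectorspace_transport[OF V V.fin_dim, of roof_fibre "derived_hom TYPE('u) A S T"]
    by (simp add: module_vec_simps derived_hom_carrier derived_hom_zero derived_hom_add derived_hom_smult V.dim_is_n)
qed

end

text \<open>An infinite universe is in bijection with its square, so it has room for pairs, hence
  for the cone.\<close>

lemma ex_inj_Times:
  assumes "infinite (UNIV :: 'u set)" "X \<lesssim> (UNIV :: 'u set)"
  shows "\<exists>\<iota> :: 'a \<times> 'a \<Rightarrow> 'u. inj_on \<iota> (X \<times> X)"
proof -
  obtain f :: "'a \<Rightarrow> 'u" where f: "inj_on f X" using assms(2) by (auto simp: lepoll_def)
  obtain h :: "'u \<times> 'u \<Rightarrow> 'u" where "bij_betw h (UNIV \<times> UNIV) (UNIV :: 'u set)"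
    using card_of_ordIso[THEN iffD2, OF card_of_Times_same_infinite[OF assms(1)]] by blast
  then have h: "inj h" by (simp add: bij_betw_def)
  have "inj_on (h \<circ> map_prod f f) (X \<times> X)"
    by (intro comp_inj_on map_prod_inj_on f inj_on_subset[OF h]) simp
  then show ?thesis by blast
qed

theorem theorem3p10:
  fixes Q :: "('v, 'e) pre_digraph"
    and deg :: "'e \<Rightarrow> int"
    and \<delta> :: "(('v, 'e) path \<Rightarrow> 'k::field) \<Rightarrow> (('v, 'e) path \<Rightarrow> 'k)"
    and A :: "('k, ('v, 'e) path \<Rightarrow> 'k) dg_space"
    and i j :: 'v and d :: nat
    and E :: "('k, ('k, 'u, ('v, 'e) path \<Rightarrow> 'k, ('v, 'e) path \<Rightarrow> 'k, ('v, 'e) path \<Rightarrow> 'k) roof set) module"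
  assumes quiver: "wf_digraph Q"
    and A_def: "A = dg_path_algebra Q deg \<delta>"
    and dg: "dg_algebra A"
    and finite_vertices: "finite (verts Q)"
    and no_positive: "{\<alpha> \<in> arcs Q. deg \<alpha> > 0} = {}"
    and finite_arrows: "\<And>m :: nat. finite {\<alpha> \<in> arcs Q. deg \<alpha> = - int m}"
    and minimal: "\<And>\<alpha>. \<alpha> \<in> arcs Q \<Longrightarrow> \<delta> (arrow Q \<alpha>) \<in> path_span {p \<in> paths Q. path_length p \<ge> 2}"
    and universe: "infinite (UNIV :: 'u set)" "carrier A \<lesssim> (UNIV :: 'u set)"
    and i: "i \<in> verts Q" and j: "j \<in> verts Q"
    and E_def: "E = Ext TYPE('u) A (int d + 1) (simple_module i) (simple_module j)"
  shows "vectorspace class_ring E \<and> vectorspace.fin_dim class_ring E \<and>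
    vectorspace.dim class_ring E =
      card {\<alpha> \<in> arcs Q. tail Q \<alpha> = j \<and> head Q \<alpha> = i \<and> deg \<alpha> = - int d}"
proof -
  have neg: "deg \<alpha> \<le> 0" if "\<alpha> \<in> arcs Q" for \<alpha> using no_positive that by fastforce
  obtain \<iota> :: "(('v, 'e) path \<Rightarrow> 'k) \<times> (('v, 'e) path \<Rightarrow> 'k) \<Rightarrow> 'u"
    where \<iota>: "inj_on \<iota> (path_span (paths Q) \<times> path_span (paths Q))"
    using ex_inj_Times[OF universe] by (auto simp: A_def dg_path_algebra_def)
  have arrows: "finite {\<alpha> \<in> arcs Q. tail Q \<alpha> = j \<and> head Q \<alpha> = i \<and> deg \<alpha> = 1 - (int d + 1)}"
    by (rule finite_subset[OF _ finite_arrows[of d]]) auto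
  interpret Q: wf_digraph Q by (rule quiver)
  interpret A: dg_algebra "dg_path_algebra Q deg \<delta>" using dg by (simp add: A_def)
  \<comment> \<open>With \<open>n = d + 1\<close> the degree \<open>1 - n\<close> of the relevant
    arrows becomes \<open>- d\<close>.\<close>
  interpret simple_ext Q deg \<delta> i \<iota> j "int d + 1"
    by unfold_locales (use neg minimal i j \<iota> arrows in auto)
  show ?thesis using derived_hom_dim by (simp add: E_def A_def Ext_def)
qed

end
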